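(* For all $n\ge2$, $\tilde\rho_{n,3}\cong S^{3^{n-2}21^2}$ as $\mathfrak S_{3n-2}$-modules.
   Context: All vector spaces are over $\mathbb C$. For $n\ge 2$, a Filippov $n$-algebra is a vector space $L$ with an $n$-linear map $[\cdot,\dots,\cdot]:L^n\to L$ satisfying $[x_1,\dots,x_n]=\mathrm{sgn}(\sigma)[x_{\sigma(1)},\dots,x_{\sigma(n)}]$ for all $\sigma\in\mathfrak S_n$, and $[[x_1,\dots,x_n],x_{n+1},\dots,x_{2n-1}]=\sum_{i=1}^n[x_1,\dots,x_{i-1},[x_i,x_{n+1},\dots,x_{2n-1}],x_{i+1},\dots,x_n]$. The free Filippov $n$-algebra on a set $X$ is generated by all $n$-ary bracketings of elements of $X$, subject only to relations following from $n$-linearity, antisymmetry and the generalized Jacobi identity. $\rho_{n,k}$ is the multilinear component of the free Filippov $n$-algebra on $[k(n-1)+1]$ (span of $n$-bracketed permutations, i.e. $n$-bracketed words using each letter exactly once), an $\mathfrak S_{k(n-1)+1}$-module by permuting letters. A bracketed permutation $[w_1,\dots,w_n]$ (each $w_i$ a single letter or a bracketed permutation) is a non-comb if either (i) for some $i\ne j$, both $w_i$ and $w_j$ have more than one letter, or (ii) some $w_i$ is a non-comb. $\tilde\rho_{n,k}$ denotes the submodule of $\rho_{n,k}$ spanned by the non-combs. $S^\lambda$ is the Specht module indexed by $\lambda$. *)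

theory Defs
  imports
    "HOL-Algebra.Sym_Groups"
    "HOL-Algebra.QuotRing"
    "HOL-Algebra.Module"
    "HOL-Algebra.Algebraic_Closure_Type"
    "HOL-Combinatorics.Permutations"
    "HOL-Library.Poly_Mapping"
begin

section \<open>Linear representations\<close>

abbreviation complex_ring :: "complex ring" where
  "complex_ring \<equiv> ring_of_type_algebra"

text \<open>
  A representation of a group is a module (in the sense of HOL-Algebra, so that the ring
  multiplication and the one of the underlying record play no role) together with an action of the
  group elements.
\<close>

record ('g, 'a, 'b) rep = "('a, 'b) module" +
  act :: "'g \<Rightarrow> 'b \<Rightarrow> 'b"

definition rep_isos ::
  "('g, 'm) monoid_scheme \<Rightarrow> ('a, 'n) ring_scheme \<Rightarrow> ('g, 'a, 'b) rep \<Rightarrow> ('g, 'a, 'c) rep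
    \<Rightarrow> ('b \<Rightarrow> 'c) set"
  where "rep_isos G R M N =
    {f. bij_betw f (carrier M) (carrier N) \<and>
        (\<forall>x \<in> carrier M. \<forall>y \<in> carrier M. f (x \<oplus>\<^bsub>M\<^esub> y) = f x \<oplus>\<^bsub>N\<^esub> f y) \<and>
        (\<forall>c \<in> carrier R. \<forall>x \<in> carrier M. f (c \<odot>\<^bsub>M\<^esub> x) = c \<odot>\<^bsub>N\<^esub> f x) \<and>
        (\<forall>g \<in> carrier G. \<forall>x \<in> carrier M. f (act M g x) = act N g (f x))}"

definition rep_isomorphic ::
  "('g, 'm) monoid_scheme \<Rightarrow> ('a, 'n) ring_scheme \<Rightarrow> ('g, 'a, 'b) rep \<Rightarrow> ('g, 'a, 'c) rep \<Rightarrow> bool"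
  where "rep_isomorphic G R M N \<longleftrightarrow> rep_isos G R M N \<noteq> {}"

definition spanned_rep ::
  "('a, 'n) ring_scheme \<Rightarrow> ('g, 'a, 'b) rep \<Rightarrow> 'b set \<Rightarrow> ('g, 'a, 'b) rep"
  where "spanned_rep R M S = M\<lparr>carrier := \<Inter>{H. submodule H R M \<and> S \<subseteq> H}\<rparr>"

text \<open>The quotient by a submodule \<open>I\<close> that is stable under the action.\<close>

definition quotient_rep :: "('g, 'a, 'b) rep \<Rightarrow> 'b set \<Rightarrow> ('g, 'a, 'b set) rep"
  where "quotient_rep M I =
    \<lparr>carrier = a_rcosets\<^bsub>M\<^esub> I, monoid.mult = undefined, one = undefined,
     zero = I, add = set_add M,
     module.smult = (\<lambda>c A. \<Union>a\<in>A. I +>\<^bsub>M\<^esub> (c \<odot>\<^bsub>M\<^esub> a)),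
     act = (\<lambda>g A. \<Union>a\<in>A. I +>\<^bsub>M\<^esub> act M g a)\<rparr>"

text \<open>
  The complex vector space with basis \<open>B\<close>, with the linear extension of an action \<open>a\<close> on the
  basis.
\<close>

definition free_rep :: "'b set \<Rightarrow> ('g \<Rightarrow> 'b \<Rightarrow> 'b) \<Rightarrow> ('g, complex, 'b \<Rightarrow>\<^sub>0 complex) rep"
  where "free_rep B a =
    \<lparr>carrier = {p. Poly_Mapping.keys p \<subseteq> B}, monoid.mult = undefined, one = undefined,
     zero = 0, add = (+),
     module.smult = (\<lambda>c p. Poly_Mapping.map ((*) c) p),
     act = (\<lambda>g p. \<Sum>b\<in>Poly_Mapping.keys p. Poly_Mapping.single (a g b) (Poly_Mapping.lookup p b))\<rparr>"

abbreviation basis_vec :: "'b \<Rightarrow> 'b \<Rightarrow>\<^sub>0 complex" where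
  "basis_vec b \<equiv> Poly_Mapping.single b 1"


section \<open>The free Filippov algebra\<close>

datatype 'x bword = Letter 'x | Bracket "'x bword list"

fun letters :: "'x bword \<Rightarrow> 'x list" where
  "letters (Letter x) = [x]"
| "letters (Bracket ws) = concat (map letters ws)"

fun nary :: "nat \<Rightarrow> 'x bword \<Rightarrow> bool" where
  "nary n (Letter x) \<longleftrightarrow> True"
| "nary n (Bracket ws) \<longleftrightarrow> length ws = n \<and> (\<forall>w \<in> set ws. nary n w)"

definition bwords :: "nat \<Rightarrow> 'x set \<Rightarrow> 'x bword set" where
  "bwords n A = {w. nary n w \<and> set (letters w) \<subseteq> A}"

text \<open>
  The free \<open>n\<close>-ary algebra on \<open>A\<close>, without any identities besides multilinearity: it has the
  bracketed words as a basis, and \<open>bracket\<close> is the multilinear extension of \<^const>\<open>Bracket\<close>.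
\<close>

definition free_nary :: "nat \<Rightarrow> 'x set \<Rightarrow> ('x \<Rightarrow> 'x, complex, 'x bword \<Rightarrow>\<^sub>0 complex) rep" where
  "free_nary n A = free_rep (bwords n A) map_bword"

definition bracket :: "('x bword \<Rightarrow>\<^sub>0 complex) list \<Rightarrow> 'x bword \<Rightarrow>\<^sub>0 complex" where
  "bracket ps = (\<Sum>ws \<in> listset (map Poly_Mapping.keys ps).
     Poly_Mapping.single (Bracket ws) (\<Prod>i<length ps. Poly_Mapping.lookup (ps ! i) (ws ! i)))"

definition nary_ideal :: "nat \<Rightarrow> 'x set \<Rightarrow> ('x bword \<Rightarrow>\<^sub>0 complex) set \<Rightarrow> bool" where
  "nary_ideal n A I \<longleftrightarrow> submodule I complex_ring (free_nary n A) \<and>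
    (\<forall>ps. length ps = n \<and> set ps \<subseteq> carrier (free_nary n A) \<and> set ps \<inter> I \<noteq> {}
       \<longrightarrow> bracket ps \<in> I)"

definition antisymmetry_relations :: "nat \<Rightarrow> 'x set \<Rightarrow> ('x bword \<Rightarrow>\<^sub>0 complex) set" where
  "antisymmetry_relations n A =
    {bracket xs - Poly_Mapping.map ((*) (of_int (sign \<sigma>))) (bracket (permute_list \<sigma> xs)) | xs \<sigma>.
      length xs = n \<and> set xs \<subseteq> carrier (free_nary n A) \<and> \<sigma> permutes {..<n}}"

definition jacobi_relations :: "nat \<Rightarrow> 'x set \<Rightarrow> ('x bword \<Rightarrow>\<^sub>0 complex) set" where
  "jacobi_relations n A =
    {bracket (bracket xs # ys) - (\<Sum>i<n. bracket (xs[i := bracket (xs ! i # ys)])) | xs ys.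
      length xs = n \<and> length ys = n - 1 \<and>
      set xs \<subseteq> carrier (free_nary n A) \<and> set ys \<subseteq> carrier (free_nary n A)}"

definition filippov_ideal :: "nat \<Rightarrow> 'x set \<Rightarrow> ('x bword \<Rightarrow>\<^sub>0 complex) set" where
  "filippov_ideal n A =
    \<Inter>{I. nary_ideal n A I \<and> antisymmetry_relations n A \<subseteq> I \<and> jacobi_relations n A \<subseteq> I}"

text \<open>The permutations of \<open>A\<close> act on the free Filippov algebra on \<open>A\<close> by permuting letters.\<close>

definition free_filippov :: "nat \<Rightarrow> 'x set \<Rightarrow> ('x \<Rightarrow> 'x, complex, ('x bword \<Rightarrow>\<^sub>0 complex) set) rep"
  where "free_filippov n A = quotient_rep (free_nary n A) (filippov_ideal n A)"

definition filippov_word :: "nat \<Rightarrow> 'x set \<Rightarrow> 'x bword \<Rightarrow> ('x bword \<Rightarrow>\<^sub>0 complex) set" where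
  "filippov_word n A w = filippov_ideal n A +>\<^bsub>free_nary n A\<^esub> basis_vec w"

definition bracketed_perms :: "nat \<Rightarrow> 'x set \<Rightarrow> 'x bword set" where
  "bracketed_perms n A = {w \<in> bwords n A. distinct (letters w) \<and> set (letters w) = A}"

inductive noncomb :: "'x bword \<Rightarrow> bool" where
  two_brackets: "i < length ws \<Longrightarrow> j < length ws \<Longrightarrow> i \<noteq> j \<Longrightarrow>
    length (letters (ws ! i)) > 1 \<Longrightarrow> length (letters (ws ! j)) > 1 \<Longrightarrow> noncomb (Bracket ws)"
| inner: "w \<in> set ws \<Longrightarrow> noncomb w \<Longrightarrow> noncomb (Bracket ws)"

definition rho :: "nat \<Rightarrow> nat \<Rightarrow> (nat \<Rightarrow> nat, complex, (nat bword \<Rightarrow>\<^sub>0 complex) set) rep" where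
  "rho n k = (let A = {1..k * (n - 1) + 1} in
     spanned_rep complex_ring (free_filippov n A) (filippov_word n A ` bracketed_perms n A))"

definition rho_tilde :: "nat \<Rightarrow> nat \<Rightarrow> (nat \<Rightarrow> nat, complex, (nat bword \<Rightarrow>\<^sub>0 complex) set) rep" where
  "rho_tilde n k = (let A = {1..k * (n - 1) + 1} in
     spanned_rep complex_ring (rho n k)
       (filippov_word n A ` {w \<in> bracketed_perms n A. noncomb w}))"


section \<open>Specht modules\<close>

text \<open>
  A partition is given by the list of its parts in weakly decreasing order. A tableau is the list
  of its rows, a tabloid the list of the sets of entries of its rows.
\<close>

definition tableaux :: "nat list \<Rightarrow> nat list list set" where
  "tableaux \<mu> = {t. map length t = \<mu> \<and> distinct (concat t) \<and> set (concat t) = {1..sum_list \<mu>}}"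

definition tabloid :: "nat list list \<Rightarrow> nat set list" where
  "tabloid t = map set t"

definition column :: "nat list list \<Rightarrow> nat \<Rightarrow> nat set" where
  "column t j = {r ! j | r. r \<in> set t \<and> j < length r}"

definition column_stabilizer :: "nat list list \<Rightarrow> (nat \<Rightarrow> nat) set" where
  "column_stabilizer t = {\<pi>. \<pi> permutes set (concat t) \<and> (\<forall>j. \<pi> ` column t j = column t j)}"

definition polytabloid :: "nat list list \<Rightarrow> nat set list \<Rightarrow>\<^sub>0 complex" where
  "polytabloid t = (\<Sum>\<pi> \<in> column_stabilizer t.
     Poly_Mapping.single (tabloid (map (map \<pi>) t)) (of_int (sign \<pi>)))"

definition permutation_module :: "nat list \<Rightarrow> (nat \<Rightarrow> nat, complex, nat set list \<Rightarrow>\<^sub>0 complex) rep"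
  where "permutation_module \<mu> = free_rep (tabloid ` tableaux \<mu>) (\<lambda>\<sigma>. map ((`) \<sigma>))"

definition specht :: "nat list \<Rightarrow> (nat \<Rightarrow> nat, complex, nat set list \<Rightarrow>\<^sub>0 complex) rep" where
  "specht \<mu> = spanned_rep complex_ring (permutation_module \<mu>) (polytabloid ` tableaux \<mu>)"

end

(*
  A tableau of shape (3^(n-2), 2, 1, 1) is recorded by two maps on the letters: its colouring (the
  column of each letter) and its tabloid. Both modules are quotients of the sign-twisted space on
  the colourings of weight (n+1, n-1, n-2): such a colouring gives a signed polytabloid on one side
  and, on the other side, the signed sum of the non-combs obtained by moving one letter from the
  first to the second colour class. The theorem says that the two quotient maps have the same kernel.

  A linear functional on the free Filippov algebra gives a function v on colourings of weight
  (n, n, n-2). With gl_3 acting on functions on colourings by moving letters between colour classes,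
  the generalized Jacobi identity and antisymmetry imply, by sl_2 theory, that v is annihilated by
  the moves into the third class and that moving a letter from the first to the second class yields a
  highest weight function from which v is recovered.

  Highest weight functions that are invariant under the stabilizer of a colouring are determined up
  to a scalar. Averaging therefore shows that the highest weight functions are exactly the
  combinations of the coefficients of the signed polytabloids, and that any nonzero one generates all
  of them. A nonzero one exists because the non-combs do not vanish in the Filippov algebra given by
  the cross product on C^(n+1), whose identity is the infinitesimal invariance of the determinant.
*)
theory Submission
  imports Defs "Jordan_Normal_Form.Determinant"
begin

text \<open>Membership in the ideal of relations is tested by the linear functionals that vanish on
  it, since the ideal is an intersection without an explicit basis. Multiplying a value by the sign
  of the word turns antisymmetry inside a bracket into independence of the order of the letters, so
  that such a functional becomes a function on colourings. Functions on the colourings by three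
  colours form the tensor power of C^3 over the letters, where gl_3 commutes with the permutations
  of the letters. The weight (n+1, n-1, n-2) is the one to aim at because these are the column
  lengths of the shape, and the weight (n, n, n-2) of a non-comb is one move short of it. Once the
  moves into the third class annihilate \<open>v\<close>, the possible types are (n+m, n-m, n-2);
  the relation \<open>v_cubic\<close> of degree three, which combines all four relations between
  combs and non-combs, singles out m = 1. On this sl_2-type the relevant eigenvalue is m(m+1) = 2,
  hence the division by 2 when a non-comb is recovered from its images.\<close>

section \<open>Recolouring letters\<close>

text \<open>
  This is \<open>g\<close> composed with the matrix unit \<open>e\<^sub>i\<^sub>j\<close> of \<open>gl\<close>; hence
  \<open>recolor A k l (recolor A i j g)\<close> is \<open>g\<close> composed with \<open>e\<^sub>i\<^sub>j e\<^sub>k\<^sub>l\<close>, with \<open>e\<^sub>k\<^sub>l\<close> applied first.\<close>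

definition recolor :: "nat set \<Rightarrow> nat \<Rightarrow> nat \<Rightarrow> ((nat \<Rightarrow> nat) \<Rightarrow> complex) \<Rightarrow> (nat \<Rightarrow> nat) \<Rightarrow> complex" where
  "recolor A i j g c = (\<Sum>x\<in>{x\<in>A. c x = j}. g (c(x := i)))"

definition cnt :: "nat set \<Rightarrow> (nat \<Rightarrow> nat) \<Rightarrow> nat \<Rightarrow> nat" where
  "cnt A c j = card {x\<in>A. c x = j}"

text \<open>A weight vector in the sense of gl: \<open>g\<close> is supported on the colourings of
  one content. Integer weights can be shifted without case distinctions, and a weight with a
  negative entry forces \<open>g\<close> to vanish.\<close>

definition has_weight :: "nat set \<Rightarrow> ((nat \<Rightarrow> nat) \<Rightarrow> complex) \<Rightarrow> (nat \<Rightarrow> int) \<Rightarrow> bool" where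
  "has_weight A g w \<longleftrightarrow> (\<forall>c. g c \<noteq> 0 \<longrightarrow> (\<forall>j. int (cnt A c j) = w j))"

lemma cnt_upd:
  assumes "finite A" "x \<in> A" "i \<noteq> c x"
  shows "int (cnt A (c(x := i)) k) = int (cnt A c k) + (if k = i then 1 else 0) - (if k = c x then 1 else 0)"
proof -
  consider "k = i" | "k = c x" | "k \<noteq> i" "k \<noteq> c x" by blast
  then show ?thesis
  proof cases
    case 1
    have "{y\<in>A. (c(x := i)) y = k} = insert x {y\<in>A. c y = k}" using 1 assms by auto
    moreover have "x \<notin> {y\<in>A. c y = k}" using 1 assms by auto
    ultimately show ?thesis using 1 assms by (simp add: cnt_def)
  next
    case 2
    have "{y\<in>A. c y = k} = insert x {y\<in>A. (c(x := i)) y = k}" using 2 assms by auto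
    moreover have "x \<notin> {y\<in>A. (c(x := i)) y = k}" using 2 assms by auto
    ultimately show ?thesis using 2 assms by (simp add: cnt_def)
  next
    case 3
    have "{y\<in>A. (c(x := i)) y = k} = {y\<in>A. c y = k}" using 3 assms by auto
    then show ?thesis using 3 by (simp add: cnt_def)
  qed
qed

lemma recolor_same: "recolor A j j g c = of_nat (cnt A c j) * g c"
  by (simp add: recolor_def cnt_def fun_upd_idem)

lemma recolor_same_weight: "has_weight A g w \<Longrightarrow> recolor A j j g = (\<lambda>c. of_int (w j) * g c)"
  unfolding has_weight_def by (rule ext) (metis mult_zero_right of_int_of_nat_eq recolor_same)

lemma recolor_weight:
  assumes "finite A" "has_weight A g w" "i \<noteq> j"
  shows "has_weight A (recolor A i j g) (w(j := w j + 1, i := w i - 1))"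
  unfolding has_weight_def
proof (intro allI impI)
  fix c k
  assume "recolor A i j g c \<noteq> 0"
  then obtain x where x: "x \<in> A" "c x = j" "g (c(x := i)) \<noteq> 0"
    unfolding recolor_def by (metis (mono_tags, lifting) mem_Collect_eq sum.neutral)
  with assms(2) have "int (cnt A (c(x := i)) k) = w k" by (simp add: has_weight_def)
  with cnt_upd[OF assms(1) x(1), of i c k] x(2) assms(3)
  show "int (cnt A c k) = (w(j := w j + 1, i := w i - 1)) k" by auto
qed

text \<open>The commutation relations of the matrix units of gl. The sum over ordered pairs of
  distinct letters is symmetric in the two moves; the correction terms come from moving the same
  letter twice.\<close>

lemma recolor_commute:
  assumes "finite A"
  shows "recolor A k l (recolor A i j g) c =
    recolor A i j (recolor A k l g) c + (if j = k then recolor A i l g c else 0)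
      - (if l = i then recolor A k j g c else 0)"
proof -
  define S where "S = (\<lambda>k l i j. \<Sum>(x, y)\<in>{(x, y). x \<in> A \<and> y \<in> A \<and> x \<noteq> y \<and> c x = l \<and> c y = j}.
      g (c(x := k, y := i)))"
  have split: "recolor A k l (recolor A i j g) c = S k l i j + (if j = k then recolor A i l g c else 0)"
    for k l i j
  proof -
    have "recolor A i j g (c(x := k)) =
      (\<Sum>y\<in>{y\<in>A. y \<noteq> x \<and> c y = j}. g (c(x := k, y := i))) + (if j = k then g (c(x := i)) else 0)"
      if "x \<in> A" for x
    proof -
      have "{y\<in>A. (c(x := k)) y = j} = {y\<in>A. y \<noteq> x \<and> c y = j} \<union> (if j = k then {x} else {})"
        using that by auto
      then show ?thesis using assms by (simp add: recolor_def)
    qed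
    then have "recolor A k l (recolor A i j g) c =
      (\<Sum>x\<in>{x\<in>A. c x = l}. \<Sum>y\<in>{y\<in>A. y \<noteq> x \<and> c y = j}. g (c(x := k, y := i)))
       + (\<Sum>x\<in>{x\<in>A. c x = l}. if j = k then g (c(x := i)) else 0)"
      unfolding recolor_def[of A k l] by (simp add: sum.distrib)
    moreover have "(\<Sum>x\<in>{x\<in>A. c x = l}. \<Sum>y\<in>{y\<in>A. y \<noteq> x \<and> c y = j}. g (c(x := k, y := i))) = S k l i j"
      unfolding S_def using assms
      by (subst sum.Sigma) (auto intro!: sum.cong)
    moreover have "(\<Sum>x\<in>{x\<in>A. c x = l}. if j = k then g (c(x := i)) else 0)
        = (if j = k then recolor A i l g c else 0)"
      by (simp add: recolor_def)
    ultimately show ?thesis by simp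
  qed
  have "S k l i j = S i j k l"
    unfolding S_def by (rule sum.reindex_bij_witness[where i = prod.swap and j = prod.swap])
      (auto simp: fun_upd_twist)
  then show ?thesis using split[of k l i j] split[of i j k l] by auto
qed

lemma recolor_add: "recolor A i j (\<lambda>c. g c + h c) = (\<lambda>c. recolor A i j g c + recolor A i j h c)"
  by (simp add: recolor_def sum.distrib fun_eq_iff)

lemma recolor_diff: "recolor A i j (\<lambda>c. g c - h c) = (\<lambda>c. recolor A i j g c - recolor A i j h c)"
  by (simp add: recolor_def sum_subtractf fun_eq_iff)

lemma recolor_mult: "recolor A i j (\<lambda>c. a * g c) = (\<lambda>c. a * recolor A i j g c)"
  by (simp add: recolor_def sum_distrib_left fun_eq_iff)

lemma recolor_zero: "recolor A i j (\<lambda>c. 0) = (\<lambda>c. 0)"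
  by (simp add: recolor_def fun_eq_iff)

lemma recolor_rename:
  assumes "inj \<tau>"
  shows "recolor A i j (\<lambda>c. g (\<tau> \<circ> c)) c = recolor A (\<tau> i) (\<tau> j) g (\<tau> \<circ> c)"
  using assms by (simp add: recolor_def inj_eq fun_upd_comp)

text \<open>In a finite-dimensional \<open>sl\<^sub>2\<close>-module the raising operator maps onto every positive weight space.\<close>

lemma recolor_inj_on_weight:
  assumes fin: "finite A" and ij: "i \<noteq> j" and g: "has_weight A g w" and pos: "w i > w j"
    and zero: "recolor A i j g = (\<lambda>c. 0)"
  shows "g = (\<lambda>c. 0)"
proof -
  define h where "h m = (recolor A j i ^^ m) g" for m
  define wh where "wh m = w(i := w i + int m, j := w j - int m)" for m
  have h0: "h 0 = g" and hS: "h (Suc m) = recolor A j i (h m)" for m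
    by (simp_all add: h_def)
  have weight: "has_weight A (h m) (wh m)" for m
  proof (induction m)
    case 0
    then show ?case using g by (simp add: h0 wh_def)
  next
    case (Suc m)
    have "wh (Suc m) = (wh m)(i := wh m i + 1, j := wh m j - 1)"
      using ij by (auto simp: wh_def fun_eq_iff)
    then show ?case using recolor_weight[OF fin Suc, of j i] ij by (simp add: hS del: fun_upd_apply)
  qed
  \<comment> \<open>The move \<open>recolor A j i\<close> only widens the gap between the two
    weights, so the usual sl_2 scalar with E F^m g = a m F^(m-1) g for E g = 0 never vanishes for
    positive m.\<close>
  define a where "a m = - (int m * (w i - w j + int m - 1))" for m
  have step: "recolor A i j (h (Suc m)) = (\<lambda>c. of_int (a (Suc m)) * h m c)" for m
  proof (induction m)
    case 0
    have "recolor A i j (h 1) c = of_int (w j - w i) * g c" for c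
      using recolor_commute[OF fin, of i j j i g c] zero ij
      by (simp add: hS h0 recolor_zero recolor_same_weight[OF g] algebra_simps)
    then show ?case by (auto simp: a_def h0 fun_eq_iff algebra_simps)
  next
    case (Suc m)
    have "recolor A i j (h (Suc (Suc m))) c = of_int (a (Suc (Suc m))) * h (Suc m) c" for c
    proof -
      have "recolor A i j (h (Suc (Suc m))) c = recolor A j i (recolor A i j (h (Suc m))) c
         + of_int (wh (Suc m) j) * h (Suc m) c - of_int (wh (Suc m) i) * h (Suc m) c"
        using recolor_commute[OF fin, of i j j i "h (Suc m)" c] ij
        by (simp add: hS[of "Suc m"] recolor_same_weight[OF weight])
      also have "recolor A j i (recolor A i j (h (Suc m))) c = of_int (a (Suc m)) * h (Suc m) c"
        unfolding Suc.IH recolor_mult by (simp add: hS)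
      finally have "recolor A i j (h (Suc (Suc m))) c
        = of_int (a (Suc m) + wh (Suc m) j - wh (Suc m) i) * h (Suc m) c" by (simp add: algebra_simps)
      also have "a (Suc m) + wh (Suc m) j - wh (Suc m) i = a (Suc (Suc m))"
        using ij by (simp add: a_def wh_def algebra_simps)
      finally show ?thesis .
    qed
    then show ?case by (simp add: fun_eq_iff)
  qed
  have neg: "a (Suc m) \<noteq> 0" for m
  proof -
    have "int (Suc m) * (w i - w j + int (Suc m) - 1) > 0" using pos by (intro mult_pos_pos) auto
    then show ?thesis unfolding a_def by linarith
  qed
  have down: "h (Suc m) = (\<lambda>c. 0) \<Longrightarrow> h m = (\<lambda>c. 0)" for m
    using step[of m] neg[of m] by (simp only: recolor_zero) (simp add: fun_eq_iff)
  \<comment> \<open>After so many moves the weight of colour \<open>j\<close> would be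
    negative.\<close>
  have "h (Suc (nat (w j))) = (\<lambda>c. 0)"
  proof (rule ext, rule ccontr)
    fix c assume "h (Suc (nat (w j))) c \<noteq> 0"
    with weight[of "Suc (nat (w j))"] have "int (cnt A c j) = wh (Suc (nat (w j))) j"
      unfolding has_weight_def by blast
    then show False using ij by (simp add: wh_def split: if_splits)
  qed
  moreover have "h m = (\<lambda>c. 0) \<Longrightarrow> h 0 = (\<lambda>c. 0)" for m
    by (induction m) (use down in auto)
  ultimately show ?thesis using h0 by metis
qed

section \<open>Relations between the values on combs and on non-combs as identities of gl_3\<close>

text \<open>
  Colours are numbered from 0; \<open>k\<close> and \<open>v\<close> are the values of a linear functional on the left-normed
  words and on the non-combs, corrected by the sign of the underlying permutation.\<close>

locale bracket_functional =
  fixes A :: "nat set" and n :: nat and k v :: "(nat \<Rightarrow> nat) \<Rightarrow> complex" and s :: complex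
  assumes fin: "finite A" and s2: "s * s = 1"
    and k_weight: "has_weight A k ((\<lambda>_. 0)(0 := int n, 1 := int n - 1, 2 := int n - 1))"
    and v_weight: "has_weight A v ((\<lambda>_. 0)(0 := int n, 1 := int n, 2 := int n - 2))"
    and v_eq_k: "v c = s * recolor A 1 2 k (id(0 := 2, 1 := 0, 2 := 1) \<circ> c)"
    and k_swap: "k c - s * k (transpose 1 2 \<circ> c) = recolor A 1 2 v (transpose 1 2 \<circ> c)"
    and k_exchange: "k c = s * recolor A 0 1 k (transpose 0 1 \<circ> c)"
    and v_swap: "v (transpose 0 1 \<circ> c) = s * v c"
begin

declare One_nat_def [simp del]

abbreviation "R \<equiv> recolor A"

lemma s_cancel: "s * (s * x) = x"
  using s2 by (simp add: mult.assoc[symmetric])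

lemma R_transpose: "R i j (\<lambda>c. g (transpose a b \<circ> c)) c =
    R (transpose a b i) (transpose a b j) g (transpose a b \<circ> c)"
  by (rule recolor_rename) simp

lemma R_cycle: "R i j (\<lambda>c. g (id(0 := 2, 1 := 0, 2 := 1) \<circ> c)) c =
    R ((id(0 := 2, 1 := 0, 2 := 1)) i) ((id(0 := 2, 1 := 0, 2 := 1)) j) g (id(0 := 2, 1 := 0, 2 := 1) \<circ> c)"
  by (rule recolor_rename) (auto simp: inj_def split: if_splits)

lemma transpose_cancel: "transpose a b \<circ> (transpose a b \<circ> c) = c"
  by (simp add: fun_eq_iff)

text \<open>Elimination of \<open>v\<close>: by \<open>v_swap\<close> the move \<open>R 1 2\<close>
  on \<open>v\<close> becomes \<open>R 0 2\<close>, and inserting \<open>v_eq_k\<close> leaves a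
  relation in \<open>k\<close> alone that involves only moves between the colours 1 and 2.\<close>

lemma k_antisymmetric_part: "k c - s * k (transpose 1 2 \<circ> c) = R 2 1 (R 1 2 k) c"
proof -
  have v: "v = (\<lambda>c. s * R 1 2 k (id(0 := 2, 1 := 0, 2 := 1) \<circ> c))"
    by (rule ext) (rule v_eq_k)
  have v': "v = (\<lambda>c. s * v (transpose 0 1 \<circ> c))"
    by (rule ext) (simp add: v_swap s_cancel)
  have 1: "R 1 2 v d = s * R 0 2 v (transpose 0 1 \<circ> d)" for d
    by (subst v') (simp add: recolor_mult R_transpose)
  have "R 1 2 v d = R 2 1 (R 1 2 k) (id(0 := 2, 1 := 0, 2 := 1) \<circ> (transpose 0 1 \<circ> d))" for d
    unfolding 1 by (subst v) (simp add: recolor_mult s_cancel R_cycle)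
  then have "R 1 2 v (transpose 1 2 \<circ> c)
      = R 2 1 (R 1 2 k) (id(0 := 2, 1 := 0, 2 := 1) \<circ> (transpose 0 1 \<circ> (transpose 1 2 \<circ> c)))" .
  also have "id(0 := 2, 1 := 0, 2 := 1) \<circ> (transpose 0 1 \<circ> (transpose 1 2 \<circ> c)) = c"
    by (auto simp: fun_eq_iff transpose_def)
  finally show ?thesis using k_swap by (simp only:)
qed

text \<open>
  With \<open>C\<close> the Casimir-like operator \<open>g \<mapsto> R 2 1 (R 1 2 g)\<close>, the relation \<open>k_antisymmetric_part\<close>
  forces \<open>C (C k) = 2 C k\<close>, so that only the \<open>sl\<^sub>2\<close>-types of spin 0 and 1 occur in \<open>k\<close>.\<close>

lemma k_exchange_twice: "R 1 2 (R 1 2 k) = (\<lambda>c. 0)"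
proof -
  let ?C = "\<lambda>g. R 2 1 (R 1 2 g)" and ?T = "\<lambda>g c. g (transpose 1 2 \<circ> c)"
  have CK: "?C k = (\<lambda>c. k c - s * ?T k c)" by (simp add: k_antisymmetric_part)
  have "R 1 2 (?T k) = (\<lambda>c. R 2 1 k (transpose 1 2 \<circ> c))" by (simp add: R_transpose fun_eq_iff)
  then have "?C (?T k) c = R 1 2 (R 2 1 k) (transpose 1 2 \<circ> c)" for c by (simp add: R_transpose)
  \<comment> \<open>The colours 1 and 2 have the same weight in \<open>k\<close>, so the commutator
    of the two moves vanishes on it.\<close>
  also have "R 1 2 (R 2 1 k) d = ?C k d" for d
    using recolor_commute[OF fin, of 1 2 2 1 k d] by (simp add: recolor_same_weight[OF k_weight])
  finally have CT: "?C (?T k) = ?T (?C k)" by (simp add: fun_eq_iff)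
  have CC: "?C (?C k) = (\<lambda>c. 2 * ?C k c)"
  proof
    fix c
    have "?C (?C k) c = ?C k c - s * ?C (?T k) c"
      by (subst CK) (simp add: recolor_diff recolor_mult)
    also have "\<dots> = 2 * ?C k c"
      unfolding CT by (simp add: CK transpose_cancel s_cancel algebra_simps)
    finally show "?C (?C k) c = 2 * ?C k c" .
  qed
  define u where "u = R 1 2 k"
  have u_weight: "has_weight A u ((\<lambda>_. 0)(0 := int n, 1 := int n - 2, 2 := int n))"
    using recolor_weight[OF fin k_weight, of 1 2] unfolding u_def
    by (simp add: fun_upd_twist)
  have "R 1 2 (R 2 1 u) = (\<lambda>c. R 2 1 (R 1 2 u) c + 2 * u c)"
    using recolor_commute[OF fin, of 1 2 2 1 u]
    by (simp add: fun_eq_iff recolor_same_weight[OF u_weight] algebra_simps)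
  with CC have *: "R 2 1 (\<lambda>c. R 2 1 (R 1 2 u) c + 2 * u c) = (\<lambda>c. 2 * R 2 1 u c)"
    by (simp add: u_def)
  \<comment> \<open>The terms 2 \<open>R 2 1 u\<close> cancel because 2 is the eigenvalue 1 * 2 of
    spin 1. Both applications of \<open>R 2 1\<close> that remain can be undone, as colour 2
    outweighs colour 1.\<close>
  have "R 2 1 (R 2 1 (R 1 2 u)) = (\<lambda>c. 0)"
    using * by (simp add: recolor_add recolor_mult fun_eq_iff)
  have w1: "has_weight A (R 1 2 u) ((\<lambda>_. 0)(0 := int n, 1 := int n - 3, 2 := int n + 1))"
    using recolor_weight[OF fin u_weight, of 1 2] by (simp add: fun_upd_twist)
  have w2: "has_weight A (R 2 1 (R 1 2 u)) ((\<lambda>_. 0)(0 := int n, 1 := int n - 2, 2 := int n))"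
    using recolor_weight[OF fin w1, of 2 1] by (simp add: fun_upd_twist)
  have "R 2 1 (R 1 2 u) = (\<lambda>c. 0)"
    by (rule recolor_inj_on_weight[OF fin _ w2]) (use \<open>R 2 1 (R 2 1 (R 1 2 u)) = _\<close> in auto)
  then have "R 1 2 u = (\<lambda>c. 0)"
    by (intro recolor_inj_on_weight[OF fin _ w1, of 2 1]) auto
  then show ?thesis by (simp add: u_def)
qed

text \<open>Under the cyclic renaming of colours in \<open>v_eq_k\<close>, the move
  \<open>R 2 0\<close> on \<open>v\<close> is a second \<open>R 1 2\<close> on \<open>k\<close>. The
  other identity follows by exchanging the colours 0 and 1.\<close>

lemma v_lower: "R 2 0 v = (\<lambda>c. 0)" "R 2 1 v = (\<lambda>c. 0)"
proof -
  have v: "v = (\<lambda>c. s * R 1 2 k (id(0 := 2, 1 := 0, 2 := 1) \<circ> c))"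
    by (rule ext) (rule v_eq_k)
  show *: "R 2 0 v = (\<lambda>c. 0)"
    by (subst v) (simp add: recolor_mult R_cycle k_exchange_twice fun_eq_iff)
  have v': "v = (\<lambda>c. s * v (transpose 0 1 \<circ> c))"
    by (rule ext) (simp add: v_swap s_cancel)
  show "R 2 1 v = (\<lambda>c. 0)"
    by (subst v') (simp add: recolor_mult R_transpose * fun_eq_iff)
qed

text \<open>By \<open>k_exchange\<close>, \<open>v\<close> is a renaming of
  \<open>R 0 2 (R 0 1 k)\<close>. Since these two moves commute, \<open>v_swap\<close> says that
  they annihilate \<open>k c - s * k (transpose 1 2 \<circ> c)\<close>, which \<open>k_swap\<close>
  identifies with a move of \<open>v\<close>.\<close>

lemma v_cubic: "R 0 1 (R 0 2 (R 1 2 v)) = (\<lambda>c. 0)"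
proof -
  define M where "M = R 0 2 (R 0 1 k)"
  let ?T = "\<lambda>g c. g (transpose 1 2 \<circ> c)"
  have k: "k = (\<lambda>c. s * R 0 1 k (transpose 0 1 \<circ> c))"
    by (rule ext) (rule k_exchange)
  have "R 1 2 k d = s * M (transpose 0 1 \<circ> d)" for d
    by (subst k) (simp add: recolor_mult R_transpose M_def)
  then have vM: "v c = M (transpose 0 1 \<circ> (id(0 := 2, 1 := 0, 2 := 1) \<circ> c))" for c
    by (simp add: v_eq_k s_cancel)
  have "M c = s * M (transpose 1 2 \<circ> c)" for c
  proof -
    define d where "d = transpose 0 2 \<circ> c"
    have 1: "transpose 0 1 \<circ> (id(0 := 2, 1 := 0, 2 := 1) \<circ> d) = c"
      unfolding d_def by (auto simp: fun_eq_iff transpose_def)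
    have 2: "transpose 0 1 \<circ> (id(0 := 2, 1 := 0, 2 := 1) \<circ> (transpose 0 1 \<circ> d)) = transpose 1 2 \<circ> c"
      unfolding d_def by (auto simp: fun_eq_iff transpose_def)
    show ?thesis using v_swap[of d] unfolding vM 1 2 by (simp add: s_cancel)
  qed
  moreover have "M (transpose 1 2 \<circ> c) = R 0 2 (R 0 1 (?T k)) c" for c
  proof -
    have "R 0 1 (?T k) = (\<lambda>c. R 0 2 k (transpose 1 2 \<circ> c))" by (simp add: R_transpose fun_eq_iff)
    then have "R 0 2 (R 0 1 (?T k)) c = R 0 1 (R 0 2 k) (transpose 1 2 \<circ> c)" by (simp add: R_transpose)
    also have "R 0 1 (R 0 2 k) d = M d" for d
      unfolding M_def using recolor_commute[OF fin, of 0 1 0 2 k d] by simp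
    finally show ?thesis by simp
  qed
  ultimately have "M c - s * R 0 2 (R 0 1 (?T k)) c = 0" for c by (metis eq_iff_diff_eq_0)
  then have "R 0 2 (R 0 1 (\<lambda>c. k c - s * ?T k c)) c = 0" for c
    by (simp add: recolor_diff recolor_mult M_def)
  then have "R 0 2 (R 0 1 (\<lambda>c. R 1 2 v (transpose 1 2 \<circ> c))) c = 0" for c
    by (simp add: k_swap)
  moreover have "R 0 1 (\<lambda>c. R 1 2 v (transpose 1 2 \<circ> c)) = (\<lambda>c. R 0 2 (R 1 2 v) (transpose 1 2 \<circ> c))"
    by (simp add: R_transpose fun_eq_iff)
  ultimately have "R 0 1 (R 0 2 (R 1 2 v)) (transpose 1 2 \<circ> c) = 0" for c
    by (simp add: R_transpose)
  then have "R 0 1 (R 0 2 (R 1 2 v)) (transpose 1 2 \<circ> (transpose 1 2 \<circ> c)) = 0" for c .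
  then show ?thesis by (simp add: transpose_cancel fun_eq_iff)
qed

text \<open>Obtained by applying \<open>R 2 0\<close> twice to \<open>v_cubic\<close> and commuting it to the inside, where it
  annihilates \<open>v\<close>.\<close>

lemma v_quadratic: "R 0 1 (R 1 0 v) = (\<lambda>c. 2 * v c)"
proof -
  let ?w = "\<lambda>a b c. (\<lambda>_. 0)(0 := int n + a, 1 := int n + b, 2 := int n + c) :: nat \<Rightarrow> int"
  note comm = recolor_commute[OF fin]
  have wv: "has_weight A v (?w 0 0 (-2))" using v_weight by simp
  have w12: "has_weight A (R 1 2 v) (?w 0 (-1) (-1))"
    using recolor_weight[OF fin wv, of 1 2] by (simp add: fun_upd_twist)
  have w10: "has_weight A (R 1 0 v) (?w 1 (-1) (-2))"
    using recolor_weight[OF fin wv, of 1 0] by (simp add: fun_upd_twist)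
  have a1: "R 2 0 (R 1 2 v) = R 1 0 v"
    using comm[of 2 0 1 2 v] by (simp add: v_lower recolor_zero fun_eq_iff)
  have a2: "R 2 1 (R 1 2 v) = (\<lambda>c. 2 * v c)"
    using comm[of 2 1 1 2 v] by (simp add: v_lower recolor_zero fun_eq_iff recolor_same_weight[OF wv] algebra_simps)
  have a3: "R 2 0 (R 0 2 (R 1 2 v)) = (\<lambda>c. R 0 2 (R 1 0 v) c + R 1 2 v c)"
    using comm[of 2 0 0 2 "R 1 2 v"] by (simp add: a1 fun_eq_iff recolor_same_weight[OF w12] algebra_simps)
  have a4: "R 2 1 (R 0 2 (R 1 2 v)) = (\<lambda>c. 2 * R 0 2 v c + R 0 1 (R 1 2 v) c)"
    using comm[of 2 1 0 2 "R 1 2 v"] by (simp add: a2 fun_eq_iff recolor_mult)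
  have a5: "R 2 0 (R 0 1 (R 0 2 (R 1 2 v))) = (\<lambda>c. R 0 1 (R 0 2 (R 1 0 v)) c - 2 * R 0 2 v c)"
    using comm[of 2 0 0 1 "R 0 2 (R 1 2 v)"] by (simp add: a3 a4 recolor_add fun_eq_iff)
  then have b0: "R 0 1 (R 0 2 (R 1 0 v)) = (\<lambda>c. 2 * R 0 2 v c)"
    by (simp add: v_cubic recolor_zero fun_eq_iff)
  have b1: "R 2 0 (R 1 0 v) = (\<lambda>c. 0)"
    using comm[of 2 0 1 0 v] by (simp add: v_lower recolor_zero fun_eq_iff)
  have b2: "R 2 1 (R 1 0 v) = (\<lambda>c. 0)"
    using comm[of 2 1 1 0 v] by (simp add: v_lower recolor_zero fun_eq_iff)
  have b3: "R 2 0 (R 0 2 (R 1 0 v)) = (\<lambda>c. 3 * R 1 0 v c)"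
    using comm[of 2 0 0 2 "R 1 0 v"] by (simp add: b1 recolor_zero fun_eq_iff recolor_same_weight[OF w10] algebra_simps)
  have b4: "R 2 1 (R 0 2 (R 1 0 v)) = R 0 1 (R 1 0 v)"
    using comm[of 2 1 0 2 "R 1 0 v"] by (simp add: b2 recolor_zero fun_eq_iff)
  have b5: "R 2 0 (R 0 1 (R 0 2 (R 1 0 v))) = (\<lambda>c. 2 * R 0 1 (R 1 0 v) c)"
    using comm[of 2 0 0 1 "R 0 2 (R 1 0 v)"] by (simp add: b3 b4 recolor_mult fun_eq_iff)
  have b6: "R 2 0 (R 0 2 v) = (\<lambda>c. 2 * v c)"
    using comm[of 2 0 0 2 v] by (simp add: v_lower recolor_zero fun_eq_iff recolor_same_weight[OF wv] algebra_simps)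
  \<comment> \<open>Comparing \<open>b5\<close> with \<open>R 2 0\<close> applied to
    \<open>b0\<close> gives twice the claim.\<close>
  from b5 show ?thesis by (simp add: b0 b6 recolor_mult fun_eq_iff)
qed

text \<open>By \<open>v_quadratic\<close>, \<open>R 0 1\<close> maps \<open>R 1 0 (R 1 0 v)\<close>
  to (2 - 2) \<open>R 1 0 v\<close> = 0, where the second 2 is the weight difference of the colours
  0 and 1 in \<open>R 1 0 v\<close>. At the weight of \<open>R 1 0 (R 1 0 v)\<close> the move
  \<open>R 0 1\<close> is injective.\<close>

lemma exchange_highest: "R 1 0 (R 1 0 v) = (\<lambda>c. 0)" "R 2 0 (R 1 0 v) = (\<lambda>c. 0)" "R 2 1 (R 1 0 v) = (\<lambda>c. 0)"
proof -
  note comm = recolor_commute[OF fin]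
  have w10: "has_weight A (R 1 0 v) ((\<lambda>_. 0)(0 := int n + 1, 1 := int n - 1, 2 := int n - 2))"
    using recolor_weight[OF fin v_weight, of 1 0] by (simp add: fun_upd_twist)
  have w1010: "has_weight A (R 1 0 (R 1 0 v)) ((\<lambda>_. 0)(0 := 2 + int n, 1 := int n - 2, 2 := int n - 2))"
    using recolor_weight[OF fin w10, of 1 0] by (simp add: fun_upd_twist)
  have "R 0 1 (R 1 0 (R 1 0 v)) = (\<lambda>c. 0)"
    using comm[of 0 1 1 0 "R 1 0 v"]
    by (simp add: v_quadratic recolor_mult recolor_same_weight[OF w10] fun_eq_iff) (simp add: algebra_simps)
  then show "R 1 0 (R 1 0 v) = (\<lambda>c. 0)"
    by (intro recolor_inj_on_weight[OF fin _ w1010, of 0 1]) auto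
  show "R 2 0 (R 1 0 v) = (\<lambda>c. 0)"
    using comm[of 2 0 1 0 v] by (simp add: v_lower recolor_zero fun_eq_iff)
  show "R 2 1 (R 1 0 v) = (\<lambda>c. 0)"
    using comm[of 2 1 1 0 v] by (simp add: v_lower recolor_zero fun_eq_iff)
qed

end

section \<open>Signs of words\<close>

text \<open>Only lists of length \<open>m\<close> are constrained, since a bracket is alternating
  only at its own arity.\<close>

definition alternating :: "nat \<Rightarrow> ('a list \<Rightarrow> complex) \<Rightarrow> bool" where
  "alternating m f \<longleftrightarrow> (\<forall>p x y q. length (p @ x # y # q) = m \<longrightarrow> f (p @ x # y # q) = - f (p @ y # x # q))"

lemma alternatingD:
  "alternating m f \<Longrightarrow> length (p @ x # y # q) = m \<Longrightarrow> f (p @ x # y # q) = - f (p @ y # x # q)"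
  unfolding alternating_def by blast

lemma alternating_move:
  assumes "alternating m f" "length (p @ x # u @ q) = m"
  shows "f (p @ x # u @ q) = (-1) ^ length u * f (p @ u @ x # q)"
  using assms(2)
proof (induction u arbitrary: p)
  case (Cons y u)
  have "f (p @ x # (y # u) @ q) = - f (p @ y # x # u @ q)"
    using alternatingD[OF assms(1), of p x y "u @ q"] Cons.prems by simp
  also have "f (p @ y # x # u @ q) = (-1) ^ length u * f ((p @ [y]) @ u @ x # q)"
    using Cons.IH[of "p @ [y]"] Cons.prems by simp
  finally show ?case by simp
qed simp

lemma alternating_block:
  assumes "alternating m f" "length (p @ u @ w @ q) = m"
  shows "f (p @ u @ w @ q) = (-1) ^ (length u * length w) * f (p @ w @ u @ q)"
  using assms(2)
proof (induction u arbitrary: p)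
  case (Cons x u)
  have "f (p @ (x # u) @ w @ q) = (-1) ^ (length u * length w) * f (p @ x # w @ u @ q)"
    using Cons.IH[of "p @ [x]"] Cons.prems by simp
  also have "f (p @ x # w @ u @ q) = (-1) ^ length w * f (p @ w @ (x # u) @ q)"
    using alternating_move[OF assms(1), of p x w "u @ q"] Cons.prems by simp
  finally show ?case by (simp add: power_add)
qed simp

lemma alternating_exchange:
  assumes "alternating m f" "length (p @ x # u @ y # q) = m"
  shows "f (p @ x # u @ y # q) = - f (p @ y # u @ x # q)"
proof -
  have "f (p @ x # u @ y # q) = (-1) ^ length u * f (p @ u @ x # y # q)"
    using alternating_move[OF assms(1), of p x u "y # q"] assms(2) by simp
  also have "f (p @ u @ x # y # q) = - f (p @ u @ y # x # q)"
    using alternatingD[OF assms(1), of "p @ u" x y q] assms(2) by simp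
  also have "(-1) ^ length u * - f (p @ u @ y # x # q) = - f (p @ y # u @ x # q)"
    using alternating_move[OF assms(1), of p y u "x # q"] assms(2) by simp
  finally show ?thesis .
qed

text \<open>In a product of two alternating functions the signs of a rearrangement cancel. The fixed
  prefix \<open>p\<close> lets the induction match \<open>w\<close> letter by letter.\<close>

lemma alternating_mult_mset_eq:
  assumes "alternating m f" "alternating m g" "mset u = mset w" "length (p @ u) = m"
  shows "f (p @ u) * g (p @ u) = f (p @ w) * g (p @ w)"
  using assms(3,4)
proof (induction u arbitrary: p w)
  case (Cons x u)
  then obtain a b where w: "w = a @ x # b"
    by (metis list.set_intros(1) set_mset_mset split_list)
  with Cons.prems have ms: "mset u = mset (a @ b)" by simp
  then have len: "length u = length (a @ b)" by (rule mset_eq_length)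
  from ms have "f ((p @ [x]) @ u) * g ((p @ [x]) @ u) = f ((p @ [x]) @ a @ b) * g ((p @ [x]) @ a @ b)"
    using Cons.prems by (intro Cons.IH) auto
  also have "\<dots> = f (p @ w) * g (p @ w)"
    using alternating_move[OF assms(1), of p x a b] alternating_move[OF assms(2), of p x a b] Cons.prems len
    by (simp add: w power_mult_distrib[symmetric] power_add[symmetric])
  finally show ?case by simp
qed simp

lemma permute_list_adjacent:
  "permute_list (transpose (length p) (Suc (length p))) (p @ x # y # q) = p @ y # x # q"
proof (rule nth_equalityI)
  let ?l = "p @ x # y # q" and ?t = "transpose (length p) (Suc (length p))"
  have t: "?t permutes {..<length ?l}" by (rule permutes_swap_id) auto
  have nth: "(p @ a # b # q) ! length p = a" "(p @ a # b # q) ! Suc (length p) = b"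
    "(p @ a # b # q) ! Suc (Suc (length p + j)) = q ! j" for a b j
    using nth_append_length_plus[of p "a # b # q" 0] nth_append_length_plus[of p "a # b # q" 1]
      nth_append_length_plus[of p "a # b # q" "Suc (Suc j)"] by simp_all
  fix i assume "i < length (permute_list ?t ?l)"
  then have i: "i < length ?l" by simp
  consider "i < length p" | "i = length p" | "i = Suc (length p)" | j where "i = Suc (Suc (length p + j))"
    by (metis add_Suc less_Suc_eq less_iff_Suc_add not_less_eq)
  then have "?l ! ?t i = (p @ y # x # q) ! i"
    by cases (simp_all add: transpose_def nth nth_append)
  then show "permute_list ?t ?l ! i = (p @ y # x # q) ! i"
    using permute_list_nth[OF t i] by simp
qed simp

text \<open>The value is 0 if a letter is repeated, so that \<open>letter_sign\<close> is alternating on all words.\<close>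

fun letter_sign :: "nat list \<Rightarrow> complex" where
  "letter_sign [] = 1"
| "letter_sign (x # w) = (\<Prod>y\<leftarrow>w. of_int (sgn (int y - int x))) * letter_sign w"

lemma letter_sign_adjacent: "letter_sign (p @ x # y # q) = - letter_sign (p @ y # x # q)"
proof (induction p)
  case Nil
  define a where "a = sgn (int x - int y)"
  have "sgn (int y - int x) = - a" by (simp add: a_def sgn_if)
  then show ?case by (simp add: a_def[symmetric])
next
  case (Cons z p)
  show ?case unfolding append_Cons letter_sign.simps Cons by (simp add: mult_ac)
qed

lemma alternating_letter_sign: "alternating m (\<lambda>l. letter_sign (p @ l @ q))"
  unfolding alternating_def
proof (intro allI impI)
  fix u x y w
  show "letter_sign (p @ (u @ x # y # w) @ q) = - letter_sign (p @ (u @ y # x # w) @ q)"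
    using letter_sign_adjacent[of "p @ u" x y "w @ q"] by simp
qed

lemma letter_sign_exchange: "letter_sign (u @ a # v @ b # z) = - letter_sign (u @ b # v @ a # z)"
proof -
  have "alternating (length (u @ a # v @ b # z)) letter_sign"
    using alternating_letter_sign[of _ "[]" "[]"] by simp
  from alternating_exchange[OF this refl] show ?thesis .
qed

lemma letter_sign_square: "distinct w \<Longrightarrow> letter_sign w * letter_sign w = 1"
proof (induction w)
  case (Cons x w)
  let ?P = "\<lambda>v. \<Prod>y\<leftarrow>v. of_int (sgn (int y - int x)) :: complex"
  have P: "x \<notin> set v \<Longrightarrow> ?P v * ?P v = 1" for v
  proof (induction v)
    case (Cons y v)
    have "?P (y # v) * ?P (y # v) = of_int (sgn (int y - int x) * sgn (int y - int x)) * (?P v * ?P v)"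
      by (simp only: list.map prod_list.Cons of_int_mult mult_ac)
    also have "sgn (int y - int x) * sgn (int y - int x) = 1"
      using Cons.prems by (auto simp: sgn_if)
    also have "?P v * ?P v = 1" using Cons by simp
    finally show ?case by simp
  qed simp
  have "letter_sign (x # w) * letter_sign (x # w) = (?P w * ?P w) * (letter_sign w * letter_sign w)"
    by (simp only: letter_sign.simps mult_ac)
  also have "\<dots> = 1" using P[of w] Cons by simp
  finally show ?case .
qed simp

lemma letter_sign_transpose:
  assumes "distinct w" "a \<in> set w" "b \<in> set w" "a \<noteq> b"
  shows "letter_sign (map (transpose a b) w) = - letter_sign w"
proof -
  have fix_list: "map (transpose a b) l = l" if "a \<notin> set l" "b \<notin> set l" for l :: "nat list" and a b
    using that by (intro map_idI) (auto simp: transpose_def)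
  have key: "letter_sign (map (transpose a b) (u @ a # v @ b # z)) = - letter_sign (u @ a # v @ b # z)"
    if "distinct (u @ a # v @ b # z)" for u v z a b
  proof -
    have "map (transpose a b) (u @ a # v @ b # z) = u @ b # v @ a # z"
      using that by (simp add: fix_list)
    then show ?thesis using letter_sign_exchange[of u a v b z] by simp
  qed
  obtain u z where w: "w = u @ a # z" using assms(2) by (meson split_list)
  with assms(3,4) consider "b \<in> set z" | "b \<in> set u" by auto
  then show ?thesis
  proof cases
    case 1
    then obtain v t where "z = v @ b # t" by (meson split_list)
    then show ?thesis using key[of u a v b t] assms(1) w by simp
  next
    case 2
    then obtain v t where "u = v @ b # t" by (meson split_list)
    then show ?thesis using key[of v b t a z] assms(1) w by (simp add: transpose_commute[of a b])
  qed
qed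

lemma letter_sign_map:
  assumes "\<sigma> permutes S" "finite S" "distinct w" "set w = S"
  shows "letter_sign (map \<sigma> w) = of_int (sign \<sigma>) * letter_sign w"
  using assms(1,2)
proof (induction rule: permutes_induct)
  case id
  then show ?case by simp
next
  case (swap a b p)
  have "inj_on p (set w)" using swap(4) by (meson permutes_inj inj_on_subset subset_UNIV)
  then have "distinct (map p w)" using assms(3) by (simp add: distinct_map)
  moreover have "set (map p w) = S" using permutes_image[OF swap(4)] assms(4) by simp
  ultimately have "letter_sign (map (transpose a b) (map p w)) = - letter_sign (map p w)"
    using swap(1-3) by (intro letter_sign_transpose) auto
  moreover have "permutation p" using swap(4) assms(2) permutation_permutes by blast
  then have "sign (transpose a b \<circ> p) = - sign p"
    using swap(3) by (simp add: sign_compose permutation_swap_id sign_swap_id)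
  ultimately show ?case by (simp only: map_map swap(5) of_int_minus mult_minus_left)
qed

section \<open>Words made of three blocks of letters, and the colourings that they define\<close>

definition noncomb_word :: "'x list \<Rightarrow> 'x list \<Rightarrow> 'x list \<Rightarrow> 'x bword" where
  "noncomb_word U V W = Bracket (Bracket (map Letter U) # Bracket (map Letter V) # map Letter W)"

definition comb_word :: "'x list \<Rightarrow> 'x list \<Rightarrow> 'x list \<Rightarrow> 'x bword" where
  "comb_word U V W = Bracket (Bracket (Bracket (map Letter U) # map Letter V) # map Letter W)"

definition coloured_lists :: "nat set \<Rightarrow> (nat \<Rightarrow> nat) \<Rightarrow> nat list \<Rightarrow> nat list \<Rightarrow> nat list \<Rightarrow> bool" where
  "coloured_lists A c U V W \<longleftrightarrow> distinct (U @ V @ W) \<and> set (U @ V @ W) = A \<and>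
     (\<forall>x\<in>set U. c x = 0) \<and> (\<forall>x\<in>set V. c x = 1) \<and> (\<forall>x\<in>set W. c x = 2)"

definition three_colours :: "nat \<Rightarrow> nat \<Rightarrow> nat \<Rightarrow> nat \<Rightarrow> int" where
  "three_colours a b d = (\<lambda>_. 0)(0 := int a, 1 := int b, 2 := int d)"

definition of_weight :: "nat set \<Rightarrow> nat \<Rightarrow> nat \<Rightarrow> nat \<Rightarrow> (nat \<Rightarrow> nat) \<Rightarrow> bool" where
  "of_weight A a b d c \<longleftrightarrow> (\<forall>j. int (cnt A c j) = three_colours a b d j)"

text \<open>Increasing order is only a normal form; \<open>v_eq\<close> and \<open>k_eq\<close> show
  that the values below are independent of it.\<close>

definition class_list :: "nat set \<Rightarrow> (nat \<Rightarrow> nat) \<Rightarrow> nat \<Rightarrow> nat list" where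
  "class_list A c j = sorted_list_of_set {x\<in>A. c x = j}"

lemma coloured_lists_classes:
  assumes "coloured_lists A c U V W"
  shows "{x\<in>A. c x = 0} = set U" "{x\<in>A. c x = 1} = set V" "{x\<in>A. c x = 2} = set W"
  using assms by (auto simp: coloured_lists_def)

lemma coloured_lists_weight:
  assumes "coloured_lists A c U V W"
  shows "of_weight A (length U) (length V) (length W) c"
proof -
  have "cnt A c j = (three_colours (length U) (length V) (length W)) j" for j
  proof -
    consider "j = 0" | "j = 1" | "j = 2" | "j > 2" by linarith
    then show ?thesis
    proof cases
      case 4
      then have "{x\<in>A. c x = j} = {}" using assms by (auto simp: coloured_lists_def)
      then have "cnt A c j = 0" unfolding cnt_def by (simp only: card.empty)
      then show ?thesis using 4 by (simp add: three_colours_def)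
    qed (use assms coloured_lists_classes[OF assms] in
        \<open>simp_all add: cnt_def three_colours_def coloured_lists_def distinct_card\<close>)
  qed
  then show ?thesis by (simp add: of_weight_def)
qed

lemma class_lists_coloured:
  assumes "finite A" "of_weight A a b d c"
  shows "coloured_lists A c (class_list A c 0) (class_list A c 1) (class_list A c 2)"
    "length (class_list A c 0) = a" "length (class_list A c 1) = b" "length (class_list A c 2) = d"
proof -
  have card: "card {x\<in>A. c x = j} = nat (three_colours a b d j)" for j
    using assms(2) unfolding of_weight_def cnt_def by (metis nat_int)
  have "c x \<le> 2" if "x \<in> A" for x
  proof (rule ccontr)
    assume "\<not> c x \<le> 2"
    then have "card {y\<in>A. c y = c x} = 0" using card[of "c x"] by (simp add: three_colours_def)
    then show False using assms(1) that by auto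
  qed
  then have "{x\<in>A. c x = 0} \<union> ({x\<in>A. c x = 1} \<union> {x\<in>A. c x = 2}) = A" by fastforce
  then show "coloured_lists A c (class_list A c 0) (class_list A c 1) (class_list A c 2)"
    using assms(1) unfolding coloured_lists_def class_list_def by simp auto
  show "length (class_list A c 0) = a" "length (class_list A c 1) = b" "length (class_list A c 2) = d"
    by (simp_all add: class_list_def card three_colours_def)
qed

text \<open>The Jacobi identity is a sum over positions, a move between colour classes is a sum over
  letters. The decomposition of the list at the position is the form in which the terms are
  compared.\<close>

lemma sum_nth_split_list:
  assumes "distinct P" and "\<And>u x w. P = u @ x # w \<Longrightarrow> F (length u) = G x"
  shows "(\<Sum>i<length P. F i) = (\<Sum>x\<in>set P. G x)"
proof -
  have "F i = G (P ! i)" if "i < length P" for i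
    using assms(2)[of "take i P" "P ! i" "drop (Suc i) P"] that id_take_nth_drop by fastforce
  moreover have "bij_betw ((!) P) {..<length P} (set P)"
    using assms(1) by (intro bij_betw_nth) auto
  ultimately show ?thesis by (simp add: sum.reindex_bij_betw[symmetric])
qed

lemma of_weight_comp:
  assumes "bij \<tau>" "\<And>j. three_colours a b d (\<tau> j) = three_colours a' b' d' j"
  shows "of_weight A a b d (\<tau> \<circ> c) \<longleftrightarrow> of_weight A a' b' d' c"
proof -
  have "cnt A (\<tau> \<circ> c) (\<tau> j) = cnt A c j" for j
    using assms(1) by (simp add: cnt_def bij_is_inj inj_eq)
  moreover have "(\<forall>j. P (\<tau> j)) \<longleftrightarrow> (\<forall>j. P j)" for P
    using assms(1) by (metis bij_pointE)
  from this[of "\<lambda>j. int (cnt A (\<tau> \<circ> c) j) = three_colours a b d j"]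
  have "of_weight A a b d (\<tau> \<circ> c) \<longleftrightarrow> (\<forall>j. int (cnt A (\<tau> \<circ> c) (\<tau> j)) = three_colours a b d (\<tau> j))"
    by (simp add: of_weight_def)
  ultimately show ?thesis by (simp add: of_weight_def assms(2))
qed

lemma of_weight_upd:
  assumes "finite A" "x \<in> A" "i \<noteq> c x" "of_weight A a b d (c(x := i))"
    "\<And>j. three_colours a' b' d' j = three_colours a b d j - (if j = i then 1 else 0) + (if j = c x then 1 else 0)"
  shows "of_weight A a' b' d' c"
  unfolding of_weight_def
proof
  fix j
  show "int (cnt A c j) = three_colours a' b' d' j"
    using cnt_upd[where c = c and i = i and x = x and k = j, OF assms(1-3)] assms(5)[of j]
      assms(4)[unfolded of_weight_def, rule_format, of j] by linarith
qed

lemma recolor_nonzero: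
  assumes "recolor A i j g c \<noteq> 0"
  obtains x where "x \<in> A" "c x = j" "g (c(x := i)) \<noteq> 0"
  using assms unfolding recolor_def by (metis (mono_tags, lifting) mem_Collect_eq sum.neutral)

lemma minus_one_power_square: "(-1) ^ (m * m) = ((-1) ^ m :: complex)"
  by (simp add: minus_one_power_iff)

text \<open>Values on words of a functional that vanishes on the ideal. Antisymmetry is stated for
  the outermost bracket and for the brackets one and two levels down in the first entry, the Jacobi
  identity for the first two levels: a comb with three brackets calls for exactly these.\<close>

locale word_functional =
  fixes A :: "nat set" and n :: nat and L :: "nat bword \<Rightarrow> complex"
  assumes fin: "finite A" and n2: "n \<ge> 2"
    and antisym: "\<And>p u w q. set (p @ u # w # q) \<subseteq> bwords n A \<Longrightarrow> length (p @ u # w # q) = n \<Longrightarrow>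
      L (Bracket (p @ u # w # q)) = - L (Bracket (p @ w # u # q))"
    and antisym1: "\<And>p u w q r. set (p @ u # w # q) \<subseteq> bwords n A \<Longrightarrow> length (p @ u # w # q) = n \<Longrightarrow>
      set r \<subseteq> bwords n A \<Longrightarrow> length r = n - 1 \<Longrightarrow>
      L (Bracket (Bracket (p @ u # w # q) # r)) = - L (Bracket (Bracket (p @ w # u # q) # r))"
    and antisym2: "\<And>p u w q r t. set (p @ u # w # q) \<subseteq> bwords n A \<Longrightarrow> length (p @ u # w # q) = n \<Longrightarrow>
      set r \<subseteq> bwords n A \<Longrightarrow> length r = n - 1 \<Longrightarrow> set t \<subseteq> bwords n A \<Longrightarrow> length t = n - 1 \<Longrightarrow>
      L (Bracket (Bracket (Bracket (p @ u # w # q) # r) # t)) =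
      - L (Bracket (Bracket (Bracket (p @ w # u # q) # r) # t))"
    and jacobi: "\<And>xs ys. set xs \<subseteq> bwords n A \<Longrightarrow> length xs = n \<Longrightarrow> set ys \<subseteq> bwords n A \<Longrightarrow> length ys = n - 1 \<Longrightarrow>
      L (Bracket (Bracket xs # ys)) = (\<Sum>i<n. L (Bracket (xs[i := Bracket (xs ! i # ys)])))"
    and jacobi1: "\<And>xs ys zs. set xs \<subseteq> bwords n A \<Longrightarrow> length xs = n \<Longrightarrow> set ys \<subseteq> bwords n A \<Longrightarrow> length ys = n - 1 \<Longrightarrow>
      set zs \<subseteq> bwords n A \<Longrightarrow> length zs = n - 1 \<Longrightarrow>
      L (Bracket (Bracket (Bracket xs # ys) # zs)) =
      (\<Sum>i<n. L (Bracket (Bracket (xs[i := Bracket (xs ! i # ys)]) # zs)))"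
begin

definition "signed_noncomb U V W = letter_sign (U @ V @ W) * L (noncomb_word U V W)"
definition "signed_comb U V W = letter_sign (U @ V @ W) * L (comb_word U V W)"

definition v :: "(nat \<Rightarrow> nat) \<Rightarrow> complex" where
  "v c = (if of_weight A n n (n - 2) c
     then signed_noncomb (class_list A c 0) (class_list A c 1) (class_list A c 2) else 0)"

definition k :: "(nat \<Rightarrow> nat) \<Rightarrow> complex" where
  "k c = (if of_weight A n (n - 1) (n - 1) c
     then signed_comb (class_list A c 0) (class_list A c 1) (class_list A c 2) else 0)"

lemma letters_bwords [simp]: "set (map Letter U) \<subseteq> bwords n A \<longleftrightarrow> set U \<subseteq> A"
  "Letter x \<in> bwords n A \<longleftrightarrow> x \<in> A" "Letter ` S \<subseteq> bwords n A \<longleftrightarrow> S \<subseteq> A"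
  by (auto simp: bwords_def)

lemma Bracket_bwords [simp]: "Bracket ws \<in> bwords n A \<longleftrightarrow> length ws = n \<and> set ws \<subseteq> bwords n A"
  by (auto simp: bwords_def)

text \<open>The letter sign and \<open>M\<close> are both alternating in the block, so their product
  sees only its set of letters. \<open>M\<close> is extended by 0 outside of \<open>A\<close>
  because \<open>alternating\<close> quantifies over all lists.\<close>

lemma symmetric_in_block:
  assumes alt: "\<And>p x y q. set (p @ x # y # q) \<subseteq> A \<Longrightarrow> length (p @ x # y # q) = m \<Longrightarrow>
      M (p @ x # y # q) = - M (p @ y # x # q)"
    and U: "distinct U" "distinct U'" "set U = set U'" "set U \<subseteq> A" "length U = m"
  shows "letter_sign (P @ U @ Q) * M U = letter_sign (P @ U' @ Q) * M U'"
proof -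
  let ?M = "\<lambda>l. if set l \<subseteq> A then M l else 0"
  have "alternating m ?M"
    unfolding alternating_def
  proof (intro allI impI)
    fix p q :: "nat list" and x y assume "length (p @ x # y # q) = m"
    then show "?M (p @ x # y # q) = - ?M (p @ y # x # q)"
      using alt[of p x y q] by (cases "set (p @ x # y # q) \<subseteq> A") auto
  qed
  then have "letter_sign (P @ ([] @ U) @ Q) * ?M ([] @ U) = letter_sign (P @ ([] @ U') @ Q) * ?M ([] @ U')"
    using U set_eq_iff_mset_eq_distinct
    by (intro alternating_mult_mset_eq[OF alternating_letter_sign[of m P Q]]) auto
  then show ?thesis using U by simp
qed

text \<open>Exchanging two blocks of n letters costs (-1)^(n*n) = (-1)^n in the letter sign,
  exchanging two entries of the outer bracket another -1. The result is the constant
  \<open>s\<close> of \<open>bracket_functional\<close>.\<close>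

lemma signed_noncomb_swap:
  assumes "set (U @ V @ W) \<subseteq> A" "length U = n" "length V = n" "length W = n - 2"
  shows "signed_noncomb V U W = (-1) ^ (n - 1) * signed_noncomb U V W"
proof -
  have "letter_sign ([] @ V @ U @ W) = (-1) ^ (n * n) * letter_sign ([] @ U @ V @ W)"
    using alternating_block[OF alternating_letter_sign[of _ "[]" "[]"], of "[]" V U W] assms by simp
  moreover have "L (noncomb_word V U W) = - L (noncomb_word U V W)"
    unfolding noncomb_word_def
    using antisym[of "[]" "Bracket (map Letter V)" "Bracket (map Letter U)" "map Letter W"] assms n2 by auto
  moreover have "(-1) ^ n = - ((-1) ^ (n - 1) :: complex)" using n2 by (cases n) auto
  ultimately show ?thesis by (simp add: signed_noncomb_def minus_one_power_square)
qed

lemma v_eq: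
  assumes c: "coloured_lists A c U V W" and len: "length U = n" "length V = n" "length W = n - 2"
  shows "v c = signed_noncomb U V W"
proof -
  let ?U = "class_list A c 0" and ?V = "class_list A c 1" and ?W = "class_list A c 2"
  have w: "of_weight A n n (n - 2) c" using coloured_lists_weight[OF c] len by simp
  note cl = class_lists_coloured[OF fin w]
  have sets: "set ?U = set U" "set ?V = set V" "set ?W = set W"
    using coloured_lists_classes[OF c] coloured_lists_classes[OF cl(1)] by simp_all
  have d: "distinct ?U" "distinct ?V" "distinct ?W" "distinct U" "distinct V" "distinct W"
    using c cl by (auto simp: coloured_lists_def)
  have sub: "set U \<subseteq> A" "set V \<subseteq> A" "set W \<subseteq> A" using c by (auto simp: coloured_lists_def)
  have first: "signed_noncomb U V W = signed_noncomb U' V W"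
    if "distinct U" "distinct U'" "set U = set U'" "set U \<subseteq> A" "length U = n"
      "set (V @ W) \<subseteq> A" "length V = n" "length W = n - 2" for U U' V W
    unfolding signed_noncomb_def noncomb_word_def
  proof (rule symmetric_in_block[where P = "[]" and m = n, simplified append_Nil])
    fix p x y q
    assume "set (p @ x # y # q) \<subseteq> A" "length (p @ x # y # q) = n"
    with that n2 antisym1[of "map Letter p" "Letter x" "Letter y" "map Letter q" "Bracket (map Letter V) # map Letter W"]
    show "L (Bracket (Bracket (map Letter (p @ x # y # q)) # Bracket (map Letter V) # map Letter W)) =
      - L (Bracket (Bracket (map Letter (p @ y # x # q)) # Bracket (map Letter V) # map Letter W))"
      by simp
  qed (use that in auto)
  have third: "signed_noncomb U V W = signed_noncomb U V W'"
    if "distinct W" "distinct W'" "set W = set W'" "set W \<subseteq> A" "length W = n - 2"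
      "set (U @ V) \<subseteq> A" "length U = n" "length V = n" for U V W W'
    unfolding signed_noncomb_def noncomb_word_def append_assoc[symmetric]
  proof (rule symmetric_in_block[where P = "U @ V" and Q = "[]" and m = "n - 2", simplified append_Nil2])
    fix p x y q
    assume "set (p @ x # y # q) \<subseteq> A" "length (p @ x # y # q) = n - 2"
    with that n2 antisym[of "Bracket (map Letter U) # Bracket (map Letter V) # map Letter p" "Letter x" "Letter y" "map Letter q"]
    show "L (Bracket (Bracket (map Letter U) # Bracket (map Letter V) # map Letter (p @ x # y # q))) =
      - L (Bracket (Bracket (map Letter U) # Bracket (map Letter V) # map Letter (p @ y # x # q)))"
      by simp
  qed (use that in auto)
  have sq: "(-1) ^ (n - 1) * ((-1) ^ (n - 1) * z) = z" for z :: complex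
    by (simp add: mult.assoc[symmetric] power_mult_distrib[symmetric])
  have "v c = signed_noncomb ?U ?V ?W" using w by (simp add: v_def)
  also have "\<dots> = signed_noncomb U ?V ?W" using d sets sub cl by (intro first) auto
  \<comment> \<open>\<open>first\<close> reorders only the first block, which the antisymmetry one
    level down reaches. The second block is brought there and back by exchanging the two inner
    brackets.\<close>
  also have "\<dots> = (-1) ^ (n - 1) * signed_noncomb ?V U ?W"
    using signed_noncomb_swap[of ?V U ?W] sets sub cl len by simp
  also have "\<dots> = (-1) ^ (n - 1) * signed_noncomb V U ?W"
    using d sets sub cl len first[of ?V V U ?W] by simp
  also have "\<dots> = signed_noncomb U V ?W"
    using signed_noncomb_swap[of U V ?W] sets sub cl len by (simp add: sq)
  also have "\<dots> = signed_noncomb U V W" using d sets sub cl len by (intro third) auto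
  finally show ?thesis .
qed

lemma k_eq:
  assumes c: "coloured_lists A c U V W" and len: "length U = n" "length V = n - 1" "length W = n - 1"
  shows "k c = signed_comb U V W"
proof -
  let ?U = "class_list A c 0" and ?V = "class_list A c 1" and ?W = "class_list A c 2"
  have w: "of_weight A n (n - 1) (n - 1) c" using coloured_lists_weight[OF c] len by simp
  note cl = class_lists_coloured[OF fin w]
  have sets: "set ?U = set U" "set ?V = set V" "set ?W = set W"
    using coloured_lists_classes[OF c] coloured_lists_classes[OF cl(1)] by simp_all
  have d: "distinct ?U" "distinct ?V" "distinct ?W" "distinct U" "distinct V" "distinct W"
    using c cl by (auto simp: coloured_lists_def)
  have sub: "set U \<subseteq> A" "set V \<subseteq> A" "set W \<subseteq> A" using c by (auto simp: coloured_lists_def)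
  have "k c = signed_comb ?U ?V ?W" using w by (simp add: k_def)
  also have "\<dots> = signed_comb U ?V ?W"
    unfolding signed_comb_def comb_word_def
  proof (rule symmetric_in_block[where P = "[]" and m = n, simplified append_Nil])
    fix p x y q
    assume "set (p @ x # y # q) \<subseteq> A" "length (p @ x # y # q) = n"
    with sets sub cl n2 antisym2[of "map Letter p" "Letter x" "Letter y" "map Letter q" "map Letter ?V" "map Letter ?W"]
    show "L (Bracket (Bracket (Bracket (map Letter (p @ x # y # q)) # map Letter ?V) # map Letter ?W)) =
      - L (Bracket (Bracket (Bracket (map Letter (p @ y # x # q)) # map Letter ?V) # map Letter ?W))"
      by simp
  qed (use d sets sub cl in auto)
  also have "\<dots> = signed_comb U V ?W"
    unfolding signed_comb_def comb_word_def
  proof (rule symmetric_in_block[where m = "n - 1"])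
    fix p x y q
    assume "set (p @ x # y # q) \<subseteq> A" "length (p @ x # y # q) = n - 1"
    with sets sub cl n2 len
      antisym1[of "Bracket (map Letter U) # map Letter p" "Letter x" "Letter y" "map Letter q" "map Letter ?W"]
    show "L (Bracket (Bracket (Bracket (map Letter U) # map Letter (p @ x # y # q)) # map Letter ?W)) =
      - L (Bracket (Bracket (Bracket (map Letter U) # map Letter (p @ y # x # q)) # map Letter ?W))"
      by simp
  qed (use d sets sub cl in auto)
  also have "\<dots> = signed_comb U V W"
    unfolding signed_comb_def comb_word_def append_assoc[symmetric]
  proof (rule symmetric_in_block[where P = "U @ V" and Q = "[]" and m = "n - 1", simplified append_Nil2])
    fix p x y q
    assume "set (p @ x # y # q) \<subseteq> A" "length (p @ x # y # q) = n - 1"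
    with sets sub cl n2 len
      antisym[of "Bracket (Bracket (map Letter U) # map Letter V) # map Letter p" "Letter x" "Letter y" "map Letter q"]
    show "L (Bracket (Bracket (Bracket (map Letter U) # map Letter V) # map Letter (p @ x # y # q))) =
      - L (Bracket (Bracket (Bracket (map Letter U) # map Letter V) # map Letter (p @ y # x # q)))"
      by simp
  qed (use d sets sub cl in auto)
  finally show ?thesis .
qed

end

section \<open>Antisymmetry and the Jacobi identity translated into moves between colour
  classes\<close>

context word_functional
begin

lemma move_to_front:
  assumes "set (u @ x # w) \<subseteq> bwords n A" "length (u @ x # w) = n"
  shows "L (Bracket (u @ x # w)) = (-1) ^ length u * L (Bracket (x # u @ w))"
proof -
  let ?M = "\<lambda>l. if set l \<subseteq> bwords n A then L (Bracket l) else 0"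
  have "alternating n ?M"
    unfolding alternating_def
  proof (intro allI impI)
    fix p q :: "nat bword list" and a b assume "length (p @ a # b # q) = n"
    then show "?M (p @ a # b # q) = - ?M (p @ b # a # q)"
      using antisym[of p a b q] by (cases "set (p @ a # b # q) \<subseteq> bwords n A") auto
  qed
  from alternating_move[OF this, of "[]" x u w] assms
  have "L (Bracket (x # u @ w)) = (-1) ^ length u * L (Bracket (u @ x # w))" by simp
  then show ?thesis by (simp add: mult.assoc[symmetric] power_mult_distrib[symmetric])
qed

lemma move_to_front1:
  assumes "set (u @ x # w) \<subseteq> bwords n A" "length (u @ x # w) = n" "set r \<subseteq> bwords n A" "length r = n - 1"
  shows "L (Bracket (Bracket (u @ x # w) # r)) = (-1) ^ length u * L (Bracket (Bracket (x # u @ w) # r))"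
proof -
  let ?M = "\<lambda>l. if set l \<subseteq> bwords n A then L (Bracket (Bracket l # r)) else 0"
  have "alternating n ?M"
    unfolding alternating_def
  proof (intro allI impI)
    fix p q :: "nat bword list" and a b assume "length (p @ a # b # q) = n"
    then show "?M (p @ a # b # q) = - ?M (p @ b # a # q)"
      using antisym1[of p a b q r] assms(3,4) by (cases "set (p @ a # b # q) \<subseteq> bwords n A") auto
  qed
  from alternating_move[OF this, of "[]" x u w] assms
  have "L (Bracket (Bracket (x # u @ w) # r)) = (-1) ^ length u * L (Bracket (Bracket (u @ x # w) # r))"
    by simp
  then show ?thesis by (simp add: mult.assoc[symmetric] power_mult_distrib[symmetric])
qed

lemma letter_sign_front: "letter_sign (p @ u @ x # q) = (-1) ^ length u * letter_sign (p @ x # u @ q)"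
proof -
  have "letter_sign (p @ x # u @ q) = (-1) ^ length u * letter_sign (p @ u @ x # q)"
    using alternating_move[OF alternating_letter_sign[of _ "[]" "[]"], of p x u q] by simp
  then show ?thesis by (simp add: mult.assoc[symmetric] power_mult_distrib[symmetric])
qed

lemma letter_sign_block:
  "letter_sign (p @ u @ w @ q) = (-1) ^ (length u * length w) * letter_sign (p @ w @ u @ q)"
  using alternating_block[OF alternating_letter_sign[of _ "[]" "[]"], of p u w q] by simp

lemma even_power: "(-1) ^ ((n - 1) * (n - 2)) = (1 :: complex)" "(-1) ^ ((n - 2) * (n - 1)) = (1 :: complex)"
  using n2 by (auto simp: minus_one_power_iff)

lemma v_weight: "v c \<noteq> 0 \<Longrightarrow> of_weight A n n (n - 2) c"
  by (simp add: v_def split: if_splits)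

lemma k_weight: "k c \<noteq> 0 \<Longrightarrow> of_weight A n (n - 1) (n - 1) c"
  by (simp add: k_def split: if_splits)

lemma v_swap: "v (transpose 0 1 \<circ> c) = (-1) ^ (n - 1) * v c"
proof (cases "of_weight A n n (n - 2) c")
  case True
  let ?U = "class_list A c 0" and ?V = "class_list A c 1" and ?W = "class_list A c 2"
  note cl = class_lists_coloured[OF fin True]
  from cl(1) have "coloured_lists A (transpose 0 1 \<circ> c) ?V ?U ?W"
    by (auto simp: coloured_lists_def)
  then have "v (transpose 0 1 \<circ> c) = signed_noncomb ?V ?U ?W" using cl by (intro v_eq) auto
  moreover have "v c = signed_noncomb ?U ?V ?W" using cl by (intro v_eq) auto
  ultimately show ?thesis using signed_noncomb_swap[of ?U ?V ?W] cl by (auto simp: coloured_lists_def)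
next
  case False
  have "three_colours n n (n - 2) (transpose 0 1 j) = three_colours n n (n - 2) j" for j
    by (auto simp: three_colours_def transpose_def)
  then have "\<not> of_weight A n n (n - 2) (transpose 0 1 \<circ> c)"
    using False by (subst of_weight_comp) auto
  then show ?thesis using False by (simp add: v_def)
qed

text \<open>The Jacobi identity for [[U], [V], W], expanded over the first bracket: a letter x of U
  absorbs [V] and W, which gives the comb with the blocks V, then x and W, then the rest of U. Hence
  the cyclic renaming of the colours, and x moves from class 2 to class 1.\<close>

lemma v_eq_k: "v c = (-1) ^ (n - 1) * recolor A 1 2 k (id(0 := 2, 1 := 0, 2 := 1) \<circ> c)"
proof (cases "of_weight A n n (n - 2) c")
  case True
  let ?r = "id(0 := 2, 1 := 0, 2 := 1 :: nat)"
  let ?U = "class_list A c 0" and ?V = "class_list A c 1" and ?W = "class_list A c 2"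
  note cl = class_lists_coloured[OF fin True]
  note d = cl(1)[unfolded coloured_lists_def]
  have sets: "{x\<in>A. (?r \<circ> c) x = 2} = set ?U"
    using coloured_lists_classes(1)[OF cl(1)] by auto
  have sub: "set ?U \<subseteq> A" "set ?V \<subseteq> A" "set ?W \<subseteq> A" using d by auto
  let ?F = "\<lambda>i. letter_sign (?U @ ?V @ ?W) *
    L (Bracket ((map Letter ?U)[i := Bracket (map Letter ?U ! i # Bracket (map Letter ?V) # map Letter ?W)]))"
  let ?G = "\<lambda>x. (-1) ^ (n - 1) * k ((?r \<circ> c)(x := 1))"
  have "v c = signed_noncomb ?U ?V ?W" using cl by (intro v_eq) auto
  also have "\<dots> = (\<Sum>i<length ?U. ?F i)"
    unfolding signed_noncomb_def noncomb_word_def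
    using jacobi[of "map Letter ?U" "Bracket (map Letter ?V) # map Letter ?W"] cl sub n2
    by (simp add: sum_distrib_left)
  also have "\<dots> = (\<Sum>x\<in>set ?U. ?G x)"
  proof (rule sum_nth_split_list)
    show "distinct ?U" using d by simp
    fix u x w assume U: "?U = u @ x # w"
    have len: "length (u @ w) = n - 1" using U cl(2) by simp
    have V: "length ?V = n" and W: "length ?W = n - 2" by (fact cl)+
    have sub': "set u \<subseteq> A" "x \<in> A" "set w \<subseteq> A" using sub(1) U by auto
    let ?B = "Bracket (Letter x # Bracket (map Letter ?V) # map Letter ?W)"
    have "L (Bracket (map Letter u @ ?B # map Letter w)) = (-1) ^ length u * L (Bracket (?B # map Letter (u @ w)))"
      using move_to_front[of "map Letter u" ?B "map Letter w"] len V W sub sub' n2 by simp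
    \<comment> \<open>Exchanging x with the bracket of V contributes -1, and carrying V across the n
      letters of the first block contributes (-1)^n to the letter sign below. Together they make up
      (-1)^(n-1).\<close>
    also have "L (Bracket (?B # map Letter (u @ w))) = - L (comb_word ?V (x # ?W) (u @ w))"
      using antisym1[of "[]" "Letter x" "Bracket (map Letter ?V)" "map Letter ?W" "map Letter (u @ w)"]
        len V W sub sub' n2 unfolding comb_word_def by simp
    finally have 1: "L (Bracket (map Letter u @ ?B # map Letter w))
      = - ((-1) ^ length u * L (comb_word ?V (x # ?W) (u @ w)))" by simp
    have "letter_sign (u @ x # w @ ?V @ ?W) = (-1) ^ length u * letter_sign (x # u @ w @ ?V @ ?W)"
      using letter_sign_front[of "[]" u x "w @ ?V @ ?W"] by simp
    also have "letter_sign (x # u @ w @ ?V @ ?W) = (-1) ^ (n * n) * letter_sign (?V @ x # (u @ w) @ ?W)"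
    proof -
      have "length (x # u @ w) = n" using len n2 by simp
      with letter_sign_block[of "[]" "x # u @ w" ?V ?W] V show ?thesis
        by (simp del: letter_sign.simps list.size)
    qed
    also have "letter_sign (?V @ x # (u @ w) @ ?W) = letter_sign (?V @ (x # ?W) @ (u @ w))"
      using letter_sign_block[of "?V @ [x]" "u @ w" ?W "[]"] len W even_power by simp
    finally have 2: "letter_sign (?U @ ?V @ ?W)
      = (-1) ^ length u * ((-1) ^ n * letter_sign (?V @ (x # ?W) @ (u @ w)))"
      by (simp add: U minus_one_power_square)
    have "coloured_lists A ((?r \<circ> c)(x := 1)) ?V (x # ?W) (u @ w)"
      using d U unfolding coloured_lists_def by auto
    then have "k ((?r \<circ> c)(x := 1)) = signed_comb ?V (x # ?W) (u @ w)"
      using len V W n2 by (intro k_eq) auto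
    moreover have "(-1) ^ n = - ((-1) ^ (n - 1) :: complex)" using n2 by (cases n) auto
    moreover have "(-1) ^ length u * ((-1) ^ length u * z) = z" for z :: complex
      by (simp add: mult.assoc[symmetric] power_mult_distrib[symmetric])
    moreover have "?F (length u) = letter_sign (?U @ ?V @ ?W) * L (Bracket (map Letter u @ ?B # map Letter w))"
      unfolding U by (simp add: nth_append list_update_append)
    ultimately show "?F (length u) = ?G x"
      unfolding 1 2 signed_comb_def by (simp add: mult_ac)
  qed
  also have "\<dots> = (-1) ^ (n - 1) * recolor A 1 2 k (?r \<circ> c)"
    unfolding recolor_def sets by (simp add: sum_distrib_left)
  finally show ?thesis .
next
  case False
  \<comment> \<open>For any other content both sides vanish, because a nonzero term of the move
    determines the weight of \<open>c\<close>.\<close>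
  have "recolor A 1 2 k (id(0 := 2, 1 := 0, 2 := 1) \<circ> c) = 0"
  proof (rule ccontr)
    assume "recolor A 1 2 k (id(0 := 2, 1 := 0, 2 := 1) \<circ> c) \<noteq> 0"
    then obtain x where x: "x \<in> A" "(id(0 := 2, 1 := 0, 2 := 1) \<circ> c) x = 2"
      "k ((id(0 := 2, 1 := 0, 2 := 1) \<circ> c)(x := 1)) \<noteq> 0" by (rule recolor_nonzero)
    have "of_weight A n (n - 2) n (id(0 := 2, 1 := 0, 2 := 1) \<circ> c)"
      by (rule of_weight_upd[OF fin x(1) _ k_weight[OF x(3)]]) (use x(2) n2 in \<open>auto simp: three_colours_def\<close>)
    moreover have "bij (id(0 := 2, 1 := 0, 2 := 1 :: nat))"
      by (rule o_bij[where g = "id(0 := 1, 1 := 2, 2 := 0)"]) (auto simp: fun_eq_iff)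
    ultimately have "of_weight A n n (n - 2) c"
      by (subst (asm) of_weight_comp) (auto simp: three_colours_def)
    with False show False by simp
  qed
  then show ?thesis using False by (simp add: v_def)
qed

text \<open>The Jacobi identity for the outermost bracket of [[[U], V], W]. The term in which [U]
  absorbs W is the comb with V and W exchanged. The terms in which a letter x of V absorbs W are
  non-combs whose inner brackets consist of U and of x with W.\<close>

lemma k_swap: "k c - (-1) ^ (n - 1) * k (transpose 1 2 \<circ> c) = recolor A 1 2 v (transpose 1 2 \<circ> c)"
proof (cases "of_weight A n (n - 1) (n - 1) c")
  case True
  let ?d = "transpose 1 2 \<circ> c"
  let ?U = "class_list A c 0" and ?V = "class_list A c 1" and ?W = "class_list A c 2"
  note cl = class_lists_coloured[OF fin True]
  note d = cl(1)[unfolded coloured_lists_def]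
  have sets: "{x\<in>A. ?d x = 2} = set ?V"
    unfolding coloured_lists_classes(2)[OF cl(1), symmetric] by (auto simp: transpose_def split: if_splits)
  have sub: "set ?U \<subseteq> A" "set ?V \<subseteq> A" "set ?W \<subseteq> A" using d by auto
  have U: "length ?U = n" and V: "length ?V = n - 1" and W: "length ?W = n - 1" by (fact cl)+
  let ?F = "\<lambda>i. letter_sign (?U @ ?V @ ?W) *
    L (Bracket (Bracket (map Letter ?U) # (map Letter ?V)[i := Bracket (map Letter ?V ! i # map Letter ?W)]))"
  have "k c = signed_comb ?U ?V ?W" using cl by (intro k_eq) auto
  also have "\<dots> = letter_sign (?U @ ?V @ ?W) * (\<Sum>i<Suc (n - 1).
      L (Bracket ((Bracket (map Letter ?U) # map Letter ?V)[i :=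
        Bracket ((Bracket (map Letter ?U) # map Letter ?V) ! i # map Letter ?W)])))"
    unfolding signed_comb_def comb_word_def
    using jacobi[of "Bracket (map Letter ?U) # map Letter ?V" "map Letter ?W"] cl sub n2 by simp
  also have "\<dots> = letter_sign (?U @ ?V @ ?W) * L (comb_word ?U ?W ?V) + (\<Sum>i<length ?V. ?F i)"
    by (simp only: sum.lessThan_Suc_shift V distrib_left sum_distrib_left) (simp add: comb_word_def)
  also have "letter_sign (?U @ ?V @ ?W) * L (comb_word ?U ?W ?V) = (-1) ^ (n - 1) * k ?d"
  proof -
    have "coloured_lists A ?d ?U ?W ?V"
      using d unfolding coloured_lists_def by auto
    then have "k ?d = signed_comb ?U ?W ?V" using cl by (intro k_eq) auto
    moreover have "letter_sign (?U @ ?V @ ?W) = (-1) ^ (n - 1) * letter_sign (?U @ ?W @ ?V)"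
      using letter_sign_block[of ?U ?V ?W "[]"] V W by (simp add: minus_one_power_square)
    ultimately show ?thesis by (simp add: signed_comb_def)
  qed
  also have "(\<Sum>i<length ?V. ?F i) = (\<Sum>x\<in>set ?V. v (?d(x := 1)))"
  proof (rule sum_nth_split_list)
    show "distinct ?V" using d by simp
    fix u x w assume Vs: "?V = u @ x # w"
    have len: "length (u @ w) = n - 2" using Vs V by simp
    have sub': "set u \<subseteq> A" "x \<in> A" "set w \<subseteq> A" using sub(2) Vs by auto
    let ?B = "Bracket (map Letter (x # ?W))" and ?BU = "Bracket (map Letter ?U)"
    have "L (Bracket ((?BU # map Letter u) @ ?B # map Letter w)) = (-1) ^ Suc (length u) * L (Bracket (?B # ?BU # map Letter (u @ w)))"
      using move_to_front[of "?BU # map Letter u" ?B "map Letter w"] len U W sub sub' n2 by simp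
    also have "L (Bracket (?B # ?BU # map Letter (u @ w))) = - L (noncomb_word ?U (x # ?W) (u @ w))"
      using antisym[of "[]" ?B ?BU "map Letter (u @ w)"] len U W sub sub' n2
      unfolding noncomb_word_def by simp
    finally have 1: "L (Bracket (?BU # map Letter u @ ?B # map Letter w))
      = (-1) ^ length u * L (noncomb_word ?U (x # ?W) (u @ w))" by simp
    have "letter_sign (?U @ u @ x # w @ ?W) = (-1) ^ length u * letter_sign (?U @ x # u @ w @ ?W)"
      by (rule letter_sign_front)
    also have "letter_sign (?U @ x # u @ w @ ?W) = letter_sign (?U @ (x # ?W) @ (u @ w))"
      using letter_sign_block[of "?U @ [x]" "u @ w" ?W "[]"] len W even_power by simp
    finally have 2: "letter_sign (?U @ ?V @ ?W) = (-1) ^ length u * letter_sign (?U @ (x # ?W) @ (u @ w))"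
      unfolding Vs by simp
    have "coloured_lists A (?d(x := 1)) ?U (x # ?W) (u @ w)"
      using d Vs unfolding coloured_lists_def by auto
    then have "v (?d(x := 1)) = signed_noncomb ?U (x # ?W) (u @ w)"
      using len U W n2 by (intro v_eq) auto
    moreover have "(-1) ^ length u * ((-1) ^ length u * z) = z" for z :: complex
      by (simp add: mult.assoc[symmetric] power_mult_distrib[symmetric])
    moreover have "?F (length u) = letter_sign (?U @ ?V @ ?W) * L (Bracket (?BU # map Letter u @ ?B # map Letter w))"
      unfolding Vs by (simp add: nth_append list_update_append)
    ultimately show "?F (length u) = v (?d(x := 1))"
      unfolding 1 2 signed_noncomb_def by (simp add: mult_ac)
  qed
  also have "\<dots> = recolor A 1 2 v ?d" unfolding recolor_def sets ..
  finally show ?thesis by (simp only: add_diff_cancel_left')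
next
  case False
  have "recolor A 1 2 v (transpose 1 2 \<circ> c) = 0"
  proof (rule ccontr)
    assume "recolor A 1 2 v (transpose 1 2 \<circ> c) \<noteq> 0"
    then obtain x where x: "x \<in> A" "(transpose 1 2 \<circ> c) x = 2" "v ((transpose 1 2 \<circ> c)(x := 1)) \<noteq> 0"
      by (rule recolor_nonzero)
    have "of_weight A n (n - 1) (n - 1) (transpose 1 2 \<circ> c)"
      by (rule of_weight_upd[OF fin x(1) _ v_weight[OF x(3)]]) (use x(2) n2 in \<open>auto simp: three_colours_def\<close>)
    then have "of_weight A n (n - 1) (n - 1) c"
      by (subst (asm) of_weight_comp) (auto simp: three_colours_def transpose_def)
    with False show False by simp
  qed
  moreover have "\<not> of_weight A n (n - 1) (n - 1) (transpose 1 2 \<circ> c)"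
    using False by (subst of_weight_comp) (auto simp: three_colours_def transpose_def)
  ultimately show ?thesis using False by (simp add: k_def)
qed

text \<open>The Jacobi identity one level down, for [[U], V]: a letter x of U absorbs V, so that x
  and V form the innermost block and the rest of U the next one.\<close>

lemma k_exchange: "k c = (-1) ^ (n - 1) * recolor A 0 1 k (transpose 0 1 \<circ> c)"
proof (cases "of_weight A n (n - 1) (n - 1) c")
  case True
  let ?d = "transpose 0 1 \<circ> c"
  let ?U = "class_list A c 0" and ?V = "class_list A c 1" and ?W = "class_list A c 2"
  note cl = class_lists_coloured[OF fin True]
  note d = cl(1)[unfolded coloured_lists_def]
  have sets: "{x\<in>A. ?d x = 1} = set ?U"
    unfolding coloured_lists_classes(1)[OF cl(1), symmetric] by (auto simp: transpose_def split: if_splits)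
  have sub: "set ?U \<subseteq> A" "set ?V \<subseteq> A" "set ?W \<subseteq> A" using d by auto
  have U: "length ?U = n" and V: "length ?V = n - 1" and W: "length ?W = n - 1" by (fact cl)+
  let ?F = "\<lambda>i. letter_sign (?U @ ?V @ ?W) *
    L (Bracket (Bracket ((map Letter ?U)[i := Bracket (map Letter ?U ! i # map Letter ?V)]) # map Letter ?W))"
  have "k c = signed_comb ?U ?V ?W" using cl by (intro k_eq) auto
  also have "\<dots> = (\<Sum>i<length ?U. ?F i)"
    unfolding signed_comb_def comb_word_def
    using jacobi1[of "map Letter ?U" "map Letter ?V" "map Letter ?W"] cl sub n2 by (simp add: sum_distrib_left)
  also have "\<dots> = (\<Sum>x\<in>set ?U. (-1) ^ (n - 1) * k (?d(x := 0)))"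
  proof (rule sum_nth_split_list)
    show "distinct ?U" using d by simp
    fix u x w assume Us: "?U = u @ x # w"
    have len: "length (u @ w) = n - 1" using Us U by simp
    have sub': "set u \<subseteq> A" "x \<in> A" "set w \<subseteq> A" using sub(1) Us by auto
    let ?B = "Bracket (map Letter (x # ?V))"
    have 1: "L (Bracket (Bracket (map Letter u @ ?B # map Letter w) # map Letter ?W))
      = (-1) ^ length u * L (comb_word (x # ?V) (u @ w) ?W)"
      using move_to_front1[of "map Letter u" ?B "map Letter w" "map Letter ?W"] len U V W sub sub' n2
      unfolding comb_word_def by simp
    have "letter_sign (u @ x # w @ ?V @ ?W) = (-1) ^ length u * letter_sign (x # u @ w @ ?V @ ?W)"
      using letter_sign_front[of "[]" u x "w @ ?V @ ?W"] by simp
    also have "letter_sign (x # u @ w @ ?V @ ?W) = (-1) ^ (n - 1) * letter_sign ((x # ?V) @ (u @ w) @ ?W)"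
      using letter_sign_block[of "[x]" "u @ w" ?V ?W] len V by (simp add: minus_one_power_square mult_ac)
    finally have 2: "letter_sign (?U @ ?V @ ?W)
      = (-1) ^ length u * ((-1) ^ (n - 1) * letter_sign ((x # ?V) @ (u @ w) @ ?W))"
      by (simp add: Us)
    have "coloured_lists A (?d(x := 0)) (x # ?V) (u @ w) ?W"
      using d Us unfolding coloured_lists_def by auto
    then have "k (?d(x := 0)) = signed_comb (x # ?V) (u @ w) ?W"
      using len V W n2 by (intro k_eq) auto
    moreover have "(-1) ^ length u * ((-1) ^ length u * z) = z" for z :: complex
      by (simp add: mult.assoc[symmetric] power_mult_distrib[symmetric])
    moreover have "?F (length u) = letter_sign (?U @ ?V @ ?W) *
        L (Bracket (Bracket (map Letter u @ ?B # map Letter w) # map Letter ?W))"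
      unfolding Us by (simp add: nth_append list_update_append)
    ultimately show "?F (length u) = (-1) ^ (n - 1) * k (?d(x := 0))"
      unfolding 1 2 signed_comb_def by (simp add: mult_ac)
  qed
  also have "\<dots> = (-1) ^ (n - 1) * recolor A 0 1 k ?d"
    unfolding recolor_def sets by (simp add: sum_distrib_left)
  finally show ?thesis .
next
  case False
  have "recolor A 0 1 k (transpose 0 1 \<circ> c) = 0"
  proof (rule ccontr)
    assume "recolor A 0 1 k (transpose 0 1 \<circ> c) \<noteq> 0"
    then obtain x where x: "x \<in> A" "(transpose 0 1 \<circ> c) x = 1" "k ((transpose 0 1 \<circ> c)(x := 0)) \<noteq> 0"
      by (rule recolor_nonzero)
    have "of_weight A (n - 1) n (n - 1) (transpose 0 1 \<circ> c)"
      by (rule of_weight_upd[OF fin x(1) _ k_weight[OF x(3)]]) (use x(2) n2 in \<open>auto simp: three_colours_def\<close>)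
    then have "of_weight A n (n - 1) (n - 1) c"
      by (subst (asm) of_weight_comp) (auto simp: three_colours_def transpose_def)
    with False show False by simp
  qed
  then show ?thesis using False by (simp add: k_def)
qed

sublocale bracket_functional A n k v "(-1) ^ (n - 1)"
proof
  show "finite A" by (rule fin)
  show "(-1) ^ (n - 1) * (-1) ^ (n - 1) = (1 :: complex)"
    by (simp add: power_mult_distrib[symmetric])
  show "has_weight A k ((\<lambda>_. 0)(0 := int n, 1 := int n - 1, 2 := int n - 1))"
    using k_weight n2 by (simp add: has_weight_def of_weight_def three_colours_def of_nat_diff)
  show "has_weight A v ((\<lambda>_. 0)(0 := int n, 1 := int n, 2 := int n - 2))"
    using v_weight n2 by (simp add: has_weight_def of_weight_def three_colours_def of_nat_diff)
  show "v c = (-1) ^ (n - 1) * recolor A 1 2 k (id(0 := 2, 1 := 0, 2 := 1) \<circ> c)" for c by (rule v_eq_k)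
  show "k c - (-1) ^ (n - 1) * k (transpose 1 2 \<circ> c) = recolor A 1 2 v (transpose 1 2 \<circ> c)" for c
    by (rule k_swap)
  show "k c = (-1) ^ (n - 1) * recolor A 0 1 k (transpose 0 1 \<circ> c)" for c by (rule k_exchange)
  show "v (transpose 0 1 \<circ> c) = (-1) ^ (n - 1) * v c" for c by (rule v_swap)
qed

end

section \<open>Spaces of finitely supported functions\<close>

abbreviation scale :: "complex \<Rightarrow> ('b \<Rightarrow>\<^sub>0 complex) \<Rightarrow> 'b \<Rightarrow>\<^sub>0 complex" where
  "scale a p \<equiv> Poly_Mapping.map ((*) a) p"

lemma lookup_scale: "Poly_Mapping.lookup (scale a p) b = a * Poly_Mapping.lookup p b"
  by (simp add: Poly_Mapping.map.rep_eq when_def)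

lemma lookup_sum: "Poly_Mapping.lookup (\<Sum>x\<in>S. f x) b = (\<Sum>x\<in>S. Poly_Mapping.lookup (f x) b)"
  by (induction S rule: infinite_finite_induct) (simp_all add: lookup_add)

interpretation pm: vector_space "scale :: complex \<Rightarrow> ('b \<Rightarrow>\<^sub>0 complex) \<Rightarrow> _"
  by unfold_locales (auto intro!: poly_mapping_eqI simp: lookup_scale lookup_add algebra_simps)

definition linear_functional :: "(('b \<Rightarrow>\<^sub>0 complex) \<Rightarrow> complex) \<Rightarrow> bool" where
  "linear_functional l \<longleftrightarrow> (\<forall>p q. l (p + q) = l p + l q) \<and> (\<forall>a p. l (scale a p) = a * l p)"

lemma linear_functional_zero: "linear_functional l \<Longrightarrow> l 0 = 0"
  unfolding linear_functional_def by (metis add_cancel_right_left)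

lemma linear_functional_sum: "linear_functional l \<Longrightarrow> l (\<Sum>x\<in>S. f x) = (\<Sum>x\<in>S. l (f x))"
  by (induction S rule: infinite_finite_induct)
    (simp_all add: linear_functional_zero, simp add: linear_functional_def)

lemma linear_functional_diff: "linear_functional l \<Longrightarrow> l (p - q) = l p - l q"
  unfolding linear_functional_def by (metis add_diff_cancel diff_add_cancel)

text \<open>A basis of \<open>I\<close> stays independent when \<open>y\<close> is added; the
  functional takes the value 1 at \<open>y\<close> and 0 on that basis.\<close>

lemma subspace_separation:
  fixes I :: "('b \<Rightarrow>\<^sub>0 complex) set"
  assumes I: "pm.subspace I" and y: "y \<notin> I"
  obtains l where "linear_functional l" "\<And>x. x \<in> I \<Longrightarrow> l x = 0" "l y \<noteq> 0"
proof -
  interpret pair: vector_space_pair "scale :: complex \<Rightarrow> ('b \<Rightarrow>\<^sub>0 complex) \<Rightarrow> _" "(*) :: complex \<Rightarrow> _"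
    by unfold_locales (auto simp: algebra_simps)
  obtain B where B: "B \<subseteq> I" "pm.independent B" "I \<subseteq> pm.span B"
    by (rule pm.maximal_independent_subset)
  have span: "pm.span B = I" using B I by (metis pm.span_minimal subset_antisym)
  then have "y \<notin> pm.span B" using y by simp
  then have "pm.independent (insert y B)" using B(2) by (rule pm.independent_insertI)
  then obtain g where g: "Vector_Spaces.linear scale (*) g"
    and gB: "\<And>x. x \<in> insert y B \<Longrightarrow> g x = (if x = y then 1 else 0)"
    using pair.linear_independent_extend[of "insert y B" "\<lambda>x. if x = y then 1 else 0"] by blast
  interpret g: Vector_Spaces.linear scale "(*)" g by (rule g)
  have lin: "linear_functional g"
    unfolding linear_functional_def using g.add g.scale by blast
  have "y \<notin> B" using \<open>y \<notin> pm.span B\<close> pm.span_base by blast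
  then have B0: "g x = 0" if "x \<in> B" for x using gB that by auto
  have "g x = 0" if "x \<in> pm.span B" for x
    by (rule pair.linear_eq_0_on_span[OF g _ that]) (rule B0)
  then show ?thesis using that[OF lin] span gB[of y] by auto
qed

definition lin_ext :: "('b \<Rightarrow> complex) \<Rightarrow> ('b \<Rightarrow>\<^sub>0 complex) \<Rightarrow> complex" where
  "lin_ext \<phi> p = (\<Sum>w\<in>Poly_Mapping.keys p. Poly_Mapping.lookup p w * \<phi> w)"

lemma lin_ext_superset:
  "finite S \<Longrightarrow> Poly_Mapping.keys p \<subseteq> S \<Longrightarrow> lin_ext \<phi> p = (\<Sum>w\<in>S. Poly_Mapping.lookup p w * \<phi> w)"
  unfolding lin_ext_def by (rule sum.mono_neutral_left) (auto simp: in_keys_iff)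

lemma linear_functional_lin_ext:
  fixes \<phi> :: "'b \<Rightarrow> complex"
  shows "linear_functional (lin_ext \<phi>)"
  unfolding linear_functional_def
proof (intro conjI allI)
  fix p q :: "'b \<Rightarrow>\<^sub>0 complex" and a
  let ?S = "Poly_Mapping.keys p \<union> Poly_Mapping.keys q"
  show "lin_ext \<phi> (p + q) = lin_ext \<phi> p + lin_ext \<phi> q"
    using lin_ext_superset[of ?S "p + q"] lin_ext_superset[of ?S p] lin_ext_superset[of ?S q]
      Poly_Mapping.keys_add[of p q]
    by (simp add: lookup_add distrib_right sum.distrib)
  have "Poly_Mapping.keys (scale a p) \<subseteq> Poly_Mapping.keys p"
    by (auto simp: in_keys_iff lookup_scale)
  then show "lin_ext \<phi> (scale a p) = a * lin_ext \<phi> p"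
    using lin_ext_superset[of "Poly_Mapping.keys p" "scale a p"]
    by (simp add: lookup_scale sum_distrib_left mult.assoc lin_ext_def)
qed

lemma lin_ext_single [simp]: "lin_ext \<phi> (Poly_Mapping.single w a) = a * \<phi> w"
  by (simp add: lin_ext_def)

text \<open>
  A concrete description of the records of the definitions: \<open>M\<close> is the image of a space \<open>C\<close> of
  finitely supported functions under a linear map.\<close>

definition linear_image :: "('g, complex, 'c) rep \<Rightarrow> (('b \<Rightarrow>\<^sub>0 complex) \<Rightarrow> 'c) \<Rightarrow> ('b \<Rightarrow>\<^sub>0 complex) set \<Rightarrow> bool" where
  "linear_image M \<phi> C \<longleftrightarrow> pm.subspace C \<and> carrier M = \<phi> ` C \<and>
     (\<forall>x\<in>C. \<forall>y\<in>C. add M (\<phi> x) (\<phi> y) = \<phi> (x + y)) \<and> zero M = \<phi> 0 \<and>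
     (\<forall>a. \<forall>x\<in>C. module.smult M a (\<phi> x) = \<phi> (scale a x))"

lemma carrier_complex_ring [simp]: "carrier complex_ring = UNIV"
  by (simp add: ring_of_type_algebra_def)

text \<open>The record is not assumed to be a group, and \<open>m_inv\<close> is a definite
  description: existence and uniqueness of the inverse are both derived from the map.\<close>

lemma linear_image_minus:
  assumes "linear_image M \<phi> C" "x \<in> C"
  shows "m_inv (add_monoid M) (\<phi> x) = \<phi> (- x)"
proof -
  have C: "pm.subspace C" and M: "carrier M = \<phi> ` C"
    and add: "\<And>x y. x \<in> C \<Longrightarrow> y \<in> C \<Longrightarrow> add M (\<phi> x) (\<phi> y) = \<phi> (x + y)" and zero: "zero M = \<phi> 0"
    using assms(1) by (auto simp: linear_image_def)
  have mx: "- x \<in> C" using C assms(2) by (rule pm.subspace_neg)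
  have "(THE y. y \<in> carrier M \<and> add M (\<phi> x) y = zero M \<and> add M y (\<phi> x) = zero M) = \<phi> (- x)"
  proof (rule the_equality)
    show "\<phi> (- x) \<in> carrier M \<and> add M (\<phi> x) (\<phi> (- x)) = zero M \<and> add M (\<phi> (- x)) (\<phi> x) = zero M"
      using assms(2) mx by (simp add: M add zero)
    fix z assume z: "z \<in> carrier M \<and> add M (\<phi> x) z = zero M \<and> add M z (\<phi> x) = zero M"
    then obtain y where y: "y \<in> C" "z = \<phi> y" by (auto simp: M)
    have "z = \<phi> ((- x) + (x + y))" using y by simp
    also have "\<dots> = add M (\<phi> (- x)) (\<phi> (x + y))"
      using mx assms(2) y C by (simp add: add pm.subspace_add)
    also have "\<phi> (x + y) = \<phi> 0" using z y assms(2) by (simp add: add[symmetric] zero)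
    also have "add M (\<phi> (- x)) (\<phi> 0) = \<phi> (- x)"
      using mx C by (simp add: add pm.subspace_0)
    finally show "z = \<phi> (- x)" .
  qed
  then show ?thesis by (simp add: m_inv_def)
qed

lemma submodule_image:
  assumes M: "linear_image M \<phi> C" and S: "pm.subspace S" "S \<subseteq> C"
  shows "submodule (\<phi> ` S) complex_ring M"
proof -
  have add: "\<And>x y. x \<in> S \<Longrightarrow> y \<in> S \<Longrightarrow> add M (\<phi> x) (\<phi> y) = \<phi> (x + y)" and zero: "zero M = \<phi> 0"
    and smult: "\<And>a x. x \<in> S \<Longrightarrow> module.smult M a (\<phi> x) = \<phi> (scale a x)" and car: "carrier M = \<phi> ` C"
    using M S(2) by (auto simp: linear_image_def subset_iff)
  show ?thesis
  proof (intro submodule.intro submodule_axioms.intro subgroup.intro)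
    show "\<phi> ` S \<subseteq> carrier (add_monoid M)" using S(2) car by auto
    show "x \<otimes>\<^bsub>add_monoid M\<^esub> y \<in> \<phi> ` S" if "x \<in> \<phi> ` S" "y \<in> \<phi> ` S" for x y
      using that S(1) by (auto simp: add pm.subspace_add)
    show "\<one>\<^bsub>add_monoid M\<^esub> \<in> \<phi> ` S" using S(1) by (simp add: zero pm.subspace_0)
    show "inv\<^bsub>add_monoid M\<^esub> x \<in> \<phi> ` S" if "x \<in> \<phi> ` S" for x
      using that S linear_image_minus[OF M] by (auto simp: pm.subspace_neg subsetD)
    show "a \<odot>\<^bsub>M\<^esub> x \<in> \<phi> ` S" if "a \<in> carrier complex_ring" "x \<in> \<phi> ` S" for a x
      using that S(1) by (auto simp: smult pm.subspace_scale)
  qed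
qed

lemma submodule_preimage:
  assumes M: "linear_image M \<phi> C" and H: "submodule H complex_ring M"
  shows "pm.subspace {x \<in> C. \<phi> x \<in> H}"
proof -
  have C: "pm.subspace C" and add: "\<And>x y. x \<in> C \<Longrightarrow> y \<in> C \<Longrightarrow> add M (\<phi> x) (\<phi> y) = \<phi> (x + y)"
    and zero: "zero M = \<phi> 0" and smult: "\<And>a x. x \<in> C \<Longrightarrow> module.smult M a (\<phi> x) = \<phi> (scale a x)"
    using M by (auto simp: linear_image_def)
  have sg: "subgroup H (add_monoid M)" using H by (simp add: submodule_def)
  show ?thesis
    unfolding pm.subspace_def
  proof (intro conjI ballI allI)
    show "0 \<in> {x \<in> C. \<phi> x \<in> H}"
      using C subgroup.one_closed[OF sg] by (simp add: pm.subspace_0 zero)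
    fix x y assume "x \<in> {x \<in> C. \<phi> x \<in> H}" "y \<in> {x \<in> C. \<phi> x \<in> H}"
    then show "x + y \<in> {x \<in> C. \<phi> x \<in> H}"
      using C subgroup.m_closed[OF sg, of "\<phi> x" "\<phi> y"] by (simp add: pm.subspace_add add)
  next
    fix a x assume "x \<in> {x \<in> C. \<phi> x \<in> H}"
    then show "scale a x \<in> {x \<in> C. \<phi> x \<in> H}"
      using C submodule.smult_closed[OF H, of a "\<phi> x"] by (simp add: pm.subspace_scale smult)
  qed
qed

text \<open>The image of the span is a submodule containing the generators, and the preimage of any
  such submodule is a subspace containing \<open>S\<close>. So the intersection of submodules
  becomes a span of finitely supported functions.\<close>

lemma linear_image_spanned_rep:
  assumes M: "linear_image M \<phi> C" and S: "S \<subseteq> C"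
  shows "linear_image (spanned_rep complex_ring M (\<phi> ` S)) \<phi> (pm.span S)"
proof -
  have C: "pm.subspace C" using M by (simp add: linear_image_def)
  have sub: "pm.span S \<subseteq> C" using S C by (rule pm.span_minimal)
  have "\<Inter>{H. submodule H complex_ring M \<and> \<phi> ` S \<subseteq> H} = \<phi> ` pm.span S"
  proof
    show "\<Inter>{H. submodule H complex_ring M \<and> \<phi> ` S \<subseteq> H} \<subseteq> \<phi> ` pm.span S"
      using submodule_image[OF M _ sub] pm.span_superset[of S] by (intro Inter_lower) auto
    have "pm.span S \<subseteq> {x \<in> C. \<phi> x \<in> H}" if "submodule H complex_ring M" "\<phi> ` S \<subseteq> H" for H
      using submodule_preimage[OF M that(1)] that(2) S by (intro pm.span_minimal) auto
    then show "\<phi> ` pm.span S \<subseteq> \<Inter>{H. submodule H complex_ring M \<and> \<phi> ` S \<subseteq> H}" by fast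
  qed
  then show ?thesis using M sub by (auto simp: linear_image_def spanned_rep_def subset_iff)
qed

lemma act_spanned_rep [simp]: "act (spanned_rep R M S) = act M"
  by (simp add: spanned_rep_def)

lemma linear_image_free_rep:
  fixes B :: "'b set"
  shows "linear_image (free_rep B a) id {p. Poly_Mapping.keys p \<subseteq> B}"
proof -
  have "pm.subspace {p :: 'b \<Rightarrow>\<^sub>0 complex. Poly_Mapping.keys p \<subseteq> B}"
    unfolding pm.subspace_def
  proof (intro conjI ballI allI)
    fix p q :: "'b \<Rightarrow>\<^sub>0 complex" and a
    assume p: "p \<in> {p. Poly_Mapping.keys p \<subseteq> B}"
    have "Poly_Mapping.keys (scale a p) \<subseteq> Poly_Mapping.keys p" by (auto simp: in_keys_iff lookup_scale)
    with p show "scale a p \<in> {p. Poly_Mapping.keys p \<subseteq> B}" by auto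
    assume "q \<in> {p. Poly_Mapping.keys p \<subseteq> B}"
    with p show "p + q \<in> {p. Poly_Mapping.keys p \<subseteq> B}" using Poly_Mapping.keys_add[of p q] by auto
  qed simp
  then show ?thesis by (simp add: linear_image_def free_rep_def)
qed

text \<open>Two surjections from the same coefficient functions that identify the same pairs:
  sending \<open>S x\<close> to \<open>T x\<close> is well defined and bijective. It commutes with
  the action because both actions come from the same \<open>h\<close> on coefficients.\<close>

lemma rep_isomorphicI:
  fixes M :: "('g, complex, 'b) rep" and N :: "('g, complex, 'c) rep"
    and S :: "('i \<Rightarrow> complex) \<Rightarrow> 'b" and T :: "('i \<Rightarrow> complex) \<Rightarrow> 'c"
  assumes M: "carrier M = range S" "\<And>x y. add M (S x) (S y) = S (\<lambda>i. x i + y i)"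
      "\<And>a x. module.smult M a (S x) = S (\<lambda>i. a * x i)"
      "\<And>g x. g \<in> carrier G \<Longrightarrow> act M g (S x) = S (h g x)"
    and N: "carrier N = range T" "\<And>x y. add N (T x) (T y) = T (\<lambda>i. x i + y i)"
      "\<And>a x. module.smult N a (T x) = T (\<lambda>i. a * x i)"
      "\<And>g x. g \<in> carrier G \<Longrightarrow> act N g (T x) = T (h g x)"
    and ST: "\<And>x y. S x = S y \<longleftrightarrow> T x = T y"
  shows "rep_isomorphic G complex_ring M N"
proof -
  define f where "f z = T (SOME x. S x = z)" for z
  have f: "f (S x) = T x" for x
    unfolding f_def by (rule someI2[of "\<lambda>y. S y = S x" x]) (auto simp: ST)
  have "f \<in> rep_isos G complex_ring M N"
    unfolding rep_isos_def using ST by (auto simp: M N f bij_betw_def inj_on_def image_image)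
  then show ?thesis by (auto simp: rep_isomorphic_def)
qed

section \<open>The Filippov ideal\<close>

lemma mem_listset: "ws \<in> listset As \<longleftrightarrow> length ws = length As \<and> (\<forall>i<length As. ws ! i \<in> As ! i)"
proof (induction As arbitrary: ws)
  case (Cons A As)
  show ?case
    by (cases ws) (auto simp: set_Cons_def Cons.IH All_less_Suc2)
qed auto

lemma finite_listset: "(\<And>A. A \<in> set As \<Longrightarrow> finite A) \<Longrightarrow> finite (listset As)"
proof (induction As)
  case (Cons A As)
  have "listset (A # As) = (\<lambda>(x, xs). x # xs) ` (A \<times> listset As)"
    by (auto simp: set_Cons_def)
  then show ?case using Cons by simp
qed simp

text \<open>With \<open>bracket\<close> described by its coefficients, the sum over
  \<open>listset\<close> disappears and multilinearity becomes distributivity in a product.\<close>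

lemma lookup_bracket:
  "Poly_Mapping.lookup (bracket ps) w = (case w of Letter _ \<Rightarrow> 0
    | Bracket ws \<Rightarrow> if length ws = length ps
        then \<Prod>i<length ps. Poly_Mapping.lookup (ps ! i) (ws ! i) else 0)"
proof -
  let ?K = "listset (map Poly_Mapping.keys ps)"
  let ?c = "\<lambda>ws. \<Prod>i<length ps. Poly_Mapping.lookup (ps ! i) (ws ! i)"
  have fin: "finite ?K" by (rule finite_listset) auto
  have "Poly_Mapping.lookup (bracket ps) w = (\<Sum>ws\<in>?K. if Bracket ws = w then ?c ws else 0)"
    by (simp add: bracket_def lookup_sum lookup_single when_def)
  also have "\<dots> = (case w of Letter _ \<Rightarrow> 0
    | Bracket ws \<Rightarrow> if length ws = length ps then ?c ws else 0)"
  proof (cases w)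
    case (Bracket ws)
    have "(\<Sum>us\<in>?K. if Bracket us = w then ?c us else 0) = (if ws \<in> ?K then ?c ws else 0)"
      using fin by (simp add: Bracket)
    moreover have "?c ws = 0" if "ws \<notin> ?K" "length ws = length ps"
      using that by (auto simp: mem_listset in_keys_iff)
    moreover have "length ws = length ps" if "ws \<in> ?K" using that by (simp add: mem_listset)
    ultimately show ?thesis by (auto simp: Bracket)
  qed simp
  finally show ?thesis .
qed

lemma bracket_basis: "bracket (map basis_vec ws) = basis_vec (Bracket ws)"
proof (rule poly_mapping_eqI)
  fix w
  have "(\<Prod>i<length ws. Poly_Mapping.lookup (map basis_vec ws ! i) (us ! i)) = (if ws = us then 1 else 0)"
    if "length us = length ws" for us
  proof (cases "ws = us")
    case False
    with that have "\<exists>i<length ws. ws ! i \<noteq> us ! i" by (simp add: list_eq_iff_nth_eq)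
    then obtain i where "i < length ws" "ws ! i \<noteq> us ! i" by blast
    then have "\<exists>i\<in>{..<length ws}. Poly_Mapping.lookup (map basis_vec ws ! i) (us ! i) = 0"
      by (intro bexI[of _ i]) (auto simp: lookup_single)
    then show ?thesis using False by (simp add: prod_zero)
  qed simp
  then show "Poly_Mapping.lookup (bracket (map basis_vec ws)) w = Poly_Mapping.lookup (basis_vec (Bracket ws)) w"
    by (auto simp: lookup_bracket lookup_single when_def split: bword.split)
qed

lemma bracket_add: "bracket ((p + q) # rs) = bracket (p # rs) + bracket (q # rs)"
  by (rule poly_mapping_eqI)
    (simp add: lookup_bracket lookup_add prod.lessThan_Suc_shift distrib_right split: bword.split del: prod.lessThan_Suc)

lemma bracket_zero: "bracket (0 # rs) = 0"
  by (rule poly_mapping_eqI)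
    (simp add: lookup_bracket prod.lessThan_Suc_shift split: bword.split del: prod.lessThan_Suc)

lemma bracket_sum: "bracket ((\<Sum>i\<in>S. p i) # rs) = (\<Sum>i\<in>S. bracket (p i # rs))"
  by (induction S rule: infinite_finite_induct) (simp_all add: bracket_zero bracket_add)

lemma bracket_diff: "bracket ((p - q) # rs) = bracket (p # rs) - bracket (q # rs)"
  using bracket_add[of "p - q" q rs] by simp

definition letter_act :: "('x \<Rightarrow> 'x) \<Rightarrow> ('x bword \<Rightarrow>\<^sub>0 complex) \<Rightarrow> 'x bword \<Rightarrow>\<^sub>0 complex" where
  "letter_act \<sigma> p = (\<Sum>b\<in>Poly_Mapping.keys p. Poly_Mapping.single (map_bword \<sigma> b) (Poly_Mapping.lookup p b))"

lemma lookup_letter_act: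
  assumes "bij \<sigma>"
  shows "Poly_Mapping.lookup (letter_act \<sigma> p) w = Poly_Mapping.lookup p (map_bword (inv_into UNIV \<sigma>) w)"
proof -
  have "map_bword (inv_into UNIV \<sigma>) (map_bword \<sigma> b) = b" "map_bword \<sigma> (map_bword (inv_into UNIV \<sigma>) b) = b" for b
    using assms by (simp_all add: bword.map_comp bij_is_inj bij_is_surj surj_iff[THEN iffD1] bword.map_id)
  then have "map_bword \<sigma> b = w \<longleftrightarrow> b = map_bword (inv_into UNIV \<sigma>) w" for b by metis
  then show ?thesis
    by (auto simp: letter_act_def lookup_sum lookup_single when_def in_keys_iff)
qed

lemma letter_act_add: "bij \<sigma> \<Longrightarrow> letter_act \<sigma> (p + q) = letter_act \<sigma> p + letter_act \<sigma> q"
  and letter_act_scale: "bij \<sigma> \<Longrightarrow> letter_act \<sigma> (scale a p) = scale a (letter_act \<sigma> p)"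
  and letter_act_diff: "bij \<sigma> \<Longrightarrow> letter_act \<sigma> (p - q) = letter_act \<sigma> p - letter_act \<sigma> q"
  and letter_act_zero: "bij \<sigma> \<Longrightarrow> letter_act \<sigma> 0 = 0"
  and letter_act_sum: "bij \<sigma> \<Longrightarrow> letter_act \<sigma> (\<Sum>i\<in>S. f i) = (\<Sum>i\<in>S. letter_act \<sigma> (f i))"
  by (auto intro!: poly_mapping_eqI simp: lookup_letter_act lookup_add lookup_scale lookup_minus lookup_sum)

lemma letter_act_single [simp]: "letter_act \<sigma> (Poly_Mapping.single b a) = Poly_Mapping.single (map_bword \<sigma> b) a"
  by (cases "a = 0") (simp_all add: letter_act_def)

lemma letter_act_bracket:
  assumes "bij \<sigma>"
  shows "letter_act \<sigma> (bracket ps) = bracket (map (letter_act \<sigma>) ps)"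
  by (rule poly_mapping_eqI) (auto simp: lookup_letter_act[OF assms] lookup_bracket split: bword.split)

lemma map_bword_in_bwords:
  assumes "\<sigma> ` A \<subseteq> A" "w \<in> bwords n A"
  shows "map_bword \<sigma> w \<in> bwords n A"
proof -
  have "nary n w \<Longrightarrow> nary n (map_bword \<sigma> w)" "letters (map_bword \<sigma> w) = map \<sigma> (letters w)" for w :: "'a bword"
    by (induction w) (auto simp: map_concat o_def intro: arg_cong[where f = concat])
  with assms show ?thesis by (fastforce simp: bwords_def)
qed

lemma bracket_in_bwords:
  assumes "length ps = n" "\<And>p. p \<in> set ps \<Longrightarrow> Poly_Mapping.keys p \<subseteq> bwords n A"
  shows "Poly_Mapping.keys (bracket ps) \<subseteq> bwords n A"
proof
  fix w assume w: "w \<in> Poly_Mapping.keys (bracket ps)"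
  then obtain ws where ws: "w = Bracket ws" "length ws = length ps"
    and nz: "(\<Prod>i<length ps. Poly_Mapping.lookup (ps ! i) (ws ! i)) \<noteq> 0"
    by (auto simp: in_keys_iff lookup_bracket split: bword.splits if_splits)
  have "ws ! i \<in> bwords n A" if "i < length ps" for i
  proof -
    have "Poly_Mapping.lookup (ps ! i) (ws ! i) \<noteq> 0" using nz that by auto
    then show ?thesis using assms(2)[of "ps ! i"] that by (auto simp: in_keys_iff)
  qed
  then have "set ws \<subseteq> bwords n A" using ws(2) by (auto simp: in_set_conv_nth)
  then show "w \<in> bwords n A" using ws assms(1) by (auto simp: bwords_def)
qed

lemma carrier_free_nary: "carrier (free_nary n A) = {p. Poly_Mapping.keys p \<subseteq> bwords n A}"
  by (simp add: free_nary_def free_rep_def)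

lemma basis_in_C: "basis_vec w \<in> carrier (free_nary n A) \<longleftrightarrow> w \<in> bwords n A"
  by (simp add: carrier_free_nary)

lemma linear_image_free_nary: "linear_image (free_nary n A) id (carrier (free_nary n A))"
  unfolding carrier_free_nary unfolding free_nary_def by (rule linear_image_free_rep)

lemma submodule_free_nary_iff:
  "submodule I complex_ring (free_nary n A) \<longleftrightarrow> pm.subspace I \<and> I \<subseteq> carrier (free_nary n A)"
proof
  assume I: "submodule I complex_ring (free_nary n A)"
  then have "I \<subseteq> carrier (free_nary n A)"
    using submodule.axioms(1)[OF I] subgroup.subset by fastforce
  then show "pm.subspace I \<and> I \<subseteq> carrier (free_nary n A)"
    using submodule_preimage[OF linear_image_free_nary I] by (simp add: Collect_conj_eq Int_absorb1 Collect_mem_eq)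
next
  assume "pm.subspace I \<and> I \<subseteq> carrier (free_nary n A)"
  then show "submodule I complex_ring (free_nary n A)"
    using submodule_image[OF linear_image_free_nary, of I] by simp
qed

lemma antisymmetry_relationsI:
  "length xs = n \<Longrightarrow> set xs \<subseteq> carrier (free_nary n A) \<Longrightarrow> \<sigma> permutes {..<n} \<Longrightarrow>
    bracket xs - scale (of_int (sign \<sigma>)) (bracket (permute_list \<sigma> xs)) \<in> antisymmetry_relations n A"
  unfolding antisymmetry_relations_def by blast

lemma jacobi_relationsI:
  "length xs = n \<Longrightarrow> length ys = n - 1 \<Longrightarrow> set xs \<subseteq> carrier (free_nary n A) \<Longrightarrow>
    set ys \<subseteq> carrier (free_nary n A) \<Longrightarrow>
    bracket (bracket xs # ys) - (\<Sum>i<n. bracket (xs[i := bracket (xs ! i # ys)])) \<in> jacobi_relations n A"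
  unfolding jacobi_relations_def by blast

text \<open>The ideal is an intersection; over an empty family it would be the whole type instead of
  a subset of \<open>C\<close>. For natural numbers as letters, the kernel of an evaluation in the
  cross product algebra is a member of the family.\<close>

locale filippov =
  fixes n :: nat and A :: "'x set"
  assumes proper: "\<exists>I. nary_ideal n A I \<and> antisymmetry_relations n A \<subseteq> I \<and> jacobi_relations n A \<subseteq> I"
begin

abbreviation "C \<equiv> carrier (free_nary n A)"
abbreviation "J \<equiv> filippov_ideal n A"

lemma subspace_C: "pm.subspace C"
  using linear_image_free_nary[of n A] unfolding linear_image_def by blast

lemma ideal_subspace: "pm.subspace J"
  unfolding filippov_ideal_def
  by (rule pm.subspace_Inter) (auto simp: nary_ideal_def submodule_free_nary_iff)

lemma ideal_subset: "J \<subseteq> C"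
  using proper by (auto simp: filippov_ideal_def nary_ideal_def submodule_free_nary_iff)

lemma ideal_bracket:
  assumes "length ps = n" "set ps \<subseteq> C" "p \<in> set ps" "p \<in> J"
  shows "bracket ps \<in> J"
  unfolding filippov_ideal_def
proof (rule InterI)
  fix I assume I: "I \<in> {I. nary_ideal n A I \<and> antisymmetry_relations n A \<subseteq> I \<and> jacobi_relations n A \<subseteq> I}"
  then have "p \<in> I" using assms(4) by (auto simp: filippov_ideal_def)
  then have "set ps \<inter> I \<noteq> {}" using assms(3) by blast
  then show "bracket ps \<in> I" using I assms(1,2) by (simp add: nary_ideal_def)
qed

lemma ideal_relations: "antisymmetry_relations n A \<subseteq> J" "jacobi_relations n A \<subseteq> J"
  by (auto simp: filippov_ideal_def)

lemma bracket_in_C: "length ps = n \<Longrightarrow> set ps \<subseteq> C \<Longrightarrow> bracket ps \<in> C"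
  using bracket_in_bwords[of ps n A] by (auto simp: carrier_free_nary)

lemma basis_antisymmetry:
  assumes "length ws = n" "set ws \<subseteq> bwords n A" "\<sigma> permutes {..<n}"
  shows "basis_vec (Bracket ws) - scale (of_int (sign \<sigma>)) (basis_vec (Bracket (permute_list \<sigma> ws))) \<in> J"
proof -
  have eq: "permute_list \<sigma> (map basis_vec ws) = map basis_vec (permute_list \<sigma> ws)"
    using assms(1,3) by (simp add: permute_list_map)
  have "bracket (map basis_vec ws) - scale (of_int (sign \<sigma>)) (bracket (permute_list \<sigma> (map basis_vec ws)))
    \<in> antisymmetry_relations n A"
    using assms by (intro antisymmetry_relationsI) (auto simp: basis_in_C)
  then show ?thesis using ideal_relations(1) unfolding eq bracket_basis by blast
qed

lemma basis_jacobi: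
  assumes "length us = n" "set us \<subseteq> bwords n A" "length ws = n - 1" "set ws \<subseteq> bwords n A" "n \<ge> 1"
  shows "basis_vec (Bracket (Bracket us # ws)) - (\<Sum>i<n. basis_vec (Bracket (us[i := Bracket (us ! i # ws)]))) \<in> J"
proof -
  let ?us = "map basis_vec us :: ('x bword \<Rightarrow>\<^sub>0 complex) list" and ?ws = "map basis_vec ws :: ('x bword \<Rightarrow>\<^sub>0 complex) list"
  have "bracket (bracket ?us # ?ws) - (\<Sum>i<n. bracket (?us[i := bracket (?us ! i # ?ws)])) \<in> jacobi_relations n A"
    using assms by (intro jacobi_relationsI) (auto simp: basis_in_C)
  moreover have "bracket (bracket ?us # ?ws) = basis_vec (Bracket (Bracket us # ws))"
    using bracket_basis[of "Bracket us # ws"] by (simp add: bracket_basis)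
  moreover have "bracket (?us[i := bracket (?us ! i # ?ws)]) = basis_vec (Bracket (us[i := Bracket (us ! i # ws)]))"
    if "i < n" for i
    using that assms bracket_basis[of "us ! i # ws"] bracket_basis[of "us[i := Bracket (us ! i # ws)]"]
    by (simp add: map_update)
  ultimately show ?thesis using ideal_relations(2) by auto
qed

lemma bracket_ideal_first:
  assumes "p \<in> J" "length ws = n - 1" "set ws \<subseteq> bwords n A" "n \<ge> 1"
  shows "bracket (p # map basis_vec ws) \<in> J"
  by (rule ideal_bracket[of _ p]) (use assms ideal_subset in \<open>auto simp: basis_in_C subset_iff\<close>)

text \<open>Minimality of \<open>J\<close>: the elements that \<open>\<sigma>\<close> maps into
  \<open>J\<close> form an ideal, and it contains the relations because \<open>\<sigma>\<close> maps
  relations to relations.\<close>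

lemma ideal_letter_act:
  assumes "\<sigma> permutes A" "p \<in> J"
  shows "letter_act \<sigma> p \<in> J"
proof -
  have bij: "bij \<sigma>" using assms(1) by (rule permutes_bij)
  have act_C: "letter_act \<sigma> q \<in> C" if "q \<in> C" for q
  proof -
    have "Poly_Mapping.keys (letter_act \<sigma> q) \<subseteq> map_bword \<sigma> ` Poly_Mapping.keys q"
      unfolding letter_act_def
      by (rule order_trans[OF Poly_Mapping.keys_sum]) (auto split: if_splits)
    then show ?thesis
      using that map_bword_in_bwords[of \<sigma> A _ n] permutes_image[OF assms(1)]
      by (fastforce simp: carrier_free_nary)
  qed
  let ?I = "{q \<in> C. letter_act \<sigma> q \<in> J}"
  have "nary_ideal n A ?I"
    unfolding nary_ideal_def submodule_free_nary_iff
  proof (intro conjI allI impI)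
    show "pm.subspace ?I"
      using subspace_C ideal_subspace
      by (auto simp: pm.subspace_def letter_act_add[OF bij] letter_act_scale[OF bij] letter_act_zero[OF bij])
    fix ps assume ps: "length ps = n \<and> set ps \<subseteq> C \<and> set ps \<inter> ?I \<noteq> {}"
    then obtain q where "q \<in> set ps" "letter_act \<sigma> q \<in> J" by blast
    then have "bracket (map (letter_act \<sigma>) ps) \<in> J"
      using ps act_C by (intro ideal_bracket[of _ "letter_act \<sigma> q"]) auto
    then show "bracket ps \<in> ?I" using ps bracket_in_C by (simp add: letter_act_bracket[OF bij])
  qed auto
  moreover have "antisymmetry_relations n A \<subseteq> ?I"
  proof
    fix q assume q: "q \<in> antisymmetry_relations n A"
    then obtain xs \<tau> where xs: "length xs = n" "set xs \<subseteq> C" "\<tau> permutes {..<n}"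
      and q_eq: "q = bracket xs - scale (of_int (sign \<tau>)) (bracket (permute_list \<tau> xs))"
      unfolding antisymmetry_relations_def by blast
    have "letter_act \<sigma> q = bracket (map (letter_act \<sigma>) xs)
        - scale (of_int (sign \<tau>)) (bracket (permute_list \<tau> (map (letter_act \<sigma>) xs)))"
      using xs by (simp add: q_eq letter_act_diff[OF bij] letter_act_scale[OF bij] letter_act_bracket[OF bij] permute_list_map)
    also have "\<dots> \<in> antisymmetry_relations n A"
      using xs act_C by (intro antisymmetry_relationsI) auto
    finally show "q \<in> ?I" using q ideal_relations(1) ideal_subset by blast
  qed
  moreover have "jacobi_relations n A \<subseteq> ?I"
  proof
    fix q assume q: "q \<in> jacobi_relations n A"
    then obtain xs ys where xs: "length xs = n" "length ys = n - 1" "set xs \<subseteq> C" "set ys \<subseteq> C"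
      and q_eq: "q = bracket (bracket xs # ys) - (\<Sum>i<n. bracket (xs[i := bracket (xs ! i # ys)]))"
      unfolding jacobi_relations_def by blast
    let ?f = "map (letter_act \<sigma>)"
    have "letter_act \<sigma> q = bracket (bracket (?f xs) # ?f ys) - (\<Sum>i<n. bracket ((?f xs)[i := bracket (?f xs ! i # ?f ys)]))"
      using xs by (simp add: q_eq letter_act_diff[OF bij] letter_act_sum[OF bij] letter_act_bracket[OF bij] map_update)
    also have "\<dots> \<in> jacobi_relations n A"
      using xs act_C by (intro jacobi_relationsI) auto
    finally show "q \<in> ?I" using q ideal_relations(2) ideal_subset by blast
  qed
  ultimately have "J \<subseteq> ?I" unfolding filippov_ideal_def by blast
  then show ?thesis using assms(2) by blast
qed

lemma coset_eq: "J +>\<^bsub>free_nary n A\<^esub> x = {h + x |h. h \<in> J}"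
  by (auto simp: a_r_coset_def r_coset_def free_nary_def free_rep_def)

lemma coset_eq_iff: "J +>\<^bsub>free_nary n A\<^esub> x = J +>\<^bsub>free_nary n A\<^esub> y \<longleftrightarrow> x - y \<in> J"
proof
  assume "J +>\<^bsub>free_nary n A\<^esub> x = J +>\<^bsub>free_nary n A\<^esub> y"
  moreover have "x \<in> J +>\<^bsub>free_nary n A\<^esub> x"
    using pm.subspace_0[OF ideal_subspace] by (force simp: coset_eq)
  ultimately show "x - y \<in> J" by (auto simp: coset_eq)
next
  have sub: "J +>\<^bsub>free_nary n A\<^esub> x \<subseteq> J +>\<^bsub>free_nary n A\<^esub> y" if "x - y \<in> J" for x y
  proof
    fix z assume "z \<in> J +>\<^bsub>free_nary n A\<^esub> x"
    then obtain h where h: "h \<in> J" "z = h + x" by (auto simp: coset_eq)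
    then have "z = (h + (x - y)) + y" "h + (x - y) \<in> J"
      using that ideal_subspace by (simp_all add: pm.subspace_add)
    then show "z \<in> J +>\<^bsub>free_nary n A\<^esub> y" unfolding coset_eq by blast
  qed
  assume xy: "x - y \<in> J"
  then have "y - x \<in> J" using pm.subspace_neg[OF ideal_subspace xy] by simp
  with xy sub show "J +>\<^bsub>free_nary n A\<^esub> x = J +>\<^bsub>free_nary n A\<^esub> y" by blast
qed

text \<open>Scalar multiplication in the quotient is a union over representatives; as
  \<open>J\<close> is a subspace, all of them contribute the same coset.\<close>

lemma linear_image_free_filippov: "linear_image (free_filippov n A) (\<lambda>x. J +>\<^bsub>free_nary n A\<^esub> x) C"
proof -
  let ?\<phi> = "\<lambda>x. J +>\<^bsub>free_nary n A\<^esub> x"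
  have smult: "module.smult (free_nary n A) a x = scale a x" for a x
    by (simp add: free_nary_def free_rep_def)
  have "?\<phi> (scale a y) = ?\<phi> (scale a x)" if "y \<in> ?\<phi> x" for a x y
  proof -
    have "scale a y - scale a x = scale a (y - x)" by (simp add: pm.scale_right_diff_distrib)
    moreover have "y - x \<in> J" using that by (auto simp: coset_eq)
    ultimately show ?thesis using ideal_subspace by (simp add: coset_eq_iff pm.subspace_scale)
  qed
  moreover have "x \<in> ?\<phi> x" for x using pm.subspace_0[OF ideal_subspace] by (force simp: coset_eq)
  ultimately have "(\<Union>y\<in>?\<phi> x. ?\<phi> (scale a y)) = ?\<phi> (scale a x)" for a x by blast
  then have 1: "module.smult (free_filippov n A) a (?\<phi> x) = ?\<phi> (scale a x)" for a x
    by (simp add: free_filippov_def quotient_rep_def smult)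
  have 2: "add (free_filippov n A) (?\<phi> x) (?\<phi> y) = ?\<phi> (x + y)" for x y
  proof -
    have "add (free_filippov n A) (?\<phi> x) (?\<phi> y) = {a + b |a b. a \<in> ?\<phi> x \<and> b \<in> ?\<phi> y}"
      by (auto simp: free_filippov_def quotient_rep_def set_add_def set_mult_def free_nary_def free_rep_def)
    also have "\<dots> = ?\<phi> (x + y)"
    proof
      show "{a + b |a b. a \<in> ?\<phi> x \<and> b \<in> ?\<phi> y} \<subseteq> ?\<phi> (x + y)"
      proof
        fix z assume "z \<in> {a + b |a b. a \<in> ?\<phi> x \<and> b \<in> ?\<phi> y}"
        then obtain g h where gh: "g \<in> J" "h \<in> J" "z = (g + x) + (h + y)" by (auto simp: coset_eq)
        then have "z = (g + h) + (x + y)" "g + h \<in> J"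
          using ideal_subspace by (simp_all add: algebra_simps pm.subspace_add)
        then show "z \<in> ?\<phi> (x + y)" unfolding coset_eq by blast
      qed
      show "?\<phi> (x + y) \<subseteq> {a + b |a b. a \<in> ?\<phi> x \<and> b \<in> ?\<phi> y}"
      proof
        fix z assume "z \<in> ?\<phi> (x + y)"
        then obtain h where "h \<in> J" "z = (h + x) + (0 + y)" by (auto simp: coset_eq algebra_simps)
        then show "z \<in> {a + b |a b. a \<in> ?\<phi> x \<and> b \<in> ?\<phi> y}"
          using pm.subspace_0[OF ideal_subspace] unfolding coset_eq by blast
      qed
    qed
    finally show ?thesis .
  qed
  have 3: "zero (free_filippov n A) = ?\<phi> 0"
    by (simp add: free_filippov_def quotient_rep_def coset_eq)
  have 4: "carrier (free_filippov n A) = ?\<phi> ` C"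
    by (auto simp: free_filippov_def quotient_rep_def A_RCOSETS_def RCOSETS_def a_r_coset_def)
  show ?thesis using subspace_C 1 2 3 4 by (simp add: linear_image_def)
qed

lemma act_free_filippov:
  assumes "\<sigma> permutes A"
  shows "act (free_filippov n A) \<sigma> (J +>\<^bsub>free_nary n A\<^esub> x) = J +>\<^bsub>free_nary n A\<^esub> letter_act \<sigma> x"
proof -
  let ?\<phi> = "\<lambda>x. J +>\<^bsub>free_nary n A\<^esub> x"
  have act: "act (free_nary n A) \<sigma> y = letter_act \<sigma> y" for y
    by (simp add: free_nary_def free_rep_def letter_act_def)
  have "?\<phi> (letter_act \<sigma> y) = ?\<phi> (letter_act \<sigma> x)" if "y \<in> ?\<phi> x" for y
  proof -
    have "y - x \<in> J" using that by (auto simp: coset_eq)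
    then have "letter_act \<sigma> (y - x) \<in> J" by (rule ideal_letter_act[OF assms])
    then show ?thesis by (simp add: coset_eq_iff letter_act_diff[OF permutes_bij[OF assms]])
  qed
  moreover have "x \<in> ?\<phi> x" using pm.subspace_0[OF ideal_subspace] by (force simp: coset_eq)
  ultimately have "(\<Union>y\<in>?\<phi> x. ?\<phi> (letter_act \<sigma> y)) = ?\<phi> (letter_act \<sigma> x)" by blast
  then show ?thesis by (simp add: free_filippov_def quotient_rep_def act)
qed

end

section \<open>The cross product algebra\<close>

definition vec_rows :: "nat \<Rightarrow> (nat \<Rightarrow> nat \<Rightarrow> complex) \<Rightarrow> complex mat" where
  "vec_rows n r = mat (Suc n) (Suc n) (\<lambda>(i, j). r i j)"

definition det_rows :: "nat \<Rightarrow> (nat \<Rightarrow> nat \<Rightarrow> complex) \<Rightarrow> complex" where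
  "det_rows n r = det (vec_rows n r)"

lemma det_rows_laplace:
  assumes "i \<le> n"
  shows "det_rows n r = (\<Sum>j\<le>n. r i j * cofactor (vec_rows n r) i j)"
proof -
  have "vec_rows n r \<in> carrier_mat (Suc n) (Suc n)" by (simp add: vec_rows_def)
  from laplace_expansion_row[OF this, of i] assms
  show ?thesis by (simp add: det_rows_def vec_rows_def lessThan_Suc_atMost)
qed

lemma cofactor_row_irrelevant:
  assumes "i \<le> n"
  shows "cofactor (vec_rows n (r(i := a))) i j = cofactor (vec_rows n r) i j"
proof -
  have "mat_delete (vec_rows n (r(i := a))) i j = mat_delete (vec_rows n r) i j"
    using assms by (auto simp: mat_delete_def vec_rows_def)
  then show ?thesis by (simp add: cofactor_def)
qed

lemma det_rows_upd:
  assumes "i \<le> n"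
  shows "det_rows n (r(i := a)) = (\<Sum>j\<le>n. a j * cofactor (vec_rows n r) i j)"
  by (subst det_rows_laplace[OF assms]) (simp add: cofactor_row_irrelevant[OF assms])

lemma det_rows_cong:
  "(\<And>i j. i \<le> n \<Longrightarrow> j \<le> n \<Longrightarrow> r i j = r' i j) \<Longrightarrow> det_rows n r = det_rows n r'"
  unfolding det_rows_def vec_rows_def by (rule arg_cong[where f = det]) auto

text \<open>The (j, l) entry of adj(M) M = det(M) 1. In contrast to the expansion along a row, this
  sums over the rows, as the derivation property below requires.\<close>

lemma column_cofactor:
  assumes "j \<le> n" "l \<le> n"
  shows "(\<Sum>i\<le>n. r i l * cofactor (vec_rows n r) i j) = (if j = l then det_rows n r else 0)"
proof -
  let ?A = "vec_rows n r"
  have A: "?A \<in> carrier_mat (Suc n) (Suc n)" by (simp add: vec_rows_def)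
  have "(adj_mat ?A * ?A) $$ (j, l) = (\<Sum>i\<le>n. r i l * cofactor ?A i j)"
    using assms A adj_mat(1)[OF A]
    by (simp add: scalar_prod_def adj_mat_def vec_rows_def lessThan_Suc_atMost atLeast0LessThan mult.commute)
  moreover have "(adj_mat ?A * ?A) $$ (j, l) = (if j = l then det_rows n r else 0)"
    using assms by (simp add: adj_mat(3)[OF A] det_rows_def)
  ultimately show ?thesis by simp
qed

text \<open>The infinitesimal form of the invariance of the determinant under the special linear group.\<close>

lemma det_rows_derivation:
  assumes "\<And>j. j \<le> n \<Longrightarrow> D j j = 0"
  shows "(\<Sum>i\<le>n. det_rows n (r(i := (\<lambda>j. \<Sum>l\<le>n. D j l * r i l)))) = 0"
proof -
  have "(\<Sum>i\<le>n. det_rows n (r(i := (\<lambda>j. \<Sum>l\<le>n. D j l * r i l))))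
      = (\<Sum>i\<le>n. \<Sum>j\<le>n. \<Sum>l\<le>n. D j l * (r i l * cofactor (vec_rows n r) i j))"
    by (intro sum.cong refl) (simp add: det_rows_upd sum_distrib_right mult.assoc)
  also have "\<dots> = (\<Sum>j\<le>n. \<Sum>i\<le>n. \<Sum>l\<le>n. D j l * (r i l * cofactor (vec_rows n r) i j))"
    by (rule sum.swap)
  also have "\<dots> = (\<Sum>j\<le>n. \<Sum>l\<le>n. \<Sum>i\<le>n. D j l * (r i l * cofactor (vec_rows n r) i j))"
    by (intro sum.cong refl sum.swap)
  also have "\<dots> = (\<Sum>j\<le>n. \<Sum>l\<le>n. D j l * (if j = l then det_rows n r else 0))"
    by (intro sum.cong refl) (simp add: sum_distrib_left[symmetric] column_cofactor)
  also have "\<dots> = 0" using assms by (simp add: if_distrib[where f = "\<lambda>x. _ * x"] cong: if_cong)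
  finally show ?thesis .
qed

lemma det_rows_swap:
  assumes "i \<le> n" "j \<le> n" "i \<noteq> j"
  shows "det_rows n (r(i := r j, j := r i)) = - det_rows n r"
proof -
  have A: "vec_rows n r \<in> carrier_mat (Suc n) (Suc n)" by (simp add: vec_rows_def)
  have "vec_rows n (r(i := r j, j := r i)) = swaprows i j (vec_rows n r)"
    using assms by (auto simp: vec_rows_def mat_swaprows_def)
  then show ?thesis
    using det_swaprows[of i "Suc n" j "vec_rows n r"] assms A by (simp add: det_rows_def)
qed

lemma det_rows_sum:
  assumes "i \<le> n"
  shows "det_rows n (r(i := (\<lambda>j. \<Sum>w\<in>S. a w * b w j))) = (\<Sum>w\<in>S. a w * det_rows n (r(i := b w)))"
proof -
  have "det_rows n (r(i := (\<lambda>j. \<Sum>w\<in>S. a w * b w j)))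
      = (\<Sum>j\<le>n. \<Sum>w\<in>S. a w * (b w j * cofactor (vec_rows n r) i j))"
    by (simp add: det_rows_upd[OF assms] sum_distrib_right mult.assoc)
  also have "\<dots> = (\<Sum>w\<in>S. \<Sum>j\<le>n. a w * (b w j * cofactor (vec_rows n r) i j))"
    by (rule sum.swap)
  finally show ?thesis by (simp add: det_rows_upd[OF assms] sum_distrib_left)
qed

lemma det_rows_permute:
  assumes "\<sigma> permutes {..n}"
  shows "det_rows n (\<lambda>i. r (\<sigma> i)) = of_int (sign \<sigma>) * det_rows n r"
proof -
  have A: "vec_rows n r \<in> carrier_mat (Suc n) (Suc n)" by (simp add: vec_rows_def)
  have p: "\<sigma> permutes {0..<Suc n}"
    using assms by (simp add: atLeast0LessThan lessThan_Suc_atMost)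
  have "mat (Suc n) (Suc n) (\<lambda>(i, j). vec_rows n r $$ (\<sigma> i, j)) = vec_rows n (\<lambda>i. r (\<sigma> i))"
    unfolding vec_rows_def using permutes_in_image[OF p] by (intro eq_matI) auto
  then show ?thesis using det_permute_rows[OF A p] by (simp add: det_rows_def)
qed

lemma det_rows_equal_rows:
  assumes "i \<le> n" "j \<le> n" "i \<noteq> j" "r i = r j"
  shows "det_rows n r = 0"
  unfolding det_rows_def
  by (rule det_identical_rows[where n = "Suc n" and i = i and j = j])
    (use assms in \<open>auto simp: vec_rows_def intro!: eq_vecI\<close>)

section \<open>The cross product and the evaluation of words in it\<close>

definition unit_vector :: "nat \<Rightarrow> nat \<Rightarrow> complex" where
  "unit_vector k = (\<lambda>j. if j = k then 1 else 0)"

text \<open>The rows are distinct unit vectors, so the matrix times its transpose is the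
  identity.\<close>

lemma det_rows_unit_vectors:
  assumes "inj_on q {..n}" "q ` {..n} \<subseteq> {..n}"
  shows "det_rows n (\<lambda>i. unit_vector (q i)) \<noteq> 0"
proof -
  let ?A = "vec_rows n (\<lambda>i. unit_vector (q i))"
  have A: "?A \<in> carrier_mat (Suc n) (Suc n)" by (simp add: vec_rows_def)
  have "?A * ?A\<^sup>T = 1\<^sub>m (Suc n)"
  proof (rule eq_matI)
    fix i j assume "i < dim_row (1\<^sub>m (Suc n))" "j < dim_col (1\<^sub>m (Suc n))"
    then have ij: "i < Suc n" "j < Suc n" by simp_all
    then have "q i < Suc n" "q j < Suc n" "q i = q j \<longleftrightarrow> i = j"
      using assms by (auto simp: inj_on_eq_iff less_Suc_eq_le)
    then show "(?A * ?A\<^sup>T) $$ (i, j) = 1\<^sub>m (Suc n) $$ (i, j)"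
      using ij by (simp add: vec_rows_def scalar_prod_def unit_vector_def if_distrib[where f = "\<lambda>x. x * _"]
          cong: if_cong)
  qed (simp_all add: vec_rows_def)
  then have "det ?A * det (?A\<^sup>T) = 1" using det_mult[of ?A "Suc n" "?A\<^sup>T"] A by simp
  then show ?thesis by (auto simp: det_rows_def)
qed

text \<open>The vector that represents the linear form z \<mapsto> det(x_0, ..., x_(n-1), z) on
  C^(n+1). Vectors are functions on all natural numbers of which the coordinates up to n
  count.\<close>

definition cross :: "nat \<Rightarrow> (nat \<Rightarrow> complex) list \<Rightarrow> nat \<Rightarrow> complex" where
  "cross n xs k = (if k \<le> n then det_rows n (\<lambda>i. if i < n then xs ! i else unit_vector k) else 0)"

lemma cross_row:
  assumes "i < n" "length xs = n"
  shows "(\<lambda>l. if l < n then (xs[i := a]) ! l else z) = (\<lambda>l. if l < n then xs ! l else z)(i := a)"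
  using assms by (auto simp: fun_eq_iff)

lemma cross_sum:
  assumes "length xs = n" "i < n"
  shows "cross n (xs[i := (\<lambda>j. \<Sum>w\<in>S. a w * b w j)]) k = (\<Sum>w\<in>S. a w * cross n (xs[i := b w]) k)"
  using assms det_rows_sum[of i n "\<lambda>i. if i < n then xs ! i else unit_vector k" a b S]
  by (simp add: cross_def cross_row)

lemma cross_permute:
  assumes "\<sigma> permutes {..<n}" "length xs = n"
  shows "cross n (permute_list \<sigma> xs) k = of_int (sign \<sigma>) * cross n xs k"
proof -
  have p: "\<sigma> permutes {..n}" using assms(1) by (rule permutes_subset) auto
  have "(\<lambda>i. if i < n then permute_list \<sigma> xs ! i else unit_vector k)
      = (\<lambda>i. if \<sigma> i < n then xs ! \<sigma> i else unit_vector k)"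
    using assms permutes_in_image[OF assms(1)] by (auto simp: permute_list_nth fun_eq_iff)
  then show ?thesis
    using det_rows_permute[OF p, of "\<lambda>i. if i < n then xs ! i else unit_vector k"] by (simp add: cross_def)
qed

lemma unit_vector_expansion: "j \<le> n \<Longrightarrow> (\<Sum>l\<le>n. z l * unit_vector l j) = z j"
  by (simp add: unit_vector_def if_distrib[where f = "\<lambda>x. _ * x"] cong: if_cong)

lemma cross_cong:
  assumes "\<And>i j. i < n \<Longrightarrow> j \<le> n \<Longrightarrow> (xs ! i) j = (ys ! i) j"
  shows "cross n xs k = cross n ys k"
  unfolding cross_def using assms by (auto intro!: det_rows_cong)

text \<open>Bracketing with \<open>ys\<close> is the linear map with matrix \<open>D\<close>, whose
  entries are determinants containing two unit vectors. The diagonal of \<open>D\<close> vanishes,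
  so \<open>D\<close> acts as a derivation with sum 0 on the determinant with rows \<open>xs\<close>
  and the unit vector of \<open>k\<close>. As \<open>D\<close> is skew, its action on this last row
  amounts to minus the action on \<open>cross n xs\<close>; the other rows give the sum over
  i.\<close>

lemma cross_filippov:
  assumes n: "n \<ge> 1" and xs: "length xs = n" and ys: "length ys = n - 1"
  shows "cross n (cross n xs # ys) k = (\<Sum>i<n. cross n (xs[i := cross n (xs ! i # ys)]) k)"
proof (cases "k \<le> n")
  case k: True
  define D where "D j l = cross n (unit_vector l # ys) j" for j l
  have ad: "cross n (z # ys) j = (\<Sum>l\<le>n. D j l * z l)" for z j
  proof -
    have "cross n (z # ys) j = cross n ((undefined # ys)[0 := (\<lambda>j. \<Sum>l\<le>n. z l * unit_vector l j)]) j"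
      using n by (intro cross_cong) (auto simp: nth_Cons unit_vector_expansion split: nat.split)
    also have "\<dots> = (\<Sum>l\<le>n. z l * D j l)"
      using n ys by (subst cross_sum) (auto simp: D_def)
    finally show ?thesis by (simp add: mult.commute)
  qed
  have D_diag: "D j j = 0" if "j \<le> n" for j
    using that n unfolding D_def cross_def by (auto intro!: det_rows_equal_rows[of 0 n n])
  have D_skew: "D l j = - D j l" if "j \<le> n" "l \<le> n" for j l
  proof -
    let ?r = "\<lambda>i. if i < n then (unit_vector l # ys) ! i else unit_vector j"
    have "det_rows n (?r(0 := ?r n, n := ?r 0)) = det_rows n (\<lambda>i. if i < n then (unit_vector j # ys) ! i else unit_vector l)"
      using n by (intro det_rows_cong) (auto simp: nth_Cons split: nat.split)
    then show ?thesis using det_rows_swap[of 0 n n ?r] n that by (simp add: D_def cross_def)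
  qed
  define r where "r = (\<lambda>i. if i < n then xs ! i else unit_vector k)"
  have "(\<Sum>i\<le>n. det_rows n (r(i := (\<lambda>j. \<Sum>l\<le>n. D j l * r i l)))) = 0"
    by (rule det_rows_derivation) (rule D_diag)
  moreover have "det_rows n (r(i := (\<lambda>j. \<Sum>l\<le>n. D j l * r i l))) = cross n (xs[i := cross n (xs ! i # ys)]) k"
    if "i < n" for i
    using that k xs by (simp add: cross_def[of _ _ k] cross_row r_def ad[abs_def])
  moreover have "det_rows n (r(n := (\<lambda>j. \<Sum>l\<le>n. D j l * r n l))) = - cross n (cross n xs # ys) k"
  proof -
    have "det_rows n (r(n := (\<lambda>j. \<Sum>l\<le>n. D j l * r n l))) = det_rows n (r(n := (\<lambda>j. \<Sum>l\<le>n. D l k * unit_vector l j)))"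
      using k by (intro det_rows_cong)
        (auto simp: r_def unit_vector_expansion unit_vector_def if_distrib[where f = "\<lambda>x. _ * x"] cong: if_cong)
    also have "\<dots> = (\<Sum>l\<le>n. D l k * det_rows n (r(n := unit_vector l)))"
      by (rule det_rows_sum) simp
    also have "\<dots> = (\<Sum>l\<le>n. - D k l * cross n xs l)"
    proof (intro sum.cong refl)
      fix l assume "l \<in> {..n}"
      moreover have "det_rows n (r(n := unit_vector l)) = det_rows n (\<lambda>i. if i < n then xs ! i else unit_vector l)"
        by (intro det_rows_cong) (auto simp: r_def)
      ultimately show "D l k * det_rows n (r(n := unit_vector l)) = - D k l * cross n xs l"
        using D_skew[of k l] k by (simp add: cross_def)
    qed
    finally show ?thesis by (simp add: ad sum_negf)
  qed
  ultimately show ?thesis by (simp add: atMost_Suc lessThan_Suc_atMost[symmetric])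
qed (simp add: cross_def)

primrec ev :: "nat \<Rightarrow> (nat \<Rightarrow> nat) \<Rightarrow> nat bword \<Rightarrow> nat \<Rightarrow> complex" where
  "ev n f (Letter x) = unit_vector (f x)"
| "ev n f (Bracket ws) = cross n (map (ev n f) ws)"

text \<open>Multilinear expansion, one argument at a time; \<open>us\<close> collects the arguments
  in which a single word has already been chosen.\<close>

lemma cross_lin_ext:
  fixes ps :: "(nat bword \<Rightarrow>\<^sub>0 complex) list"
  assumes "length us + length ps = n"
  shows "cross n (us @ map (\<lambda>p j. lin_ext (\<lambda>w. \<phi> w j) p) ps) k =
    (\<Sum>ws\<in>listset (map Poly_Mapping.keys ps).
      (\<Prod>i<length ps. Poly_Mapping.lookup (ps ! i) (ws ! i)) * cross n (us @ map \<phi> ws) k)"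
  using assms
proof (induction ps arbitrary: us)
  case (Cons p ps)
  let ?g = "\<lambda>p j. lin_ext (\<lambda>w. \<phi> w j) p"
  let ?K = "listset (map Poly_Mapping.keys ps)"
  have fin: "finite ?K" by (rule finite_listset) auto
  have upd: "us @ a # zs = (us @ undefined # zs)[length us := a]" for a zs by simp
  have "cross n (us @ map ?g (p # ps)) k =
      (\<Sum>w\<in>Poly_Mapping.keys p. Poly_Mapping.lookup p w * cross n (us @ \<phi> w # map ?g ps) k)"
    using Cons.prems unfolding lin_ext_def list.map
    by (subst (1 2) upd) (subst cross_sum, auto)
  also have "\<dots> = (\<Sum>w\<in>Poly_Mapping.keys p. \<Sum>ws\<in>?K. Poly_Mapping.lookup p w *
      ((\<Prod>i<length ps. Poly_Mapping.lookup (ps ! i) (ws ! i)) * cross n (us @ \<phi> w # map \<phi> ws) k))"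
    using Cons.IH[of "us @ [\<phi> _]"] Cons.prems by (simp add: sum_distrib_left)
  also have "\<dots> = (\<Sum>(w, ws)\<in>Poly_Mapping.keys p \<times> ?K. Poly_Mapping.lookup p w *
      ((\<Prod>i<length ps. Poly_Mapping.lookup (ps ! i) (ws ! i)) * cross n (us @ \<phi> w # map \<phi> ws) k))"
    by (rule sum.cartesian_product)
  also have "\<dots> = (\<Sum>ws\<in>listset (map Poly_Mapping.keys (p # ps)).
      (\<Prod>i<length (p # ps). Poly_Mapping.lookup ((p # ps) ! i) (ws ! i)) * cross n (us @ map \<phi> ws) k)"
    by (rule sum.reindex_bij_witness[where i = "\<lambda>ws. (hd ws, tl ws)" and j = "\<lambda>(w, ws). w # ws"])
      (auto simp: set_Cons_def prod.lessThan_Suc_shift simp del: prod.lessThan_Suc)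
  finally show ?case .
qed simp

lemma lin_ext_bracket:
  assumes "length ps = n"
  shows "lin_ext (\<lambda>w. ev n f w k) (bracket ps) = cross n (map (\<lambda>p j. lin_ext (\<lambda>w. ev n f w j) p) ps) k"
  using cross_lin_ext[of "[]" ps n "ev n f" k] assms
  by (simp add: bracket_def linear_functional_sum[OF linear_functional_lin_ext])

definition evaluation :: "nat \<Rightarrow> (nat \<Rightarrow> nat) \<Rightarrow> (nat bword \<Rightarrow>\<^sub>0 complex) \<Rightarrow> nat \<Rightarrow> complex" where
  "evaluation n f p k = lin_ext (\<lambda>w. ev n f w k) p"

lemma evaluation_bracket: "length ps = n \<Longrightarrow> evaluation n f (bracket ps) = cross n (map (evaluation n f) ps)"
  by (simp add: evaluation_def[abs_def] lin_ext_bracket)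

lemma linear_evaluation: "linear_functional (\<lambda>p. evaluation n f p k)"
  unfolding evaluation_def by (rule linear_functional_lin_ext)

lemma cross_zero:
  assumes "length xs = n" "(\<lambda>j. 0) \<in> set xs"
  shows "cross n xs k = 0"
proof -
  obtain i where i: "i < n" "xs ! i = (\<lambda>j. 0)" using assms by (auto simp: in_set_conv_nth)
  then have "xs = xs[i := (\<lambda>j. \<Sum>w\<in>({} :: nat set). 0 * 0)]" by (metis list_update_id sum.empty)
  then show ?thesis using cross_sum[OF assms(1) i(1), of "\<lambda>_. 0" "\<lambda>_ _. 0" "{} :: nat set" k] by simp
qed

text \<open>Evaluation is a homomorphism into the cross product algebra, so its kernel is an ideal
  that contains the relations. It serves twice: it keeps the Filippov ideal inside the free algebra,
  in \<open>filippov_nat\<close>, and it yields a functional that does not vanish on a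
  non-comb.\<close>

lemma evaluation_kernel:
  assumes n: "n \<ge> 1"
  fixes A :: "nat set" and f :: "nat \<Rightarrow> nat"
  defines "I \<equiv> {p \<in> carrier (free_nary n A). evaluation n f p = (\<lambda>_. 0)}"
  shows "nary_ideal n A I" "antisymmetry_relations n A \<subseteq> I" "jacobi_relations n A \<subseteq> I"
proof -
  let ?C = "carrier (free_nary n A)" and ?e = "evaluation n f"
  have C: "pm.subspace ?C" using linear_image_free_nary[of n A] unfolding linear_image_def by blast
  note lin = linear_evaluation[of n f]
  have add: "?e (p + q) = (\<lambda>k. ?e p k + ?e q k)" and scale: "?e (scale a p) = (\<lambda>k. a * ?e p k)" for p q a
    using lin unfolding linear_functional_def by (auto simp: fun_eq_iff)
  have zero: "?e 0 = (\<lambda>_. 0)" and diff: "?e (p - q) = (\<lambda>k. ?e p k - ?e q k)"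
    and sum: "?e (\<Sum>i\<in>S. h i) = (\<lambda>k. \<Sum>i\<in>S. ?e (h i) k)" for p q h and S :: "nat set"
    using linear_functional_zero[OF lin] linear_functional_diff[OF lin] linear_functional_sum[OF lin]
    by (auto simp: fun_eq_iff)
  have bracket_C: "bracket ps \<in> ?C" if "length ps = n" "set ps \<subseteq> ?C" for ps
    using bracket_in_bwords[of ps n A] that by (auto simp: carrier_free_nary)
  show "nary_ideal n A I"
    unfolding nary_ideal_def submodule_free_nary_iff
  proof (intro conjI allI impI)
    show "pm.subspace I" using C by (auto simp: I_def pm.subspace_def add scale zero)
    show "I \<subseteq> ?C" by (auto simp: I_def)
    fix ps assume ps: "length ps = n \<and> set ps \<subseteq> ?C \<and> set ps \<inter> I \<noteq> {}"
    then have "(\<lambda>_. 0) \<in> set (map ?e ps)" by (force simp: I_def)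
    then have "cross n (map ?e ps) k = 0" for k using ps by (intro cross_zero) auto
    then show "bracket ps \<in> I" using ps bracket_C by (auto simp: I_def evaluation_bracket fun_eq_iff)
  qed
  show "antisymmetry_relations n A \<subseteq> I"
  proof
    fix q assume "q \<in> antisymmetry_relations n A"
    then obtain xs \<tau> where xs: "length xs = n" "set xs \<subseteq> ?C" "\<tau> permutes {..<n}"
      and q: "q = bracket xs - scale (of_int (sign \<tau>)) (bracket (permute_list \<tau> xs))"
      unfolding antisymmetry_relations_def by blast
    have "bracket xs \<in> ?C" "bracket (permute_list \<tau> xs) \<in> ?C" using xs by (simp_all add: bracket_C)
    then have "q \<in> ?C" unfolding q by (intro pm.subspace_diff[OF C] pm.subspace_scale[OF C])
    moreover have "map ?e (permute_list \<tau> xs) = permute_list \<tau> (map ?e xs)"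
      using xs by (simp add: permute_list_map)
    then have "?e q = (\<lambda>_. 0)"
      using xs by (simp add: q diff scale evaluation_bracket cross_permute mult.assoc[symmetric] of_int_mult[symmetric] del: of_int_mult)
    ultimately show "q \<in> I" by (simp add: I_def)
  qed
  show "jacobi_relations n A \<subseteq> I"
  proof
    fix q assume "q \<in> jacobi_relations n A"
    then obtain xs ys where xs: "length xs = n" "length ys = n - 1" "set xs \<subseteq> ?C" "set ys \<subseteq> ?C"
      and q: "q = bracket (bracket xs # ys) - (\<Sum>i<n. bracket (xs[i := bracket (xs ! i # ys)]))"
      unfolding jacobi_relations_def by blast
    have "bracket (xs[i := bracket (xs ! i # ys)]) \<in> ?C" if "i < n" for i
    proof -
      have "bracket (xs ! i # ys) \<in> ?C" using xs n that by (intro bracket_C) auto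
      then show ?thesis using xs set_update_subset_insert[of xs i] by (intro bracket_C) auto
    qed
    moreover have "bracket (bracket xs # ys) \<in> ?C"
      using xs n bracket_C[of xs] by (intro bracket_C[of "bracket xs # ys"]) auto
    ultimately have "q \<in> ?C" unfolding q by (intro pm.subspace_diff[OF C] pm.subspace_sum[OF C]) auto
    moreover have "?e q k = 0" for k
      using xs n cross_filippov[of n "map ?e xs" "map ?e ys" k]
      by (simp add: q diff sum evaluation_bracket map_update)
    ultimately show "q \<in> I" by (simp add: I_def fun_eq_iff)
  qed
qed

lemma evaluation_ideal: "n \<ge> 1 \<Longrightarrow> p \<in> filippov_ideal n A \<Longrightarrow> evaluation n f p k = 0"
  using evaluation_kernel[of n A f] by (auto simp: filippov_ideal_def)

lemma filippov_nat: "n \<ge> 1 \<Longrightarrow> filippov n (A :: nat set)"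
  using evaluation_kernel[of n A "\<lambda>_. 0"] by unfold_locales blast

lemma cross_unit_vectors:
  assumes "distinct is" "length is = n" "set is \<subseteq> {..n}" "m \<le> n" "m \<notin> set is"
  obtains a where "a \<noteq> 0" "cross n (map unit_vector is) = (\<lambda>j. a * unit_vector m j)"
proof
  let ?r = "\<lambda>k i. if i < n then map unit_vector is ! i else unit_vector k"
  have eq: "det_rows n (?r k) = det_rows n (\<lambda>i. unit_vector (if i < n then is ! i else k))" for k
    using assms by (intro det_rows_cong) auto
  have "insert m (set is) = {..n}"
    using assms by (intro card_subset_eq) (auto simp: distinct_card)
  show "det_rows n (?r m) \<noteq> 0"
    unfolding eq
  proof (rule det_rows_unit_vectors)
    show "inj_on (\<lambda>i. if i < n then is ! i else m) {..n}"
      using assms by (auto simp: inj_on_def nth_eq_iff_index_eq)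
    show "(\<lambda>i. if i < n then is ! i else m) ` {..n} \<subseteq> {..n}"
      using assms nth_mem by fastforce
  qed
  show "cross n (map unit_vector is) = (\<lambda>j. det_rows n (?r m) * unit_vector m j)"
  proof
    fix j
    have "det_rows n (?r j) = 0" if "j \<le> n" "j \<noteq> m"
    proof -
      have "j \<in> set is" using that \<open>insert m (set is) = {..n}\<close> by auto
      then obtain i where "i < n" "is ! i = j" using assms(2) by (auto simp: in_set_conv_nth)
      then show ?thesis using assms by (intro det_rows_equal_rows[of i n n]) auto
    qed
    then show "cross n (map unit_vector is) j = det_rows n (?r m) * unit_vector m j"
      using assms(4) by (auto simp: cross_def unit_vector_def)
  qed
qed

lemma cross_scale_first:
  assumes "length (x # xs) = n"
  shows "cross n ((\<lambda>j. a * x j) # xs) k = a * cross n (x # xs) k"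
  using cross_sum[of "x # xs" n 0 "\<lambda>_. a" "\<lambda>_. x" "{()}" k] assms by simp

lemma cross_scale_second:
  assumes "length (x # y # xs) = n"
  shows "cross n (x # (\<lambda>j. a * y j) # xs) k = a * cross n (x # y # xs) k"
  using cross_sum[of "x # y # xs" n 1 "\<lambda>_. a" "\<lambda>_. y" "{()}" k] assms by simp

text \<open>The letters are assigned so that each bracket misses exactly one unit vector. The first
  block is e_0, ..., e_(n-1) and yields a multiple of e_n; the second block omits e_(n-1) and yields
  a multiple of it; the outer bracket of e_n, e_(n-1), e_0, ..., e_(n-3) omits e_(n-2), the
  coordinate that is read off.\<close>

lemma noncomb_evaluation_nonzero:
  assumes "n \<ge> 2"
  defines "f \<equiv> \<lambda>x. if x \<le> n then x - 1 else if x < 2 * n then x - n - 1 else if x = 2 * n then n else x - 2 * n - 1"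
  shows "ev n f (noncomb_word [1..<n + 1] [n + 1..<2 * n + 1] [2 * n + 1..<3 * n - 1]) (n - 2) \<noteq> 0"
proof -
  have 1: "map f [1..<n + 1] = [0..<n]"
    by (rule nth_equalityI) (auto simp: f_def nth_append)
  have 2: "map f [n + 1..<2 * n + 1] = [0..<n - 1] @ [n]"
    using assms(1) by (intro nth_equalityI) (auto simp: f_def nth_append)
  have 3: "map f [2 * n + 1..<3 * n - 1] = [0..<n - 2]"
    using assms(1) by (intro nth_equalityI) (auto simp: f_def)
  obtain a where a: "a \<noteq> 0" "cross n (map unit_vector [0..<n]) = (\<lambda>j. a * unit_vector n j)"
    by (rule cross_unit_vectors[of "[0..<n]" n n]) auto
  obtain b where b: "b \<noteq> 0" "cross n (map unit_vector ([0..<n - 1] @ [n])) = (\<lambda>j. b * unit_vector (n - 1) j)"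
    by (rule cross_unit_vectors[of "[0..<n - 1] @ [n]" n "n - 1"]) (use assms(1) in auto)
  obtain d where d: "d \<noteq> 0" "cross n (map unit_vector (n # (n - 1) # [0..<n - 2])) = (\<lambda>j. d * unit_vector (n - 2) j)"
    by (rule cross_unit_vectors[of "n # (n - 1) # [0..<n - 2]" n "n - 2"]) (use assms(1) in auto)
  have ev_letters: "map (ev n f) (map Letter xs) = map unit_vector (map f xs)" for xs by simp
  have "ev n f (noncomb_word [1..<n + 1] [n + 1..<2 * n + 1] [2 * n + 1..<3 * n - 1]) (n - 2)
      = cross n ((\<lambda>j. a * unit_vector n j) # (\<lambda>j. b * unit_vector (n - 1) j) # map unit_vector [0..<n - 2]) (n - 2)"
    unfolding noncomb_word_def ev.simps list.map(2) ev_letters 1 2 3 a b ..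
  also have "\<dots> = a * (b * d)"
    using assms(1) fun_cong[OF d(2), of "n - 2"]
    by (subst cross_scale_first, simp, subst cross_scale_second, simp) (simp add: unit_vector_def)
  finally show ?thesis using a b d by simp
qed

context filippov
begin

lemma basis_adjacent:
  assumes "set (p @ u # w # q) \<subseteq> bwords n A" "length (p @ u # w # q) = n"
  shows "basis_vec (Bracket (p @ u # w # q)) + basis_vec (Bracket (p @ w # u # q)) \<in> J"
proof -
  let ?t = "transpose (length p) (Suc (length p))"
  have "?t permutes {..<n}" by (rule permutes_swap_id) (use assms(2) in auto)
  from basis_antisymmetry[OF assms(2,1) this]
  have "basis_vec (Bracket (p @ u # w # q)) - scale (of_int (sign ?t)) (basis_vec (Bracket (p @ w # u # q))) \<in> J"
    by (simp only: permute_list_adjacent)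
  moreover have "scale (of_int (sign ?t)) x = - x" for x :: "'x bword \<Rightarrow>\<^sub>0 complex"
    by (intro poly_mapping_eqI) (simp add: lookup_scale sign_swap_id)
  ultimately show ?thesis by simp
qed

end

text \<open>The relations below the outermost bracket lie in the ideal because it absorbs brackets,
  here once or twice in the first entry.\<close>

lemma word_functional_linear:
  fixes A :: "nat set"
  assumes A: "finite A" and n: "n \<ge> 2" and l: "linear_functional l"
    and zero: "\<And>x. x \<in> filippov_ideal n A \<Longrightarrow> l x = 0"
  shows "word_functional A n (\<lambda>w. l (basis_vec w))"
proof -
  interpret filippov n A using n by (intro filippov_nat) simp
  have add: "l (p + q) = l p + l q" for p q using l by (simp add: linear_functional_def)
  note diff = linear_functional_diff[OF l] and sum = linear_functional_sum[OF l]
  have first: "bracket (basis_vec w # map basis_vec r) = basis_vec (Bracket (w # r))"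
    for w :: "nat bword" and r using bracket_basis[of "w # r"] by simp
  have adj1: "basis_vec (Bracket (Bracket (p @ u # w # q) # r)) + basis_vec (Bracket (Bracket (p @ w # u # q) # r)) \<in> J"
    if "set (p @ u # w # q) \<subseteq> bwords n A" "length (p @ u # w # q) = n" "set r \<subseteq> bwords n A" "length r = n - 1"
    for p q r u w
    using bracket_ideal_first[OF basis_adjacent[OF that(1,2)] that(4,3)] n by (simp add: bracket_add first)
  show ?thesis
  proof
    fix p q r t u w
    assume 1: "set (p @ u # w # q) \<subseteq> bwords n A" "length (p @ u # w # q) = n"
    show "l (basis_vec (Bracket (p @ u # w # q))) = - l (basis_vec (Bracket (p @ w # u # q)))"
      using zero[OF basis_adjacent[OF 1]] by (simp add: add eq_neg_iff_add_eq_0)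
    assume 2: "set r \<subseteq> bwords n A" "length r = n - 1"
    show "l (basis_vec (Bracket (Bracket (p @ u # w # q) # r))) = - l (basis_vec (Bracket (Bracket (p @ w # u # q) # r)))"
      using zero[OF adj1[OF 1 2]] by (simp add: add eq_neg_iff_add_eq_0)
    assume 3: "set t \<subseteq> bwords n A" "length t = n - 1"
    have "basis_vec (Bracket (Bracket (Bracket (p @ u # w # q) # r) # t))
        + basis_vec (Bracket (Bracket (Bracket (p @ w # u # q) # r) # t)) \<in> J"
      using bracket_ideal_first[OF adj1[OF 1 2] 3(2,1)] n by (simp add: bracket_add first)
    from zero[OF this]
    show "l (basis_vec (Bracket (Bracket (Bracket (p @ u # w # q) # r) # t)))
        = - l (basis_vec (Bracket (Bracket (Bracket (p @ w # u # q) # r) # t)))"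
      by (simp add: add eq_neg_iff_add_eq_0)
  next
    fix xs ys zs
    assume 1: "set xs \<subseteq> bwords n A" "length xs = n" "set ys \<subseteq> bwords n A" "length ys = n - 1"
    have j: "basis_vec (Bracket (Bracket xs # ys)) - (\<Sum>i<n. basis_vec (Bracket (xs[i := Bracket (xs ! i # ys)]))) \<in> J"
      using 1 n by (intro basis_jacobi) auto
    from zero[OF this]
    show "l (basis_vec (Bracket (Bracket xs # ys))) = (\<Sum>i<n. l (basis_vec (Bracket (xs[i := Bracket (xs ! i # ys)]))))"
      by (simp add: diff sum)
    assume 2: "set zs \<subseteq> bwords n A" "length zs = n - 1"
    have "basis_vec (Bracket (Bracket (Bracket xs # ys) # zs))
        - (\<Sum>i<n. basis_vec (Bracket (Bracket (xs[i := Bracket (xs ! i # ys)]) # zs))) \<in> J"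
      using bracket_ideal_first[OF j 2(2,1)] n by (simp add: bracket_diff bracket_sum first)
    from zero[OF this]
    show "l (basis_vec (Bracket (Bracket (Bracket xs # ys) # zs)))
        = (\<Sum>i<n. l (basis_vec (Bracket (Bracket (xs[i := Bracket (xs ! i # ys)]) # zs))))"
      by (simp add: diff sum)
  qed (use A n in auto)
qed

section \<open>Uniqueness of highest weight functions\<close>

text \<open>The colour 0 outside of \<open>A\<close> makes a colouring determined by its values on
  \<open>A\<close> and the set finite.\<close>

definition colourings :: "nat set \<Rightarrow> nat \<Rightarrow> nat \<Rightarrow> nat \<Rightarrow> (nat \<Rightarrow> nat) set" where
  "colourings A a b d = {c. of_weight A a b d c \<and> (\<forall>x. x \<notin> A \<longrightarrow> c x = 0)}"

text \<open>As \<open>recolor A i j\<close> adds 1 to the weight of \<open>j\<close> and takes 1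
  from that of \<open>i\<close>, the moves with \<open>j\<close> < \<open>i\<close> are the raising
  operators of gl_3.\<close>

definition highest :: "nat set \<Rightarrow> ((nat \<Rightarrow> nat) \<Rightarrow> complex) \<Rightarrow> bool" where
  "highest A g \<longleftrightarrow> (\<forall>i j. j < i \<longrightarrow> i \<le> 2 \<longrightarrow> recolor A i j g = (\<lambda>_. 0))"

lemma of_weight_le_2: "finite A \<Longrightarrow> of_weight A a b d c \<Longrightarrow> x \<in> A \<Longrightarrow> c x \<le> 2"
proof -
  assume A: "finite A" "of_weight A a b d c" and x: "x \<in> A"
  note cl = class_lists_coloured(1)[OF A, unfolded coloured_lists_def]
  from cl x have "x \<in> set (class_list A c 0) \<or> x \<in> set (class_list A c 1) \<or> x \<in> set (class_list A c 2)"
    by (simp only: set_append) blast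
  then have "c x = 0 \<or> c x = 1 \<or> c x = 2" using cl by blast
  then show "c x \<le> 2" by linarith
qed

lemma finite_colourings: "finite A \<Longrightarrow> finite (colourings A a b d)"
proof -
  assume A: "finite A"
  have "colourings A a b d \<subseteq> {c. \<forall>x. (x \<in> A \<longrightarrow> c x \<in> {..2}) \<and> (x \<notin> A \<longrightarrow> c x = 0)}"
    using of_weight_le_2[OF A] by (auto simp: colourings_def)
  then show ?thesis using finite_set_of_finite_funs[OF A, of "{..2 :: nat}" 0] by (auto intro: finite_subset)
qed

lemma cnt_comp_permutes:
  assumes "\<sigma> permutes A"
  shows "cnt A (c \<circ> \<sigma>) j = cnt A c j"
proof -
  have "bij_betw \<sigma> {x\<in>A. (c \<circ> \<sigma>) x = j} {x\<in>A. c x = j}"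
    using permutes_in_image[OF assms] permutes_in_image[OF permutes_inv[OF assms]]
    by (intro bij_betw_byWitness[where f' = "inv_into UNIV \<sigma>"]) (auto simp: permutes_inverses[OF assms])
  then show ?thesis unfolding cnt_def by (rule bij_betw_same_card)
qed

lemma colourings_comp: "\<sigma> permutes A \<Longrightarrow> c \<in> colourings A a b d \<Longrightarrow> c \<circ> \<sigma> \<in> colourings A a b d"
  by (auto simp: colourings_def of_weight_def cnt_comp_permutes permutes_not_in)

lemma sum_colourings_comp:
  assumes "\<sigma> permutes A"
  shows "(\<Sum>c\<in>colourings A a b d. F (c \<circ> \<sigma>)) = (\<Sum>c\<in>colourings A a b d. F c)"
  by (rule sum.reindex_bij_witness[where i = "\<lambda>c. c \<circ> inv_into UNIV \<sigma>" and j = "\<lambda>c. c \<circ> \<sigma>"])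
    (auto simp: o_assoc[symmetric] permutes_inv_o[OF assms] intro!: colourings_comp permutes_inv assms)

lemma colourings_transitive:
  assumes A: "finite A" and c: "c \<in> colourings A a b d" "c' \<in> colourings A a b d"
  obtains \<sigma> where "\<sigma> permutes A" "c = c' \<circ> \<sigma>"
proof -
  have "image_mset c (mset_set A) = image_mset c' (mset_set A)"
  proof (rule multiset_eqI)
    fix j
    have "int (cnt A c j) = int (cnt A c' j)" using c by (simp add: colourings_def of_weight_def)
    then show "count (image_mset c (mset_set A)) j = count (image_mset c' (mset_set A)) j"
      using A by (simp add: count_image_mset_eq_card_vimage cnt_def)
  qed
  then obtain p where p: "p permutes A" "\<forall>x\<in>A. c x = c' (p x)"
    using image_mset_eq_implies_permutes[OF A] by blast
  have "c x = c' (p x)" for x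
    using p c by (cases "x \<in> A") (auto simp: colourings_def permutes_not_in[OF p(1)])
  then have "c = c' \<circ> p" by (simp add: fun_eq_iff)
  with p show ?thesis using that by blast
qed

lemma recolor_comp_permutes:
  assumes "\<sigma> permutes A"
  shows "recolor A i j (\<lambda>c. g (c \<circ> \<sigma>)) c = recolor A i j g (c \<circ> \<sigma>)"
  unfolding recolor_def
proof (rule sum.reindex_bij_witness[where i = \<sigma> and j = "inv_into UNIV \<sigma>"])
  note inv = permutes_inverses[OF assms]
  fix x assume x: "x \<in> {x\<in>A. c x = j}"
  show "\<sigma> (inv_into UNIV \<sigma> x) = x" by (simp add: inv)
  show "inv_into UNIV \<sigma> x \<in> {x\<in>A. (c \<circ> \<sigma>) x = j}"
    using x permutes_in_image[OF permutes_inv[OF assms]] by (simp add: inv)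
  have "(c \<circ> \<sigma>)(inv_into UNIV \<sigma> x := i) = (c(x := i)) \<circ> \<sigma>"
    using inv by (auto simp: fun_eq_iff)
  then show "g ((c \<circ> \<sigma>)(inv_into UNIV \<sigma> x := i)) = g ((c(x := i)) \<circ> \<sigma>)" by simp
next
  fix y assume "y \<in> {x\<in>A. (c \<circ> \<sigma>) x = j}"
  then show "inv_into UNIV \<sigma> (\<sigma> y) = y" "\<sigma> y \<in> {x\<in>A. c x = j}"
    using permutes_in_image[OF assms] by (auto simp: permutes_inverses[OF assms])
qed

lemma highest_comp: "\<sigma> permutes A \<Longrightarrow> highest A g \<Longrightarrow> highest A (\<lambda>c. g (c \<circ> \<sigma>))"
  by (simp add: highest_def recolor_comp_permutes fun_eq_iff)

lemma highest_sum: "(\<And>s. s \<in> S \<Longrightarrow> highest A (g s)) \<Longrightarrow> highest A (\<lambda>c. \<Sum>s\<in>S. a s * g s c)"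
proof -
  assume g: "\<And>s. s \<in> S \<Longrightarrow> highest A (g s)"
  have "recolor A i j (\<lambda>c. \<Sum>s\<in>S. a s * g s c) c = (\<Sum>s\<in>S. a s * recolor A i j (g s) c)" for i j c
    unfolding recolor_def sum_distrib_left by (rule sum.swap)
  then show ?thesis using g by (simp add: highest_def fun_eq_iff)
qed

definition colour_stabilizer :: "nat set \<Rightarrow> (nat \<Rightarrow> nat) \<Rightarrow> (nat \<Rightarrow> nat) set" where
  "colour_stabilizer A c = {\<sigma>. \<sigma> permutes A \<and> c \<circ> \<sigma> = c}"

text \<open>
  Induction on the number of letters coloured differently in \<open>c\<close> and \<open>c0\<close>: for a letter \<open>x\<close> whose
  colour in \<open>c\<close> is larger, the highest weight equation at \<open>c(x := c0 x)\<close> expresses a positive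
  multiple of \<open>h c\<close> by values at colourings closer to \<open>c0\<close>.\<close>

lemma stable_highest_unique:
  assumes A: "finite A" and c0: "c0 \<in> colourings A a b d" and h: "highest A h"
    and inv: "\<And>c \<sigma>. \<sigma> \<in> colour_stabilizer A c0 \<Longrightarrow> h (c \<circ> \<sigma>) = h c"
    and zero: "h c0 = 0" and c: "c \<in> colourings A a b d"
  shows "h c = 0"
  using c
proof (induction "card {x\<in>A. c x \<noteq> c0 x}" arbitrary: c rule: less_induct)
  case less
  show ?case
  proof (cases "c = c0")
    case False
    obtain \<sigma> where \<sigma>: "\<sigma> permutes A" "c = c0 \<circ> \<sigma>" using colourings_transitive[OF A less.prems c0] by blast
    \<comment> \<open>\<open>c\<close> and \<open>c0\<close> have the same content, so their colours
      have the same sum and \<open>c\<close> cannot lie below \<open>c0\<close> everywhere.\<close>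
    have sums: "(\<Sum>x\<in>A. c x) = (\<Sum>x\<in>A. c0 x)"
      using sum.permute[OF \<sigma>(1), of c0] by (simp add: \<sigma>(2))
    have "\<exists>x\<in>A. c x > c0 x"
    proof (rule ccontr)
      assume "\<not> ?thesis"
      then have le: "\<forall>x\<in>A. c x \<le> c0 x" by auto
      moreover from False obtain x where "c x \<noteq> c0 x" by (auto simp: fun_eq_iff)
      with less.prems c0 have "x \<in> A" by (cases "x \<in> A") (auto simp: colourings_def)
      with le \<open>c x \<noteq> c0 x\<close> have "\<exists>x\<in>A. c x < c0 x" by (auto intro!: bexI[of _ x] simp: order.strict_iff_order)
      ultimately have "(\<Sum>x\<in>A. c x) < (\<Sum>x\<in>A. c0 x)" using A by (intro sum_strict_mono_ex1) auto
      with sums show False by simp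
    qed
    then obtain x where x: "x \<in> A" "c0 x < c x" by blast
    define i j where "i = c x" and "j = c0 x"
    define c' where "c' = c(x := j)"
    let ?Y = "{y\<in>A. c' y = j}"
    have "i \<le> 2" using of_weight_le_2[OF A _ x(1)] less.prems by (auto simp: i_def colourings_def)
    with h x have "recolor A i j h c' = 0" by (simp add: highest_def i_def j_def fun_eq_iff)
    then have *: "(\<Sum>y\<in>?Y. h (c'(y := i))) = 0" by (simp add: recolor_def)
    \<comment> \<open>Letters of \<open>c0\<close>-colour \<open>j\<close> can be exchanged with
      \<open>x\<close> inside the stabilizer of \<open>c0\<close>, so each of them contributes
      \<open>h c\<close> once more.\<close>
    have same: "h (c'(y := i)) = h c" if "y \<in> ?Y" "c0 y = j" for y
    proof (cases "y = x")
      case True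
      then show ?thesis by (simp add: c'_def i_def)
    next
      case False
      have "transpose x y \<in> colour_stabilizer A c0"
        using that x permutes_swap_id[OF x(1), of y]
        by (auto simp: colour_stabilizer_def fun_eq_iff transpose_def j_def)
      moreover have "c'(y := i) = c \<circ> transpose x y"
        using False that by (auto simp: c'_def i_def j_def fun_eq_iff transpose_def)
      ultimately show ?thesis using inv by simp
    qed
    \<comment> \<open>Such a letter is coloured wrongly already in \<open>c\<close>, whereas
      \<open>x\<close> becomes right: the new colouring is closer to \<open>c0\<close>.\<close>
    have other: "h (c'(y := i)) = 0" if y: "y \<in> ?Y" "c0 y \<noteq> j" for y
    proof (rule less.hyps)
      have "y \<noteq> x" using that by (auto simp: j_def)
      then have cy: "c y = j" using y by (simp add: c'_def)
      have "c'(y := i) = c \<circ> transpose x y"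
        using \<open>y \<noteq> x\<close> cy by (auto simp: c'_def i_def j_def fun_eq_iff transpose_def)
      then show "c'(y := i) \<in> colourings A a b d"
        using colourings_comp[OF permutes_swap_id less.prems] x y by simp
      have "(c'(y := i)) x = c0 x" using \<open>y \<noteq> x\<close> by (simp add: c'_def j_def)
      moreover have "c z \<noteq> c0 z" if "(c'(y := i)) z \<noteq> c0 z" for z
        using that y(2) cy \<open>(c'(y := i)) x = c0 x\<close> by (cases "z = y"; cases "z = x") (simp_all add: c'_def)
      ultimately have "{z\<in>A. (c'(y := i)) z \<noteq> c0 z} \<subseteq> {z\<in>A. c z \<noteq> c0 z}"
        "x \<notin> {z\<in>A. (c'(y := i)) z \<noteq> c0 z}" "x \<in> {z\<in>A. c z \<noteq> c0 z}"
        using x by (blast, simp, simp)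
      then have "{z\<in>A. (c'(y := i)) z \<noteq> c0 z} \<subset> {z\<in>A. c z \<noteq> c0 z}" by blast
      then show "card {z\<in>A. (c'(y := i)) z \<noteq> c0 z} < card {z\<in>A. c z \<noteq> c0 z}"
        using A by (intro psubset_card_mono) auto
    qed
    have "(\<Sum>y\<in>?Y. h (c'(y := i))) = (\<Sum>y\<in>?Y. if c0 y = j then h c else 0)"
      by (rule sum.cong) (auto simp: same other)
    also have "\<dots> = of_nat (card {y\<in>?Y. c0 y = j}) * h c"
      using A by (simp add: sum.If_cases Int_def)
    finally have "of_nat (card {y\<in>?Y. c0 y = j}) * h c = 0" using * by simp
    moreover have "card {y\<in>?Y. c0 y = j} \<noteq> 0"
    proof -
      have "x \<in> {y\<in>?Y. c0 y = j}" using x by (simp add: c'_def j_def)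
      moreover have "finite {y\<in>?Y. c0 y = j}" using A by simp
      ultimately show ?thesis using card_0_eq[of "{y\<in>?Y. c0 y = j}"] by blast
    qed
    ultimately show ?thesis by simp
  qed (use zero in simp)
qed

section \<open>Averaging over stabilizers and a kernel that reproduces highest weight
  functions\<close>

lemma sum_real_squares_zero:
  fixes f :: "'t \<Rightarrow> complex"
  assumes "finite S" "\<And>t. t \<in> S \<Longrightarrow> f t \<in> \<real>" "(\<Sum>t\<in>S. f t * f t) = 0" "t \<in> S"
  shows "f t = 0"
proof -
  have "(\<Sum>t\<in>S. f t * f t) = of_real (\<Sum>t\<in>S. Re (f t) * Re (f t))"
    unfolding of_real_sum using assms(2) by (intro sum.cong) (auto simp: Reals_def)
  then have "(\<Sum>t\<in>S. Re (f t) * Re (f t)) = 0" using assms(3) by (metis of_real_eq_0_iff)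
  then have "Re (f t) = 0" using assms(1,4) by (simp add: sum_nonneg_eq_0_iff)
  then show ?thesis using assms(2)[OF assms(4)] by (auto simp: Reals_def)
qed

text \<open>The abstract form of the coefficients of signed polytabloids, with \<open>t\<close>
  running over the tabloids. Real values make a sum of squares positive, and the sign in the
  equivariance cancels in a product of two values.\<close>

locale invariant_kernel =
  fixes A :: "nat set" and a b d :: nat and E :: "(nat \<Rightarrow> nat) \<Rightarrow> 't \<Rightarrow> complex" and S :: "'t set"
  assumes A: "finite A" and S: "finite S"
    and E_real: "E c t \<in> \<real>"
    and E_highest: "highest A (\<lambda>c. E c t)"
    and E_equivariant: "\<sigma> permutes A \<Longrightarrow> \<exists>\<tau>. bij_betw \<tau> S S \<and> (\<forall>c. \<forall>t\<in>S. E (c \<circ> \<sigma>) (\<tau> t) = of_int (sign \<sigma>) * E c t)"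
    and E_nonzero: "c \<in> colourings A a b d \<Longrightarrow> \<exists>t\<in>S. E c t \<noteq> 0"
begin

abbreviation "W \<equiv> colourings A a b d"

text \<open>The Gram matrix of the vectors \<open>E c\<close>. Its row at \<open>c0\<close> is the
  stable highest weight function with which all averages are compared.\<close>

definition ker :: "(nat \<Rightarrow> nat) \<Rightarrow> (nat \<Rightarrow> nat) \<Rightarrow> complex" where
  "ker c0 c = (\<Sum>t\<in>S. E c0 t * E c t)"

lemma ker_real: "ker c0 c \<in> \<real>"
  unfolding ker_def using E_real by (intro sum_in_Reals) auto

lemma ker_equivariant:
  assumes "\<sigma> permutes A"
  shows "ker (c0 \<circ> \<sigma>) (c \<circ> \<sigma>) = ker c0 c"
proof -
  obtain \<tau> where \<tau>: "bij_betw \<tau> S S" "\<And>c t. t \<in> S \<Longrightarrow> E (c \<circ> \<sigma>) (\<tau> t) = of_int (sign \<sigma>) * E c t"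
    using E_equivariant[OF assms] by blast
  have "ker (c0 \<circ> \<sigma>) (c \<circ> \<sigma>) = (\<Sum>t\<in>S. E (c0 \<circ> \<sigma>) (\<tau> t) * E (c \<circ> \<sigma>) (\<tau> t))"
    unfolding ker_def by (rule sum.reindex_bij_betw[OF \<tau>(1), symmetric])
  also have "\<dots> = (\<Sum>t\<in>S. (of_int (sign \<sigma>) * of_int (sign \<sigma>)) * (E c0 t * E c t))"
    using \<tau>(2) by (intro sum.cong) (auto simp: mult_ac)
  also have "\<dots> = ker c0 c" by (simp add: ker_def of_int_mult[symmetric] del: of_int_mult)
  finally show ?thesis .
qed

lemma ker_stable: "\<sigma> \<in> colour_stabilizer A c0 \<Longrightarrow> ker c0 (c \<circ> \<sigma>) = ker c0 c"
  using ker_equivariant[of \<sigma> c0 c] by (simp add: colour_stabilizer_def)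

lemma ker_diag: "c \<in> W \<Longrightarrow> ker c c \<noteq> 0"
  using E_nonzero[of c] sum_real_squares_zero[OF S, of "E c"] E_real unfolding ker_def by blast

lemma highest_ker: "highest A (ker c0)"
  unfolding ker_def[abs_def] by (rule highest_sum) (rule E_highest)

definition average :: "(nat \<Rightarrow> nat) \<Rightarrow> ((nat \<Rightarrow> nat) \<Rightarrow> complex) \<Rightarrow> (nat \<Rightarrow> nat) \<Rightarrow> complex" where
  "average c0 g c = (\<Sum>\<sigma>\<in>colour_stabilizer A c0. g (c \<circ> \<sigma>))"

lemma finite_stabilizer: "finite (colour_stabilizer A c0)"
  unfolding colour_stabilizer_def using finite_permutations[OF A] by (rule rev_finite_subset) auto

lemma card_stabilizer: "card (colour_stabilizer A c0) \<noteq> 0"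
proof -
  have "id \<in> colour_stabilizer A c0" by (simp add: colour_stabilizer_def permutes_id)
  then show ?thesis using finite_stabilizer by auto
qed

text \<open>Both sides are, as functions of \<open>c\<close>, highest weight functions invariant
  under the stabilizer of \<open>c0\<close>, and they agree at \<open>c0\<close>;
  \<open>stable_highest_unique\<close> applies to their difference.\<close>

lemma average_eq_ker:
  assumes g: "highest A g" and c: "c0 \<in> W" "c \<in> W"
  shows "average c0 g c * ker c0 c0 = of_nat (card (colour_stabilizer A c0)) * g c0 * ker c0 c"
proof -
  let ?G = "colour_stabilizer A c0"
  let ?h = "\<lambda>c. ker c0 c0 * average c0 g c - of_nat (card ?G) * g c0 * ker c0 c"
  have "?h c = 0"
  proof (rule stable_highest_unique[OF A c(1) _ _ _ c(2), where h = ?h])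
    have "highest A (average c0 g)"
      using highest_sum[of ?G A "\<lambda>\<sigma> c. g (c \<circ> \<sigma>)" "\<lambda>_. 1"] highest_comp[OF _ g]
      by (simp add: average_def[abs_def] colour_stabilizer_def)
    then show "highest A ?h"
      using highest_ker[of c0] by (simp add: highest_def recolor_diff recolor_mult)
    show "?h (c \<circ> \<tau>) = ?h c" if \<tau>: "\<tau> \<in> ?G" for c \<tau>
    proof -
      have \<tau>': "\<tau> permutes A" "c0 \<circ> \<tau> = c0" using \<tau> by (auto simp: colour_stabilizer_def)
      then have inv: "c0 \<circ> inv_into UNIV \<tau> = c0"
        by (metis comp_assoc comp_id permutes_inv_o(1))
      have "average c0 g (c \<circ> \<tau>) = average c0 g c"
        unfolding average_def
        by (rule sum.reindex_bij_witness[where i = "\<lambda>\<sigma>. inv_into UNIV \<tau> \<circ> \<sigma>" and j = "\<lambda>\<sigma>. \<tau> \<circ> \<sigma>"])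
          (use \<tau>' inv in \<open>auto simp: colour_stabilizer_def o_assoc permutes_inv_o permutes_inv intro: permutes_compose\<close>)
      then show ?thesis using ker_stable[OF \<tau>] by simp
    qed
    have "average c0 g c0 = of_nat (card ?G) * g c0"
      unfolding average_def by (simp add: colour_stabilizer_def)
    then show "?h c0 = 0" by simp
  qed
  then show ?thesis by (simp add: mult.commute)
qed

text \<open>A reproducing property: pairing with \<open>ker c0\<close> is evaluation at
  \<open>c0\<close> up to a factor independent of \<open>g\<close>. The invariance of
  \<open>ker c0\<close> allows \<open>g\<close> to be replaced by its average, which is a multiple
  of \<open>ker c0\<close>; the order of the stabilizer cancels.\<close>

lemma highest_inner_ker:
  assumes g: "highest A g" and c0: "c0 \<in> W"
  shows "(\<Sum>c\<in>W. g c * ker c0 c) * ker c0 c0 = g c0 * (\<Sum>c\<in>W. ker c0 c * ker c0 c)"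
proof -
  let ?G = "colour_stabilizer A c0"
  have "(\<Sum>c\<in>W. average c0 g c * ker c0 c) = (\<Sum>\<sigma>\<in>?G. \<Sum>c\<in>W. g (c \<circ> \<sigma>) * ker c0 c)"
    unfolding average_def sum_distrib_right by (rule sum.swap)
  also have "\<dots> = (\<Sum>\<sigma>\<in>?G. \<Sum>c\<in>W. g (c \<circ> \<sigma>) * ker c0 (c \<circ> \<sigma>))"
    by (intro sum.cong refl) (simp add: ker_stable)
  also have "\<dots> = (\<Sum>\<sigma>\<in>?G. \<Sum>c\<in>W. g c * ker c0 c)"
    by (intro sum.cong refl sum_colourings_comp) (simp add: colour_stabilizer_def)
  finally have 1: "(\<Sum>c\<in>W. average c0 g c * ker c0 c) = of_nat (card ?G) * (\<Sum>c\<in>W. g c * ker c0 c)" by simp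
  have "(\<Sum>c\<in>W. average c0 g c * ker c0 c) * ker c0 c0
      = (\<Sum>c\<in>W. (average c0 g c * ker c0 c0) * ker c0 c)"
    by (subst sum_distrib_right) (simp add: mult_ac)
  also have "\<dots> = (\<Sum>c\<in>W. of_nat (card ?G) * g c0 * ker c0 c * ker c0 c)"
    by (intro sum.cong refl) (simp add: average_eq_ker[OF g c0])
  also have "\<dots> = of_nat (card ?G) * (g c0 * (\<Sum>c\<in>W. ker c0 c * ker c0 c))"
    by (simp add: sum_distrib_left mult_ac)
  finally show ?thesis using card_stabilizer[of c0] unfolding 1 by (simp add: mult.assoc)
qed

lemma ker_norms_constant:
  assumes "c \<in> W" "c' \<in> W"
  shows "ker c c = ker c' c'" "(\<Sum>x\<in>W. ker c x * ker c x) = (\<Sum>x\<in>W. ker c' x * ker c' x)"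
proof -
  obtain \<sigma> where \<sigma>: "\<sigma> permutes A" "c = c' \<circ> \<sigma>" using colourings_transitive[OF A assms] by blast
  show "ker c c = ker c' c'" unfolding \<sigma>(2) by (rule ker_equivariant[OF \<sigma>(1)])
  have "(\<Sum>x\<in>W. ker c x * ker c x) = (\<Sum>x\<in>W. ker c (x \<circ> \<sigma>) * ker c (x \<circ> \<sigma>))"
    by (rule sum_colourings_comp[OF \<sigma>(1), symmetric])
  then show "(\<Sum>x\<in>W. ker c x * ker c x) = (\<Sum>x\<in>W. ker c' x * ker c' x)"
    unfolding \<sigma>(2) by (simp add: ker_equivariant[OF \<sigma>(1)])
qed

text \<open>By \<open>highest_inner_ker\<close> a highest weight function is a combination of the functions \<open>E _ t\<close>.\<close>

theorem orthogonal_highest: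
  assumes x: "\<And>t. t \<in> S \<Longrightarrow> (\<Sum>c\<in>W. x c * E c t) = 0" and g: "highest A g"
  shows "(\<Sum>c\<in>W. x c * g c) = 0"
proof (cases "W = {}")
  case False
  then obtain c1 where c1: "c1 \<in> W" by blast
  let ?q = "\<Sum>c\<in>W. ker c1 c * ker c1 c"
  have finW: "finite W" using A by (rule finite_colourings)
  have "?q \<noteq> 0"
    using sum_real_squares_zero[OF finW, of "ker c1" c1] ker_real ker_diag[OF c1] c1 by blast
  have "(\<Sum>c0\<in>W. x c0 * ker c0 c) = 0" for c
  proof -
    have "(\<Sum>c0\<in>W. x c0 * ker c0 c) = (\<Sum>t\<in>S. (\<Sum>c0\<in>W. x c0 * E c0 t) * E c t)"
      unfolding ker_def sum_distrib_left sum_distrib_right mult.assoc by (rule sum.swap)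
    then show ?thesis using x by simp
  qed
  then have "0 = (\<Sum>c\<in>W. g c * (\<Sum>c0\<in>W. x c0 * ker c0 c)) * ker c1 c1" by simp
  also have "\<dots> = (\<Sum>c0\<in>W. x c0 * ((\<Sum>c\<in>W. g c * ker c0 c) * ker c1 c1))"
    unfolding sum_distrib_left sum_distrib_right by (subst sum.swap) (simp add: mult_ac)
  also have "\<dots> = (\<Sum>c0\<in>W. x c0 * (g c0 * ?q))"
    using highest_inner_ker[OF g] ker_norms_constant[OF c1] by (intro sum.cong) auto
  also have "\<dots> = (\<Sum>c0\<in>W. x c0 * g c0) * ?q"
    by (simp add: sum_distrib_right mult.assoc)
  finally show ?thesis using \<open>?q \<noteq> 0\<close> by simp
qed simp

text \<open>As \<open>g c1\<close> is nonzero, averages of translates of \<open>g\<close> give every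
  \<open>ker c0\<close> up to a nonzero factor, so \<open>x\<close> is annihilated by the Gram
  matrix.\<close>

theorem orthogonal_translates:
  assumes g: "highest A g" and c1: "c1 \<in> W" "g c1 \<noteq> 0"
    and x: "\<And>\<sigma>. \<sigma> permutes A \<Longrightarrow> (\<Sum>c\<in>W. x c * g (c \<circ> \<sigma>)) = 0" and t: "t \<in> S"
  shows "(\<Sum>c\<in>W. x c * E c t) = 0"
proof -
  let ?G = "colour_stabilizer A c1"
  have ortho: "(\<Sum>c\<in>W. x c * ker c0 c) = 0" if c0: "c0 \<in> W" for c0
  proof -
    obtain \<sigma> where \<sigma>: "\<sigma> permutes A" "c0 = c1 \<circ> \<sigma>" using colourings_transitive[OF A c0 c1(1)] by blast
    let ?s = "inv_into UNIV \<sigma>"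
    have s: "?s permutes A" using \<sigma>(1) by (rule permutes_inv)
    have ker: "ker c0 c = ker c1 (c \<circ> ?s)" for c
      using ker_equivariant[OF \<sigma>(1), of c1 "c \<circ> ?s"] \<sigma>
      by (simp add: o_assoc[symmetric] permutes_inv_o)
    have "0 = (\<Sum>\<tau>\<in>?G. \<Sum>c\<in>W. x c * g (c \<circ> (?s \<circ> \<tau>)))"
      using x permutes_compose[OF _ s] by (simp add: colour_stabilizer_def)
    also have "\<dots> = (\<Sum>c\<in>W. x c * average c1 g (c \<circ> ?s))"
      unfolding average_def sum_distrib_left o_assoc by (rule sum.swap)
    finally have "0 = (\<Sum>c\<in>W. x c * (average c1 g (c \<circ> ?s) * ker c1 c1))"
      by (simp add: sum_distrib_right[symmetric] mult.assoc[symmetric])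
    also have "\<dots> = (\<Sum>c\<in>W. x c * (of_nat (card ?G) * g c1 * ker c0 c))"
      using average_eq_ker[OF g c1(1)] colourings_comp[OF s] by (intro sum.cong refl) (simp add: ker)
    also have "\<dots> = of_nat (card ?G) * g c1 * (\<Sum>c\<in>W. x c * ker c0 c)"
      by (simp add: sum_distrib_left mult_ac)
    finally show ?thesis using card_stabilizer[of c1] c1(2) by simp
  qed
  let ?v = "\<lambda>t. \<Sum>c\<in>W. x c * E c t"
  \<comment> \<open>The Hermitian form of the Gram matrix at \<open>x\<close> is the squared norm of
    the vector \<open>?v\<close>. The coefficients \<open>x\<close> are complex while
    \<open>E\<close> is real, hence the conjugate on one side only.\<close>
  have "0 = (\<Sum>c0\<in>W. cnj (x c0) * (\<Sum>c\<in>W. x c * ker c0 c))" using ortho by simp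
  also have "\<dots> = (\<Sum>c0\<in>W. \<Sum>t\<in>S. (cnj (x c0) * E c0 t) * ?v t)"
  proof (intro sum.cong refl)
    fix c0
    have "(\<Sum>c\<in>W. x c * ker c0 c) = (\<Sum>t\<in>S. E c0 t * ?v t)"
      unfolding ker_def sum_distrib_left by (subst sum.swap) (simp add: mult_ac)
    then show "cnj (x c0) * (\<Sum>c\<in>W. x c * ker c0 c) = (\<Sum>t\<in>S. (cnj (x c0) * E c0 t) * ?v t)"
      by (simp add: sum_distrib_left mult.assoc)
  qed
  also have "\<dots> = (\<Sum>t\<in>S. cnj (?v t) * ?v t)"
    using E_real by (subst sum.swap) (simp add: sum_distrib_right[symmetric] Reals_cnj_iff)
  also have "\<dots> = of_real (\<Sum>t\<in>S. (cmod (?v t))\<^sup>2)"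
    unfolding of_real_sum by (intro sum.cong refl) (simp only: complex_norm_square mult.commute)
  finally have "(\<Sum>t\<in>S. (cmod (?v t))\<^sup>2) = 0" by (metis of_real_eq_0_iff)
  then show ?thesis using S t by (simp add: sum_nonneg_eq_0_iff)
qed

end

section \<open>Polytabloids and colourings\<close>

text \<open>An entry of a tableau lies in exactly one column, which \<open>LEAST\<close> names; the
  value 0 elsewhere agrees with \<open>colourings\<close>.\<close>

definition colouring_of :: "nat list list \<Rightarrow> nat \<Rightarrow> nat" where
  "colouring_of t x = (if x \<in> set (concat t) then (LEAST j. x \<in> column t j) else 0)"

lemma entry_in_concat: "r \<in> set t \<Longrightarrow> j < length r \<Longrightarrow> r ! j \<in> set (concat t)"
  using nth_mem[of j r] by (simp only: set_concat) blast

lemma entry_unique: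
  assumes "distinct (concat t)" "r \<in> set t" "r' \<in> set t" "j < length r" "j' < length r'" "r ! j = r' ! j'"
  shows "r = r'" "j = j'"
proof -
  have "r ! j \<in> set r \<inter> set r'" using nth_mem[OF assms(4)] nth_mem[OF assms(5)] assms(6) by simp
  then show "r = r'" using assms(1-3) by (auto simp: distinct_concat_iff)
  with assms show "j = j'" by (auto simp: distinct_concat_iff nth_eq_iff_index_eq)
qed

lemma tableau_distinct: "t \<in> tableaux \<mu> \<Longrightarrow> distinct (concat t)"
  and tableau_set: "t \<in> tableaux \<mu> \<Longrightarrow> set (concat t) = {1..sum_list \<mu>}"
  and tableau_shape: "t \<in> tableaux \<mu> \<Longrightarrow> map length t = \<mu>"
  by (simp_all add: tableaux_def)

lemma entry_in_range: "t \<in> tableaux \<mu> \<Longrightarrow> r \<in> set t \<Longrightarrow> j < length r \<Longrightarrow> r ! j \<in> {1..sum_list \<mu>}"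
  using entry_in_concat[of r t j] by (simp only: tableau_set)

lemma colouring_of_nth:
  assumes t: "t \<in> tableaux \<mu>" and r: "r \<in> set t" "j < length r"
  shows "colouring_of t (r ! j) = j"
proof -
  have "r ! j \<in> set (concat t)" using r by (rule entry_in_concat)
  moreover have "r ! j \<in> column t j' \<longleftrightarrow> j' = j" for j'
    using entry_unique(2)[OF tableau_distinct[OF t] r(1) _ r(2)] r by (auto simp: column_def) 
  moreover have "(LEAST j'. j' = j) = j" by (rule Least_equality) auto
  ultimately show ?thesis by (simp add: colouring_of_def)
qed

lemma tableau_entry:
  assumes "t \<in> tableaux \<mu>" "x \<in> {1..sum_list \<mu>}"
  obtains r where "r \<in> set t" "colouring_of t x < length r" "x = r ! colouring_of t x"
proof -
  have "x \<in> set (concat t)" using tableau_set[OF assms(1)] assms(2) by simp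
  then obtain r where r: "r \<in> set t" "x \<in> set r" by auto
  then obtain j where "j < length r" "x = r ! j" by (auto simp: in_set_conv_nth)
  with r that colouring_of_nth[OF assms(1) r(1)] show ?thesis by metis
qed

lemma colouring_of_outside: "t \<in> tableaux \<mu> \<Longrightarrow> x \<notin> {1..sum_list \<mu>} \<Longrightarrow> colouring_of t x = 0"
  unfolding colouring_of_def by (simp only: tableau_set if_False)

lemma column_colouring:
  assumes "t \<in> tableaux \<mu>"
  shows "column t j = {x \<in> {1..sum_list \<mu>}. colouring_of t x = j}"
proof
  show "column t j \<subseteq> {x \<in> {1..sum_list \<mu>}. colouring_of t x = j}"
  proof
    fix x assume "x \<in> column t j"
    then obtain r where r: "r \<in> set t" "j < length r" "x = r ! j" by (auto simp: column_def)
    then show "x \<in> {x \<in> {1..sum_list \<mu>}. colouring_of t x = j}"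
      using entry_in_range[OF assms r(1,2)] colouring_of_nth[OF assms r(1,2)] by simp
  qed
  show "{x \<in> {1..sum_list \<mu>}. colouring_of t x = j} \<subseteq> column t j"
  proof
    fix x assume x: "x \<in> {x \<in> {1..sum_list \<mu>}. colouring_of t x = j}"
    then obtain r where "r \<in> set t" "colouring_of t x < length r" "x = r ! colouring_of t x"
      using tableau_entry[OF assms] by blast
    then show "x \<in> column t j" using x by (auto simp: column_def)
  qed
qed

lemma finite_tableaux: "finite (tableaux \<mu>)"
proof -
  let ?A = "{1..sum_list \<mu>}"
  let ?R = "{r. set r \<subseteq> ?A \<and> length r \<le> sum_list \<mu>}"
  have "t \<in> {t. set t \<subseteq> ?R \<and> length t = length \<mu>}" if t: "t \<in> tableaux \<mu>" for t
  proof -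
    have "length r \<le> sum_list \<mu>" if "r \<in> set t" for r
      using that tableau_shape[OF t] by (auto intro!: member_le_sum_list)
    moreover have "set r \<subseteq> ?A" if "r \<in> set t" for r using that tableau_set[OF t] by auto
    moreover have "length t = length \<mu>" using tableau_shape[OF t] by auto
    ultimately show ?thesis by auto
  qed
  then show ?thesis
    using finite_lists_length_eq[OF finite_lists_length_le[of ?A "sum_list \<mu>"], of "length \<mu>"]
    by (meson finite_atLeastAtMost finite_subset subsetI)
qed

lemma map_tableau:
  assumes "t \<in> tableaux \<mu>" "\<sigma> permutes {1..sum_list \<mu>}"
  shows "map (map \<sigma>) t \<in> tableaux \<mu>" "colouring_of (map (map \<sigma>) t) = colouring_of t \<circ> inv_into UNIV \<sigma>"
    "letter_sign (concat (map (map \<sigma>) t)) = of_int (sign \<sigma>) * letter_sign (concat t)"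
    "tabloid (map (map \<sigma>) t) = map ((`) \<sigma>) (tabloid t)"
proof -
  have c: "concat (map (map \<sigma>) t) = map \<sigma> (concat t)" by (simp add: map_concat)
  show s: "map (map \<sigma>) t \<in> tableaux \<mu>"
    using assms(1) permutes_image[OF assms(2)] permutes_inj_on[OF assms(2)]
    unfolding tableaux_def mem_Collect_eq c by (simp add: distinct_map o_def)
  show "letter_sign (concat (map (map \<sigma>) t)) = of_int (sign \<sigma>) * letter_sign (concat t)"
    unfolding c using tableau_distinct[OF assms(1)] tableau_set[OF assms(1)]
    by (intro letter_sign_map[OF assms(2)]) auto
  show "tabloid (map (map \<sigma>) t) = map ((`) \<sigma>) (tabloid t)" by (simp add: tabloid_def)
  show "colouring_of (map (map \<sigma>) t) = colouring_of t \<circ> inv_into UNIV \<sigma>"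
  proof
    fix x
    let ?y = "inv_into UNIV \<sigma> x"
    have x: "x = \<sigma> ?y" by (simp add: permutes_inverses[OF assms(2)])
    show "colouring_of (map (map \<sigma>) t) x = (colouring_of t \<circ> inv_into UNIV \<sigma>) x"
    proof (cases "x \<in> {1..sum_list \<mu>}")
      case True
      then have "?y \<in> {1..sum_list \<mu>}" using permutes_in_image[OF permutes_inv[OF assms(2)]] by simp
      then obtain r where r: "r \<in> set t" "colouring_of t ?y < length r" "?y = r ! colouring_of t ?y"
        using tableau_entry[OF assms(1)] by blast
      have "x = map \<sigma> r ! colouring_of t ?y" using x r by simp
      then show ?thesis
        using colouring_of_nth[OF s, of "map \<sigma> r" "colouring_of t ?y"] r by simp
    next
      case False
      then have "?y \<notin> {1..sum_list \<mu>}" using permutes_in_image[OF permutes_inv[OF assms(2)]] by simp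
      then show ?thesis using False colouring_of_outside[OF s] colouring_of_outside[OF assms(1)] by simp
    qed
  qed
qed

text \<open>The tabloid gives the rows as sets, the colouring gives the place of each letter in its
  row.\<close>

lemma tableau_unique:
  assumes s: "s \<in> tableaux \<mu>" and t: "t \<in> tableaux \<mu>"
    and eq: "colouring_of s = colouring_of t" "tabloid s = tabloid t"
  shows "s = t"
proof (rule nth_equalityI)
  show len: "length s = length t" using tableau_shape[OF s] tableau_shape[OF t] map_eq_imp_length_eq by metis
  fix i assume i: "i < length s"
  show "s ! i = t ! i"
  proof (rule nth_equalityI)
    show "length (s ! i) = length (t ! i)"
      using i len tableau_shape[OF s] tableau_shape[OF t] by (metis nth_map)
    fix j assume j: "j < length (s ! i)"
    have "set (s ! i) = set (t ! i)" using eq(2) i len unfolding tabloid_def by (metis nth_map)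
    then have "s ! i ! j \<in> set (t ! i)" using j by (metis nth_mem)
    then obtain j' where j': "j' < length (t ! i)" "t ! i ! j' = s ! i ! j" by (auto simp: in_set_conv_nth)
    have "j' = colouring_of t (t ! i ! j')" using colouring_of_nth[OF t _ j'(1)] i len by simp
    also have "\<dots> = j" using colouring_of_nth[OF s _ j] i by (simp add: j'(2) eq(1)[symmetric])
    finally show "s ! i ! j = t ! i ! j" using j' by simp
  qed
qed

lemma tableau_exists: "\<exists>t. t \<in> tableaux \<mu>"
proof -
  have "\<exists>t. map length t = \<mu> \<and> concat t = [a..<a + sum_list \<mu>]" for a
  proof (induction \<mu> arbitrary: a)
    case (Cons m \<mu>)
    from Cons[of "a + m"] obtain t where "map length t = \<mu>" "concat t = [a + m..<a + m + sum_list \<mu>]" by blast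
    then show ?case
      by (intro exI[of _ "[a..<a + m] # t"]) (simp add: upt_add_eq_append[of a "a + m" "sum_list \<mu>", symmetric] add.assoc[symmetric])
  qed simp
  from this[of 1] obtain t where t: "map length t = \<mu>" "concat t = [1..<1 + sum_list \<mu>]" by blast
  have "set [1..<1 + sum_list \<mu>] = {1..sum_list \<mu>}" by (auto simp del: upt.simps)
  then have "t \<in> tableaux \<mu>" unfolding tableaux_def mem_Collect_eq t by (simp del: upt.simps)
  then show ?thesis ..
qed

lemma card_column:
  assumes t: "t \<in> tableaux \<mu>"
  shows "card (column t j) = length (filter (\<lambda>l. j < l) \<mu>)"
proof -
  let ?f = "filter (\<lambda>r. j < length r) t"
  have "column t j = (\<lambda>r. r ! j) ` set ?f" by (auto simp: column_def)
  moreover have "inj_on (\<lambda>r. r ! j) (set ?f)"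
    using entry_unique(1)[OF tableau_distinct[OF t]] by (auto simp: inj_on_def)
  moreover have "distinct ?f"
  proof -
    have "distinct (removeAll [] t)" using tableau_distinct[OF t] by (simp add: distinct_concat_iff)
    then have "distinct (filter (\<lambda>r. j < length r) (removeAll [] t))" by simp
    also have "filter (\<lambda>r. j < length r) (removeAll [] t) = ?f"
      by (induction t) auto
    finally show ?thesis .
  qed
  ultimately have "card (column t j) = length ?f" by (simp only: card_image distinct_card)
  then show ?thesis using tableau_shape[OF t] by (auto simp: filter_map o_def)
qed

text \<open>A polytabloid corrected by the sign of its tableau, so that it depends only on the
  columns as sets. For a colouring that comes from no tableau the sum is empty.\<close>

definition signed_polytabloid :: "nat list \<Rightarrow> (nat \<Rightarrow> nat) \<Rightarrow> nat set list \<Rightarrow>\<^sub>0 complex" where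
  "signed_polytabloid \<mu> c = (\<Sum>s\<in>{s \<in> tableaux \<mu>. colouring_of s = c}.
     Poly_Mapping.single (tabloid s) (letter_sign (concat s)))"

lemma lookup_signed_polytabloid:
  "Poly_Mapping.lookup (signed_polytabloid \<mu> c) T =
    (\<Sum>s\<in>{s \<in> tableaux \<mu>. colouring_of s = c \<and> tabloid s = T}. letter_sign (concat s))"
proof -
  have "Poly_Mapping.lookup (signed_polytabloid \<mu> c) T =
      (\<Sum>s\<in>{s \<in> tableaux \<mu>. colouring_of s = c}. if tabloid s = T then letter_sign (concat s) else 0)"
    by (simp add: signed_polytabloid_def lookup_sum lookup_single when_def)
  also have "\<dots> = (\<Sum>s\<in>{s \<in> tableaux \<mu>. colouring_of s = c} \<inter> {s. tabloid s = T}. letter_sign (concat s))"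
    using finite_tableaux[of \<mu>] by (simp add: sum.If_cases)
  also have "{s \<in> tableaux \<mu>. colouring_of s = c} \<inter> {s. tabloid s = T}
      = {s \<in> tableaux \<mu>. colouring_of s = c \<and> tabloid s = T}" by auto
  finally show ?thesis .
qed

text \<open>The tableaux with the columns of \<open>t\<close> are exactly the images of
  \<open>t\<close> under its column stabilizer, and a permutation changes the sign of the reading
  word by its own sign.\<close>

lemma signed_polytabloid_eq:
  assumes t: "t \<in> tableaux \<mu>"
  shows "signed_polytabloid \<mu> (colouring_of t) = scale (letter_sign (concat t)) (polytabloid t)"
proof -
  let ?A = "{1..sum_list \<mu>}"
  let ?S = "{s \<in> tableaux \<mu>. colouring_of s = colouring_of t}"
  have st: "\<pi> permutes ?A" "\<pi> ` column t j = column t j" if "\<pi> \<in> column_stabilizer t" for \<pi> j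
    using that tableau_set[OF t] by (auto simp: column_stabilizer_def)
  have inj: "inj_on (\<lambda>\<pi>. map (map \<pi>) t) (column_stabilizer t)"
  proof (rule inj_onI)
    fix \<pi> \<rho> assume *: "\<pi> \<in> column_stabilizer t" "\<rho> \<in> column_stabilizer t" "map (map \<pi>) t = map (map \<rho>) t"
    then have "map \<pi> (concat t) = map \<rho> (concat t)" by (metis map_concat)
    then have "\<forall>x\<in>set (concat t). \<pi> x = \<rho> x" by (simp only: map_eq_conv)
    then have "\<pi> x = \<rho> x" if "x \<in> ?A" for x using that by (simp only: tableau_set[OF t])
    moreover have "\<pi> x = \<rho> x" if "x \<notin> ?A" for x
      using that st(1)[OF *(1)] st(1)[OF *(2)] by (simp add: permutes_not_in)
    ultimately show "\<pi> = \<rho>" by (metis ext)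
  qed
  have into: "map (map \<pi>) t \<in> ?S" if \<pi>: "\<pi> \<in> column_stabilizer t" for \<pi>
  proof -
    note p = st(1)[OF \<pi>]
    have "colouring_of t (inv_into UNIV \<pi> x) = colouring_of t x" for x
    proof (cases "x \<in> ?A")
      case True
      then have "x \<in> column t (colouring_of t x)" by (simp add: column_colouring[OF t])
      then have "x \<in> \<pi> ` column t (colouring_of t x)" using st(2)[OF \<pi>] by simp
      then have "inv_into UNIV \<pi> x \<in> column t (colouring_of t x)" by (auto simp: permutes_inverses[OF p])
      then show ?thesis by (simp add: column_colouring[OF t])
    next
      case False
      then show ?thesis by (simp add: permutes_not_in[OF permutes_inv[OF p]])
    qed
    then show ?thesis using map_tableau[OF t p] by (simp add: o_def)
  qed
  have onto: "s \<in> (\<lambda>\<pi>. map (map \<pi>) t) ` column_stabilizer t" if s: "s \<in> ?S" for s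
  proof -
    let ?u = "concat t" and ?w = "concat s"
    have s': "s \<in> tableaux \<mu>" "colouring_of s = colouring_of t" using s by auto
    have len: "length ?u = length ?w"
      using tableau_shape[OF t] tableau_shape[OF s'(1)] by (simp add: length_concat)
    have bu: "bij_betw ((!) ?u) {..<length ?u} ?A" and bw: "bij_betw ((!) ?w) {..<length ?u} ?A"
      using tableau_distinct[OF t] tableau_set[OF t] tableau_distinct[OF s'(1)] tableau_set[OF s'(1)] len
      by (auto intro!: bij_betw_nth)
    \<comment> \<open>The permutation that carries the reading word of \<open>t\<close> to that of
      \<open>s\<close>.\<close>
    define \<pi> where "\<pi> x = (if x \<in> ?A then ?w ! inv_into {..<length ?u} ((!) ?u) x else x)" for x
    have "bij_betw ((!) ?w \<circ> inv_into {..<length ?u} ((!) ?u)) ?A ?A"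
      by (rule bij_betw_trans[OF bij_betw_inv_into[OF bu] bw])
    then have "bij_betw \<pi> ?A ?A" by (rule bij_betw_cong[THEN iffD1, rotated]) (simp add: \<pi>_def)
    then have p: "\<pi> permutes ?A" by (rule bij_imp_permutes) (simp only: \<pi>_def if_False)
    have "map \<pi> ?u = ?w"
    proof (rule nth_equalityI)
      fix i assume "i < length (map \<pi> ?u)"
      then have i: "i < length ?u" by simp
      then have "?u ! i \<in> ?A" using tableau_set[OF t] nth_mem by blast
      moreover have "inv_into {..<length ?u} ((!) ?u) (?u ! i) = i"
        using bu i by (intro inv_into_f_f) (auto simp: bij_betw_def)
      ultimately show "map \<pi> ?u ! i = ?w ! i" using i by (simp add: \<pi>_def)
    qed (simp add: len)
    then have "concat (map (map \<pi>) t) = concat s" by (simp add: map_concat)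
    moreover have lens: "map length (map (map \<pi>) t) = map length s"
      using tableau_shape[OF t] tableau_shape[OF s'(1)] by (simp add: o_def)
    then have "length (map (map \<pi>) t) = length s" by (metis length_map)
    moreover have "\<forall>(x, y)\<in>set (zip (map (map \<pi>) t) s). length x = length y"
    proof (intro ballI, clarify)
      fix x y assume "(x, y) \<in> set (zip (map (map \<pi>) t) s)"
      then obtain i where i: "x = map (map \<pi>) t ! i" "y = s ! i" "i < length t" "i < length s"
        by (auto simp: in_set_zip)
      have "length x = map length (map (map \<pi>) t) ! i" using i by simp
      also have "\<dots> = length y" unfolding lens using i by simp
      finally show "length x = length y" .
    qed
    ultimately have eq: "map (map \<pi>) t = s" by (rule concat_injective)
    have "\<pi> ` column t j = column t j" for j
    proof -
      have "\<pi> ` column t j = column (map (map \<pi>) t) j"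
      proof -
        have "column u j = (\<lambda>r. r ! j) ` {r \<in> set u. j < length r}" for u by (auto simp: column_def)
        moreover have "{r \<in> set (map (map \<pi>) t). j < length r} = map \<pi> ` {r \<in> set t. j < length r}" by auto
        ultimately show ?thesis by (simp add: image_image cong: image_cong_simp)
      qed
      also have "\<dots> = column t j" by (simp add: eq column_colouring[OF t] column_colouring[OF s'(1)] s'(2))
      finally show ?thesis .
    qed
    then have "\<pi> \<in> column_stabilizer t" using p tableau_set[OF t] by (simp add: column_stabilizer_def)
    then show ?thesis using eq by blast
  qed
  have "bij_betw (\<lambda>\<pi>. map (map \<pi>) t) (column_stabilizer t) ?S"
    using inj into onto by (auto simp: bij_betw_def)
  then have "signed_polytabloid \<mu> (colouring_of t) = (\<Sum>\<pi>\<in>column_stabilizer t.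
      Poly_Mapping.single (tabloid (map (map \<pi>) t)) (letter_sign (concat (map (map \<pi>) t))))"
    unfolding signed_polytabloid_def by (rule sum.reindex_bij_betw[symmetric])
  also have "\<dots> = (\<Sum>\<pi>\<in>column_stabilizer t. scale (letter_sign (concat t))
      (Poly_Mapping.single (tabloid (map (map \<pi>) t)) (of_int (sign \<pi>))))"
    using map_tableau(3)[OF t st(1)] by (intro sum.cong) (auto intro!: poly_mapping_eqI simp: lookup_scale lookup_single when_def)
  also have "\<dots> = scale (letter_sign (concat t)) (polytabloid t)"
    unfolding polytabloid_def by (rule pm.scale_sum_right[symmetric])
  finally show ?thesis .
qed

text \<open>
  The terms are indexed by a letter \<open>x\<close> and a tableau with \<open>x\<close> in column \<open>i\<close>. Exchanging \<open>x\<close> with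
  the entry of its row in column \<open>j\<close> is an involution of the index set that reverses the sign.\<close>

lemma garnir:
  assumes "j < i"
  shows "recolor {1..sum_list \<mu>} i j (\<lambda>c. Poly_Mapping.lookup (signed_polytabloid \<mu> c) T) c = 0"
proof -
  let ?A = "{1..sum_list \<mu>}"
  let ?B = "\<lambda>x. {s \<in> tableaux \<mu>. colouring_of s = c(x := i) \<and> tabloid s = T}"
  let ?I = "Sigma {x \<in> ?A. c x = j} ?B"
  \<comment> \<open>The entry in column \<open>j\<close> of the row of \<open>x\<close>. On the
    index set it exists because \<open>x\<close> lies in column \<open>i\<close> of that row and
    \<open>j\<close> < \<open>i\<close>.\<close>
  define y where "y x s = (THE y. \<exists>r\<in>set s. x \<in> set r \<and> j < length r \<and> y = r ! j)" for x and s :: "nat list list"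
  define \<phi> where "\<phi> = (\<lambda>(x, s). (y x s, map (map (transpose x (y x s))) s))"
  have y_eq: "y x s = r ! j" if s: "s \<in> tableaux \<mu>" and r: "r \<in> set s" "x \<in> set r" "j < length r" for x s r
    unfolding y_def
  proof (rule the_equality)
    fix z assume "\<exists>r\<in>set s. x \<in> set r \<and> j < length r \<and> z = r ! j"
    then obtain r' where r': "r' \<in> set s" "x \<in> set r'" "z = r' ! j" by blast
    then have "r' = r" using entry_unique(1)[OF tableau_distinct[OF s]] r by (metis in_set_conv_nth)
    then show "z = r ! j" using r' by simp
  qed (use r in auto)
  have step: "\<phi> p \<in> ?I" "\<phi> (\<phi> p) = p" "letter_sign (concat (snd (\<phi> p))) = - letter_sign (concat (snd p))"
    if p_in: "p \<in> ?I" for p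
  proof -
    obtain x s where p: "p = (x, s)" by (cases p)
    have x: "x \<in> ?A" "c x = j" and s: "s \<in> tableaux \<mu>" "colouring_of s = c(x := i)" "tabloid s = T"
      using p_in p by auto
    obtain r where r: "r \<in> set s" "i < length r" "x = r ! i"
      using tableau_entry[OF s(1) x(1)] by (auto simp: s(2))
    have jr: "j < length r" using assms r by simp
    have y: "y x s = r ! j" using y_eq[OF s(1) r(1) _ jr, of x] r by simp
    let ?y = "r ! j"
    have "colouring_of s ?y = j" by (rule colouring_of_nth[OF s(1) r(1) jr])
    then have yx: "?y \<noteq> x" and cy: "c ?y = j" using assms s(2) by (auto split: if_splits)
    have yA: "?y \<in> ?A" by (rule entry_in_range[OF s(1) r(1) jr])
    let ?t = "transpose x ?y"
    have t: "?t permutes ?A" using x yA by (intro permutes_swap_id)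
    note m = map_tableau[OF s(1) t]
    have "inv_into UNIV ?t = ?t" by simp
    then have col: "colouring_of (map (map ?t) s) = c(?y := i)"
      using yx x cy by (auto simp: m(2) s(2) fun_eq_iff transpose_def)
    have xr: "x \<in> set r" "?y \<in> set r" using r jr by auto
    \<comment> \<open>Both exchanged letters belong to the row \<open>r\<close>, so the tabloid does
      not change.\<close>
    have "?t ` set r' = set r'" if r': "r' \<in> set s" for r'
    proof (cases "r' = r")
      case True
      then show ?thesis using xr by (auto simp: transpose_def image_iff)
    next
      case False
      then have "set r' \<inter> set r = {}"
        using r' r(1) tableau_distinct[OF s(1)] unfolding distinct_concat_iff by blast
      then have "x \<notin> set r'" "?y \<notin> set r'" using xr by blast+
      then have "\<forall>z\<in>set r'. ?t z = z" by (auto simp: transpose_def)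
      then show ?thesis by force
    qed
    then have tab: "tabloid (map (map ?t) s) = T"
      using s(3) by (auto simp: m(4) tabloid_def)
    show "\<phi> p \<in> ?I" using m(1) col tab yA cy by (simp add: \<phi>_def p y)
    have "y ?y (map (map ?t) s) = map ?t r ! j"
      by (rule y_eq[OF m(1)]) (use r xr jr in \<open>auto simp: image_iff intro!: bexI[of _ x]\<close>)
    then have "y ?y (map (map ?t) s) = x" using jr by simp
    then show "\<phi> (\<phi> p) = p" by (simp add: \<phi>_def p y o_def transpose_commute[of ?y x])
    have "sign ?t = -1" using yx by (simp add: sign_swap_id)
    then show "letter_sign (concat (snd (\<phi> p))) = - letter_sign (concat (snd p))"
      using m(3) by (simp add: \<phi>_def p y)
  qed
  have "recolor ?A i j (\<lambda>c. Poly_Mapping.lookup (signed_polytabloid \<mu> c) T) c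
      = (\<Sum>p\<in>?I. letter_sign (concat (snd p)))"
    unfolding recolor_def lookup_signed_polytabloid
    using finite_tableaux[of \<mu>] by (subst sum.Sigma) (auto intro!: sum.cong)
  moreover have "(\<Sum>p\<in>?I. letter_sign (concat (snd p))) = (\<Sum>p\<in>?I. - letter_sign (concat (snd p)))"
    by (rule sum.reindex_bij_witness[where i = \<phi> and j = \<phi>]) (use step in auto)
  ultimately show ?thesis by (simp add: sum_negf)
qed

definition relabel_tabloids :: "(nat \<Rightarrow> nat) \<Rightarrow> (nat set list \<Rightarrow>\<^sub>0 complex) \<Rightarrow> nat set list \<Rightarrow>\<^sub>0 complex" where
  "relabel_tabloids \<sigma> p = (\<Sum>b\<in>Poly_Mapping.keys p. Poly_Mapping.single (map ((`) \<sigma>) b) (Poly_Mapping.lookup p b))"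

lemma lookup_relabel_tabloids:
  "Poly_Mapping.lookup (relabel_tabloids \<sigma> p) T = lin_ext (\<lambda>b. if map ((`) \<sigma>) b = T then 1 else 0) p"
  by (simp add: relabel_tabloids_def lookup_sum lookup_single when_def lin_ext_def if_distrib cong: if_cong)

text \<open>The letter sign in the definition turns the plain action on tabloids into the action on
  colourings twisted by the sign.\<close>

lemma relabel_tabloids_signed_polytabloid:
  assumes "\<sigma> permutes {1..sum_list \<mu>}"
  shows "relabel_tabloids \<sigma> (signed_polytabloid \<mu> c)
    = scale (of_int (sign \<sigma>)) (signed_polytabloid \<mu> (c \<circ> inv_into UNIV \<sigma>))"
proof (rule poly_mapping_eqI)
  fix T
  let ?S = "\<lambda>c. {s \<in> tableaux \<mu>. colouring_of s = c}" and ?s = "inv_into UNIV \<sigma>"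
  note inv = permutes_inv[OF assms]
  have comp: "map (map \<sigma>) (map (map ?s) u) = u" "map (map ?s) (map (map \<sigma>) u) = u" for u
    using permutes_inv_o[OF assms] by (simp_all add: o_def map_idI permutes_inverses[OF assms])
  have colour: "(c \<circ> ?s) \<circ> inv_into UNIV ?s = c"
    using permutes_inv_o[OF inv] by (simp add: o_assoc[symmetric])
  have "Poly_Mapping.lookup (relabel_tabloids \<sigma> (signed_polytabloid \<mu> c)) T
      = (\<Sum>s\<in>?S c. letter_sign (concat s) * (if map ((`) \<sigma>) (tabloid s) = T then 1 else 0))"
    by (simp add: lookup_relabel_tabloids signed_polytabloid_def linear_functional_sum[OF linear_functional_lin_ext])
  also have "\<dots> = (\<Sum>s\<in>?S (c \<circ> ?s). of_int (sign \<sigma>) * (if tabloid s = T then letter_sign (concat s) else 0))"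
  proof (rule sum.reindex_bij_witness[where i = "map (map ?s)" and j = "map (map \<sigma>)"])
    fix s assume s: "s \<in> ?S c"
    then have s': "s \<in> tableaux \<mu>" by simp
    show "map (map ?s) (map (map \<sigma>) s) = s" by (rule comp)
    show "map (map \<sigma>) s \<in> ?S (c \<circ> ?s)" using map_tableau[OF s' assms] s by simp
    show "of_int (sign \<sigma>) * (if tabloid (map (map \<sigma>) s) = T then letter_sign (concat (map (map \<sigma>) s)) else 0)
        = letter_sign (concat s) * (if map ((`) \<sigma>) (tabloid s) = T then 1 else 0)"
      unfolding map_tableau(3,4)[OF s' assms]
      by (simp add: mult.assoc[symmetric] of_int_mult[symmetric] del: of_int_mult)
  next
    fix s assume s: "s \<in> ?S (c \<circ> ?s)"
    then show "map (map ?s) s \<in> ?S c" using map_tableau[OF _ inv, of s] colour by simp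
    show "map (map \<sigma>) (map (map ?s) s) = s" by (rule comp)
  qed
  also have "\<dots> = Poly_Mapping.lookup (scale (of_int (sign \<sigma>)) (signed_polytabloid \<mu> (c \<circ> ?s))) T"
    by (simp add: lookup_scale signed_polytabloid_def lookup_sum lookup_single when_def sum_distrib_left)
  finally show "Poly_Mapping.lookup (relabel_tabloids \<sigma> (signed_polytabloid \<mu> c)) T
    = Poly_Mapping.lookup (scale (of_int (sign \<sigma>)) (signed_polytabloid \<mu> (c \<circ> ?s))) T" .
qed

section \<open>Shape of the non-combs\<close>

fun bracket_count :: "'x bword \<Rightarrow> nat" where
  "bracket_count (Letter x) = 0"
| "bracket_count (Bracket ws) = Suc (sum_list (map bracket_count ws))"

lemma length_letters:
  assumes "n \<ge> 1" "nary n w"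
  shows "length (letters w) = bracket_count w * (n - 1) + 1"
  using assms(2)
proof (induction w)
  case (Bracket ws)
  have "length (letters (Bracket ws)) = (\<Sum>w\<leftarrow>ws. bracket_count w * (n - 1) + 1)"
    using Bracket by (auto simp: length_concat o_def intro!: arg_cong[where f = sum_list])
  also have "\<dots> = sum_list (map bracket_count ws) * (n - 1) + length ws"
    by (induction ws) (auto simp: algebra_simps)
  also have "\<dots> = bracket_count (Bracket ws) * (n - 1) + 1"
    using Bracket.prems assms(1) by (cases n) simp_all
  finally show ?case .
qed simp

lemma bracket_count_0: "bracket_count w = 0 \<Longrightarrow> \<exists>x. w = Letter x"
  by (cases w) auto

lemma all_letters: "(\<And>w. w \<in> set ws \<Longrightarrow> bracket_count w = 0) \<Longrightarrow> \<exists>xs. ws = map Letter xs"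
proof (induction ws)
  case (Cons w ws)
  then obtain x xs where "w = Letter x" "ws = map Letter xs" using bracket_count_0[of w] by auto
  then have "w # ws = map Letter (x # xs)" by simp
  then show ?case by (rule exI)
qed simp

lemma bracket_count_1:
  assumes "bracket_count w = 1"
  obtains xs where "w = Bracket (map Letter xs)"
proof (cases w)
  case (Bracket ws)
  then have "\<And>u. u \<in> set ws \<Longrightarrow> bracket_count u = 0" using assms by (simp add: sum_list_eq_0_iff)
  then obtain xs where "ws = map Letter xs" using all_letters by blast
  then show ?thesis using Bracket that by simp
qed (use assms in simp)

lemma two_entries:
  assumes "i < length ws" "j < length ws" "i \<noteq> j"
  obtains rest where "mset ws = mset (ws ! i # ws ! j # rest)"
proof -
  let ?u = "take i ws @ drop (Suc i) ws"
  have u: "mset ws = add_mset (ws ! i) (mset ?u)"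
    using assms(1) by (metis id_take_nth_drop mset.simps(2) mset_append union_mset_add_mset_right)
  have "ws ! j \<in> set ?u"
  proof (cases "j < i")
    case True
    then show ?thesis using assms by (auto simp: in_set_conv_nth intro!: exI[of _ j])
  next
    case False
    then have "ws ! j = drop (Suc i) ws ! (j - Suc i)" "j - Suc i < length (drop (Suc i) ws)"
      using assms by auto
    then have "ws ! j \<in> set (drop (Suc i) ws)" by (metis nth_mem)
    then show ?thesis by simp
  qed
  then obtain p q where "?u = p @ ws ! j # q" by (meson split_list)
  then have "mset ws = mset (ws ! i # ws ! j # p @ q)" using u by simp
  then show ?thesis by (rule that)
qed

text \<open>Two long entries contain a bracket each, and one bracket surrounds them. With three
  brackets in all, no non-comb can therefore sit strictly inside another bracket.\<close>

lemma noncomb_bracket_count: "noncomb w \<Longrightarrow> n \<ge> 1 \<Longrightarrow> nary n w \<Longrightarrow> bracket_count w \<ge> 3"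
proof (induction rule: noncomb.induct)
  case (two_brackets i ws j)
  have pos: "bracket_count (ws ! m) \<ge> 1" if "m < length ws" "length (letters (ws ! m)) > 1" for m
    using that two_brackets.prems length_letters[of n "ws ! m"] by (cases "bracket_count (ws ! m)") auto
  obtain rest where "mset ws = mset (ws ! i # ws ! j # rest)" using two_entries two_brackets.hyps by metis
  then have "sum_list (map bracket_count ws) = sum_list (map bracket_count (ws ! i # ws ! j # rest))"
    by (metis mset_map sum_mset_sum_list)
  then show ?case using pos[of i] pos[of j] two_brackets.hyps by simp
next
  case (inner w ws)
  have "bracket_count w \<le> sum_list (map bracket_count ws)"
    using inner.hyps by (intro member_le_sum_list) auto
  then show ?case using inner by auto
qed

text \<open>The number of letters forces exactly three brackets. The outermost one and the two long
  entries use them up, so all other entries are letters. The order of the entries stays open, hence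
  the multisets.\<close>

lemma noncomb_shape:
  assumes n: "n \<ge> 2" and w: "w \<in> bracketed_perms n A" and nc: "noncomb w" and A: "card A = 3 * n - 2"
  obtains ws U V W where "w = Bracket ws"
    "mset ws = mset (Bracket (map Letter U) # Bracket (map Letter V) # map Letter W)"
    "length U = n" "length V = n" "length W = n - 2" "distinct (U @ V @ W)" "set (U @ V @ W) = A"
proof -
  have nary: "nary n w" and dist: "distinct (letters w)" and set: "set (letters w) = A"
    using w by (auto simp: bracketed_perms_def bwords_def)
  have "length (letters w) = 3 * n - 2" using distinct_card[OF dist] set A by simp
  moreover have "length (letters w) = bracket_count w * (n - 1) + 1"
    using length_letters[OF _ nary] n by simp
  ultimately have "bracket_count w * (n - 1) = 3 * (n - 1)" using n by linarith
  then have count: "bracket_count w = 3" using n by simp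
  from nc show ?thesis
  proof cases
    case (inner u ws)
    then have "bracket_count u \<ge> 3" using noncomb_bracket_count[of u n] n nary by auto
    moreover have "bracket_count u \<le> sum_list (map bracket_count ws)"
      using inner by (intro member_le_sum_list) auto
    ultimately show ?thesis using count inner by simp
  next
    case (two_brackets i ws j)
    have pos: "bracket_count (ws ! m) \<ge> 1" if "m < length ws" "length (letters (ws ! m)) > 1" for m
      using that two_brackets(1) nary n length_letters[of n "ws ! m"] by (cases "bracket_count (ws ! m)") auto
    obtain rest where ms: "mset ws = mset (ws ! i # ws ! j # rest)"
      using two_entries two_brackets by metis
    have "sum_list (map bracket_count ws) = sum_list (map bracket_count (ws ! i # ws ! j # rest))"
      using ms by (metis mset_map sum_mset_sum_list)
    then have sum: "bracket_count (ws ! i) + bracket_count (ws ! j) + sum_list (map bracket_count rest) = 2"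
      using count two_brackets(1) by simp
    then have one: "bracket_count (ws ! i) = 1" "bracket_count (ws ! j) = 1" and "sum_list (map bracket_count rest) = 0"
      using pos[of i] pos[of j] two_brackets by linarith+
    then obtain W where W: "rest = map Letter W" using all_letters[of rest] by (auto simp: sum_list_eq_0_iff)
    obtain U where U: "ws ! i = Bracket (map Letter U)" using one(1) by (rule bracket_count_1)
    obtain V where V: "ws ! j = Bracket (map Letter V)" using one(2) by (rule bracket_count_1)
    have "nary n (ws ! i)" "nary n (ws ! j)" "length ws = n" using nary two_brackets by auto
    then have len: "length U = n" "length V = n" "length ws = n" using U V by auto
    have "length ws = length (ws ! i # ws ! j # rest)" using ms by (rule mset_eq_length)
    then have "length W = n - 2" using len W by simp
    have "mset (letters w) = (\<Sum>u\<in>#mset ws. mset (letters u))"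
      using two_brackets(1) by (simp add: mset_concat sum_mset_sum_list[symmetric] o_def flip: mset_map)
    also have "\<dots> = mset (U @ V @ W)"
    proof -
      have "concat (map letters (map Letter zs)) = zs" for zs :: "'a list" by (induction zs) auto
      moreover have "(\<Sum>u\<in>#mset (map Letter zs). mset (letters u)) = mset zs" for zs :: "'a list"
        by (induction zs) auto
      ultimately show ?thesis unfolding ms U V W by simp
    qed
    finally have "mset (letters w) = mset (U @ V @ W)" .
    then have "distinct (U @ V @ W)" "set (U @ V @ W) = A"
      using dist set mset_eq_imp_distinct_iff mset_eq_setD by metis+
    then show ?thesis
      using that[of ws U V W] two_brackets(1) ms len \<open>length W = n - 2\<close> unfolding U V W by blast
  qed
qed

lemma noncomb_word_noncomb:
  assumes "n \<ge> 2" "length U = n" "length V = n" "length W = n - 2" "distinct (U @ V @ W)" "set (U @ V @ W) = A"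
  shows "noncomb_word U V W \<in> bracketed_perms n A" "noncomb (noncomb_word U V W)"
proof -
  have l: "concat (map letters (map Letter zs)) = zs" for zs :: "'a list" by (induction zs) auto
  then have letters: "letters (noncomb_word U V W) = U @ V @ W" by (simp add: noncomb_word_def)
  then show "noncomb_word U V W \<in> bracketed_perms n A"
    using assms by (simp add: bracketed_perms_def bwords_def) (auto simp: noncomb_word_def)
  show "noncomb (noncomb_word U V W)"
    unfolding noncomb_word_def
    by (rule two_brackets[of 0 _ 1]) (use assms l in auto)
qed

lemma letter_sign_real: "letter_sign w \<in> \<real>"
proof (induction w)
  case (Cons x w)
  have "(\<Prod>y\<leftarrow>v. of_int (sgn (int y - int x)) :: complex) \<in> \<real>" for v
    by (induction v) auto
  with Cons show ?case by simp
qed simp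

section \<open>The isomorphism\<close>

definition combination :: "'i set \<Rightarrow> ('i \<Rightarrow> 'b \<Rightarrow>\<^sub>0 complex) \<Rightarrow> ('i \<Rightarrow> complex) \<Rightarrow> 'b \<Rightarrow>\<^sub>0 complex" where
  "combination W F x = (\<Sum>c\<in>W. scale (x c) (F c))"

lemma combination_add: "combination W F x + combination W F y = combination W F (\<lambda>c. x c + y c)"
  by (simp add: combination_def sum.distrib pm.scale_left_distrib)

lemma combination_scale: "scale a (combination W F x) = combination W F (\<lambda>c. a * x c)"
  by (simp only: combination_def pm.scale_sum_right pm.scale_scale)

lemma combination_diff: "combination W F x - combination W F y = combination W F (\<lambda>c. x c - y c)"
  by (simp add: combination_def sum_subtractf pm.scale_left_diff_distrib)

lemma linear_combination: "linear_functional l \<Longrightarrow> l (combination W F x) = (\<Sum>c\<in>W. x c * l (F c))"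
  by (simp add: combination_def linear_functional_sum) (simp add: linear_functional_def)

lemma range_combination:
  assumes "finite W"
  shows "range (combination W F) = pm.span (F ` W)"
proof
  show "range (combination W F) \<subseteq> pm.span (F ` W)"
    unfolding combination_def
    by (intro subsetI, elim rangeE, simp only:, intro pm.span_sum pm.span_scale pm.span_base imageI)
  have "pm.subspace (range (combination W F))"
    unfolding pm.subspace_def
  proof (intro conjI ballI allI)
    show "0 \<in> range (combination W F)"
      by (rule range_eqI[of _ _ "\<lambda>_. 0"]) (simp only: combination_def pm.scale_zero_left sum.neutral_const)
  qed (auto simp: combination_add combination_scale)
  moreover have "F c \<in> range (combination W F)" if "c \<in> W" for c
  proof (rule range_eqI[of _ _ "\<lambda>c'. if c' = c then 1 else 0"])
    have "combination W F (\<lambda>c'. if c' = c then 1 else 0) = (\<Sum>c'\<in>W. if c' = c then F c' else 0)"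
      unfolding combination_def by (intro sum.cong refl) (simp add: pm.scale_one[unfolded id_def] del: mult_1)
    then show "F c = combination W F (\<lambda>c'. if c' = c then 1 else 0)"
      using assms that by simp
  qed
  ultimately show "pm.span (F ` W) \<subseteq> range (combination W F)" by (intro pm.span_minimal) auto
qed

abbreviation (input) target_shape :: "nat \<Rightarrow> nat list" where
  "target_shape n \<equiv> replicate (n - 2) 3 @ [2, 1, 1]"

lemma sum_shape: "n \<ge> 2 \<Longrightarrow> sum_list (target_shape n) = 3 * n - 2"
  by (simp add: sum_list_replicate)

definition tabloids :: "nat list \<Rightarrow> nat set list set" where
  "tabloids \<mu> = tabloid ` tableaux \<mu>"

lemma tabloids_relabel:
  assumes "\<sigma> permutes {1..sum_list \<mu>}"
  shows "bij_betw (map ((`) \<sigma>)) (tabloids \<mu>) (tabloids \<mu>)"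
proof -
  have closed: "map ((`) \<tau>) T \<in> tabloids \<mu>" if \<tau>: "\<tau> permutes {1..sum_list \<mu>}" and T: "T \<in> tabloids \<mu>" for \<tau> T
  proof -
    obtain t where t: "t \<in> tableaux \<mu>" "T = tabloid t" using T by (auto simp: tabloids_def)
    show ?thesis unfolding t(2) map_tableau(4)[OF t(1) \<tau>, symmetric] tabloids_def
      using map_tableau(1)[OF t(1) \<tau>] by blast
  qed
  let ?s = "inv_into UNIV \<sigma>"
  have "map ((`) ?s) (map ((`) \<sigma>) T) = T" "map ((`) \<sigma>) (map ((`) ?s) T) = T" for T
    by (simp_all add: o_def image_image permutes_inverses[OF assms])
  then show ?thesis
    using closed[OF assms] closed[OF permutes_inv[OF assms]]
    by (intro bij_betw_byWitness[where f' = "map ((`) ?s)"]) auto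
qed

lemma colouring_of_weight:
  assumes n: "n \<ge> 2" and t: "t \<in> tableaux (target_shape n)"
  shows "colouring_of t \<in> colourings {1..3 * n - 2} (n + 1) (n - 1) (n - 2)"
proof -
  let ?A = "{1..3 * n - 2}" and ?\<mu> = "target_shape n"
  have "cnt ?A (colouring_of t) j = length (filter (\<lambda>l. j < l) ?\<mu>)" for j
    using card_column[OF t, of j] unfolding column_colouring[OF t] sum_shape[OF n] cnt_def .
  moreover have "int (length (filter (\<lambda>l. j < l) ?\<mu>)) = three_colours (n + 1) (n - 1) (n - 2) j" for j
    using n by (auto simp: three_colours_def filter_replicate)
  ultimately have "of_weight ?A (n + 1) (n - 1) (n - 2) (colouring_of t)" by (simp add: of_weight_def)
  moreover have "colouring_of t x = 0" if "x \<notin> ?A" for x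
    using that colouring_of_outside[OF t] by (simp only: sum_shape[OF n])
  ultimately show ?thesis by (simp only: colourings_def mem_Collect_eq) blast
qed

lemma tableau_of_colouring:
  assumes n: "n \<ge> 2" and c: "c \<in> colourings {1..3 * n - 2} (n + 1) (n - 1) (n - 2)"
  shows "\<exists>t\<in>tableaux (target_shape n). colouring_of t = c"
proof -
  let ?A = "{1..3 * n - 2}" and ?\<mu> = "target_shape n"
  obtain t where t: "t \<in> tableaux ?\<mu>" using tableau_exists by blast
  obtain \<sigma> where \<sigma>: "\<sigma> permutes ?A" "c = colouring_of t \<circ> \<sigma>"
    using colourings_transitive[OF _ c colouring_of_weight[OF n t]] by blast
  have s: "inv_into UNIV \<sigma> permutes {1..sum_list ?\<mu>}" unfolding sum_shape[OF n] using \<sigma>(1) by (rule permutes_inv)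
  have "colouring_of (map (map (inv_into UNIV \<sigma>)) t) = c"
    unfolding map_tableau(2)[OF t s] \<sigma>(2) using permutes_inv_inv[OF \<sigma>(1)] by simp
  then show ?thesis using map_tableau(1)[OF t s] by blast
qed

text \<open>The highest weight equations are the relations of \<open>garnir\<close>. Some
  coefficient is nonzero because a tableau is the only one with its colouring and its
  tabloid.\<close>

lemma specht_kernel:
  assumes n: "n \<ge> 2"
  shows "invariant_kernel {1..3 * n - 2} (n + 1) (n - 1) (n - 2)
    (\<lambda>c. Poly_Mapping.lookup (signed_polytabloid (target_shape n) c)) (tabloids (target_shape n))"
proof
  let ?\<mu> = "target_shape n" and ?A = "{1..3 * n - 2}"
  let ?E = "\<lambda>c. Poly_Mapping.lookup (signed_polytabloid ?\<mu> c)"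
  note A = sum_shape[OF n]
  show "finite ?A" "finite (tabloids ?\<mu>)" using finite_tableaux by (simp_all add: tabloids_def)
  show "?E c t \<in> \<real>" for c t
    unfolding lookup_signed_polytabloid by (rule sum_in_Reals) (rule letter_sign_real)
  show "highest ?A (\<lambda>c. ?E c t)" for t
    using garnir[where \<mu> = ?\<mu>] unfolding highest_def A by (simp add: fun_eq_iff)
  show "\<exists>t\<in>tabloids ?\<mu>. ?E c t \<noteq> 0" if c: "c \<in> colourings ?A (n + 1) (n - 1) (n - 2)" for c
  proof -
    obtain t where t: "t \<in> tableaux ?\<mu>" "colouring_of t = c" using tableau_of_colouring[OF n c] by blast
    have "{s \<in> tableaux ?\<mu>. colouring_of s = c \<and> tabloid s = tabloid t} = {t}"
      using t tableau_unique[OF _ t(1)] by auto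
    then have "?E c (tabloid t) = letter_sign (concat t)" by (simp add: lookup_signed_polytabloid)
    moreover have "letter_sign (concat t) \<noteq> 0" using letter_sign_square[OF tableau_distinct[OF t(1)]] by auto
    ultimately show ?thesis using t(1) unfolding tabloids_def by (metis image_eqI)
  qed
  show "\<exists>\<tau>. bij_betw \<tau> (tabloids ?\<mu>) (tabloids ?\<mu>) \<and>
      (\<forall>c. \<forall>t\<in>tabloids ?\<mu>. ?E (c \<circ> \<sigma>) (\<tau> t) = of_int (sign \<sigma>) * ?E c t)" if \<sigma>: "\<sigma> permutes ?A" for \<sigma>
  proof (intro exI conjI allI ballI)
    let ?s = "inv_into UNIV \<sigma>"
    have s: "?s permutes {1..sum_list ?\<mu>}" unfolding A using \<sigma> by (rule permutes_inv)
    show "bij_betw (map ((`) ?s)) (tabloids ?\<mu>) (tabloids ?\<mu>)" by (rule tabloids_relabel[OF s])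
    fix c T
    have inj: "map ((`) ?s) b = map ((`) ?s) T \<longleftrightarrow> b = T" for b
      by (rule inj_map_eq_map) (use permutes_inj[OF s] in \<open>auto intro!: injI simp: inj_image_eq_iff\<close>)
    have sgn: "sign ?s = sign \<sigma>" by (rule sign_inverse) (use \<sigma> permutation_permutes in blast)
    have "?E c T = Poly_Mapping.lookup (relabel_tabloids ?s (signed_polytabloid ?\<mu> c)) (map ((`) ?s) T)"
      unfolding lookup_relabel_tabloids inj lin_ext_def by (auto simp: in_keys_iff if_distrib cong: if_cong)
    also have "\<dots> = of_int (sign \<sigma>) * ?E (c \<circ> \<sigma>) (map ((`) ?s) T)"
      unfolding relabel_tabloids_signed_polytabloid[OF s] lookup_scale sgn permutes_inv_inv[OF \<sigma>] ..
    finally show "?E (c \<circ> \<sigma>) (map ((`) ?s) T) = of_int (sign \<sigma>) * ?E c T"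
      by (simp add: mult.assoc[symmetric] of_int_mult[symmetric] del: of_int_mult)
  qed
qed

lemma relabel_tabloids_combination:
  "relabel_tabloids \<sigma> (combination W F x) = combination W (\<lambda>c. relabel_tabloids \<sigma> (F c)) x"
proof (rule poly_mapping_eqI)
  fix T
  show "Poly_Mapping.lookup (relabel_tabloids \<sigma> (combination W F x)) T
      = Poly_Mapping.lookup (combination W (\<lambda>c. relabel_tabloids \<sigma> (F c)) x) T"
    unfolding lookup_relabel_tabloids linear_combination[OF linear_functional_lin_ext]
    by (simp add: combination_def lookup_sum lookup_scale lookup_relabel_tabloids)
qed

lemma specht_carrier:
  assumes n: "n \<ge> 2"
  defines "W \<equiv> colourings {1..3 * n - 2} (n + 1) (n - 1) (n - 2)"
  shows "linear_image (specht (target_shape n)) id (range (combination W (signed_polytabloid (target_shape n))))"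
    "act (specht (target_shape n)) = relabel_tabloids"
proof -
  let ?\<mu> = "target_shape n"
  let ?sp = "signed_polytabloid ?\<mu>"
  have W: "finite W" unfolding W_def by (rule finite_colourings) simp
  have keys: "Poly_Mapping.keys (?sp c) \<subseteq> tabloids ?\<mu>" for c
    unfolding signed_polytabloid_def tabloids_def
    by (rule order_trans[OF Poly_Mapping.keys_sum]) auto
  have poly: "polytabloid t = scale (letter_sign (concat t)) (?sp (colouring_of t))" if "t \<in> tableaux ?\<mu>" for t
    by (simp only: signed_polytabloid_eq[OF that] pm.scale_scale letter_sign_square[OF tableau_distinct[OF that]] pm.scale_one)
  have W_tableau: "colouring_of t \<in> W" if "t \<in> tableaux ?\<mu>" for t
    unfolding W_def using that by (rule colouring_of_weight[OF n])
  have "pm.span (polytabloid ` tableaux ?\<mu>) = pm.span (?sp ` W)"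
  proof (rule antisym; rule pm.span_minimal)
    show "polytabloid ` tableaux ?\<mu> \<subseteq> pm.span (?sp ` W)"
    proof (rule image_subsetI)
      fix t assume t: "t \<in> tableaux ?\<mu>"
      show "polytabloid t \<in> pm.span (?sp ` W)"
        unfolding poly[OF t] by (intro pm.span_scale pm.span_base imageI W_tableau[OF t])
    qed
    show "?sp ` W \<subseteq> pm.span (polytabloid ` tableaux ?\<mu>)"
    proof
      fix p assume "p \<in> ?sp ` W"
      then obtain t where t: "t \<in> tableaux ?\<mu>" "p = ?sp (colouring_of t)"
        using tableau_of_colouring[OF n] unfolding W_def by blast
      show "p \<in> pm.span (polytabloid ` tableaux ?\<mu>)"
        unfolding t(2) signed_polytabloid_eq[OF t(1)] by (intro pm.span_scale pm.span_base imageI t(1))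
    qed
  qed auto
  moreover have "polytabloid ` tableaux ?\<mu> \<subseteq> {p. Poly_Mapping.keys p \<subseteq> tabloids ?\<mu>}"
  proof clarify
    fix t b assume t: "t \<in> tableaux ?\<mu>" and "b \<in> Poly_Mapping.keys (polytabloid t)"
    then have "b \<in> Poly_Mapping.keys (?sp (colouring_of t))" by (auto simp: poly[OF t] in_keys_iff lookup_scale)
    then show "b \<in> tabloids ?\<mu>" using keys by blast
  qed
  ultimately show "linear_image (specht ?\<mu>) id (range (combination W ?sp))"
    unfolding range_combination[OF W] specht_def permutation_module_def tabloids_def[symmetric]
    using linear_image_spanned_rep[OF linear_image_free_rep, of "polytabloid ` tableaux ?\<mu>" "tabloids ?\<mu>"] by simp
  show "act (specht ?\<mu>) = relabel_tabloids"
    by (simp add: specht_def permutation_module_def free_rep_def relabel_tabloids_def fun_eq_iff)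
qed

section \<open>Non-combs modulo the ideal, tested by the functionals that annihilate it\<close>

locale noncombs =
  fixes n :: nat
  assumes n: "n \<ge> 2"
begin

definition "A = {1..3 * n - 2}"
definition "W = colourings A (n + 1) (n - 1) (n - 2)"

sublocale filippov n A
  using n by (intro filippov_nat) simp

abbreviation "coset x \<equiv> J +>\<^bsub>free_nary n A\<^esub> x"

text \<open>The element at which an annihilating functional takes the value
  \<open>word_functional.v\<close>, so that identities for these functions become congruences modulo
  the ideal.\<close>

definition noncomb_vector :: "(nat \<Rightarrow> nat) \<Rightarrow> nat bword \<Rightarrow>\<^sub>0 complex" where
  "noncomb_vector c = (if of_weight A n n (n - 2) c
     then let U = class_list A c 0; V = class_list A c 1; W = class_list A c 2
       in Poly_Mapping.single (noncomb_word U V W) (letter_sign (U @ V @ W))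
     else 0)"

text \<open>The counterpart of \<open>recolor A 1 0\<close> before a functional is applied. For
  \<open>c\<close> in \<open>W\<close> these are the generators that are matched with the signed
  polytabloids.\<close>

definition exchange_vector :: "(nat \<Rightarrow> nat) \<Rightarrow> nat bword \<Rightarrow>\<^sub>0 complex" where
  "exchange_vector c = (\<Sum>x\<in>{x\<in>A. c x = 0}. noncomb_vector (c(x := 1)))"

definition annihilator :: "((nat bword \<Rightarrow>\<^sub>0 complex) \<Rightarrow> complex) \<Rightarrow> bool" where
  "annihilator l \<longleftrightarrow> linear_functional l \<and> (\<forall>x\<in>J. l x = 0)"

lemma finite_A: "finite A" and card_A: "card A = 3 * n - 2" and finite_W: "finite W"
  by (simp_all add: A_def W_def finite_colourings)

lemma ideal_iff: "y \<in> J \<longleftrightarrow> (\<forall>l. annihilator l \<longrightarrow> l y = 0)"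
proof
  assume *: "\<forall>l. annihilator l \<longrightarrow> l y = 0"
  show "y \<in> J"
  proof (rule ccontr)
    assume "y \<notin> J"
    then obtain l where l: "linear_functional l" "\<And>x. x \<in> J \<Longrightarrow> l x = 0" "l y \<noteq> 0"
      by (rule subspace_separation[OF ideal_subspace]) blast
    then have "annihilator l" unfolding annihilator_def by blast
    with * l(3) show False by blast
  qed
qed (simp add: annihilator_def)

definition "noncomb_value l = word_functional.v A n (\<lambda>w. l (basis_vec w))"

context
  fixes l assumes l: "annihilator l"
begin

interpretation L: word_functional A n "\<lambda>w. l (basis_vec w)"
  using l finite_A n by (intro word_functional_linear) (auto simp: annihilator_def)

lemma annihilator_scale: "l (scale a p) = a * l p" and annihilator_linear: "linear_functional l"
  using l by (auto simp: annihilator_def linear_functional_def)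

lemma annihilator_single: "l (Poly_Mapping.single w a) = a * l (basis_vec w)"
  using annihilator_scale[of a "basis_vec w"] by simp

lemma annihilator_vector: "l (noncomb_vector c) = noncomb_value l c"
  unfolding noncomb_value_def noncomb_vector_def L.v_def L.signed_noncomb_def Let_def
  using linear_functional_zero[OF annihilator_linear]
    annihilator_single[of "noncomb_word (class_list A c 0) (class_list A c 1) (class_list A c 2)"
      "letter_sign (class_list A c 0 @ class_list A c 1 @ class_list A c 2)"]
  by (cases "of_weight A n n (n - 2) c") (simp_all only: if_True if_False)

lemma annihilator_exchange: "l (exchange_vector c) = recolor A 1 0 (noncomb_value l) c"
  by (simp add: exchange_vector_def recolor_def linear_functional_sum[OF annihilator_linear] annihilator_vector)

lemma noncomb_value_eq:
  assumes "coloured_lists A c U V W'" "length U = n" "length V = n" "length W' = n - 2"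
  shows "noncomb_value l c = letter_sign (U @ V @ W') * l (basis_vec (noncomb_word U V W'))"
  unfolding noncomb_value_def L.v_eq[OF assms] L.signed_noncomb_def ..

lemma noncomb_value_quadratic: "recolor A 0 1 (recolor A 1 0 (noncomb_value l)) c = 2 * noncomb_value l c"
  using L.v_quadratic by (simp add: noncomb_value_def)

lemma highest_noncomb_value: "highest A (recolor A 1 0 (noncomb_value l))"
  unfolding highest_def
proof (intro allI impI)
  fix i j :: nat assume "j < i" "i \<le> 2"
  then consider "i = 1" "j = 0" | "i = 2" "j = 0" | "i = 2" "j = 1" by linarith
  then show "recolor A i j (recolor A 1 0 (noncomb_value l)) = (\<lambda>_. 0)"
    unfolding noncomb_value_def by cases (simp_all only: L.exchange_highest)
qed

end

lemma annihilator_letter_act: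
  assumes l: "annihilator l" and \<sigma>: "\<sigma> permutes A"
  shows "annihilator (\<lambda>p. l (letter_act \<sigma> p))"
  using l ideal_letter_act[OF \<sigma>] permutes_bij[OF \<sigma>]
  by (simp add: annihilator_def linear_functional_def letter_act_add letter_act_scale)

text \<open>Relabelling a word multiplies its letter sign by the sign of \<open>\<sigma>\<close>:
  the same twist as for signed polytabloids.\<close>

lemma noncomb_value_letter_act:
  assumes l: "annihilator l" and \<sigma>: "\<sigma> permutes A"
  shows "noncomb_value (\<lambda>p. l (letter_act \<sigma> p)) c = of_int (sign \<sigma>) * noncomb_value l (c \<circ> inv_into UNIV \<sigma>)"
proof (cases "of_weight A n n (n - 2) c")
  case True
  let ?U = "class_list A c 0" and ?V = "class_list A c 1" and ?W = "class_list A c 2"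
  note cl = class_lists_coloured[OF finite_A True]
  have coloured: "coloured_lists A (c \<circ> inv_into UNIV \<sigma>) (map \<sigma> ?U) (map \<sigma> ?V) (map \<sigma> ?W)"
  proof -
    have "distinct (map \<sigma> (?U @ ?V @ ?W))" "set (map \<sigma> (?U @ ?V @ ?W)) = A"
      using cl(1) permutes_inj_on[OF \<sigma>] permutes_image[OF \<sigma>]
      unfolding coloured_lists_def by (simp_all only: distinct_map set_map)
    then show ?thesis
      using cl(1) unfolding coloured_lists_def by (simp add: permutes_inverses[OF \<sigma>])
  qed
  have word: "map_bword \<sigma> (noncomb_word ?U ?V ?W) = noncomb_word (map \<sigma> ?U) (map \<sigma> ?V) (map \<sigma> ?W)"
    by (simp add: noncomb_word_def)
  have "letter_sign (map \<sigma> (?U @ ?V @ ?W)) = of_int (sign \<sigma>) * letter_sign (?U @ ?V @ ?W)"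
    using cl(1) unfolding coloured_lists_def by (intro letter_sign_map[OF \<sigma> finite_A]) blast+
  then have s: "letter_sign (map \<sigma> ?U @ map \<sigma> ?V @ map \<sigma> ?W) = of_int (sign \<sigma>) * letter_sign (?U @ ?V @ ?W)"
    by simp
  have "noncomb_value (\<lambda>p. l (letter_act \<sigma> p)) c = letter_sign (?U @ ?V @ ?W) * l (basis_vec (map_bword \<sigma> (noncomb_word ?U ?V ?W)))"
    using noncomb_value_eq[OF annihilator_letter_act[OF l \<sigma>] cl] by simp
  moreover have "noncomb_value l (c \<circ> inv_into UNIV \<sigma>)
      = of_int (sign \<sigma>) * letter_sign (?U @ ?V @ ?W) * l (basis_vec (noncomb_word (map \<sigma> ?U) (map \<sigma> ?V) (map \<sigma> ?W)))"
    using noncomb_value_eq[OF l coloured] cl(2-4) s by simp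
  ultimately show ?thesis
    unfolding word by (simp add: mult.assoc[symmetric] of_int_mult[symmetric] del: of_int_mult)
next
  case False
  then have "noncomb_vector c = 0" by (simp add: noncomb_vector_def)
  moreover have "\<not> of_weight A n n (n - 2) (c \<circ> inv_into UNIV \<sigma>)"
    using False by (simp add: of_weight_def cnt_comp_permutes[OF permutes_inv[OF \<sigma>]])
  then have "noncomb_vector (c \<circ> inv_into UNIV \<sigma>) = 0" by (simp add: noncomb_vector_def)
  ultimately show ?thesis
    using annihilator_vector[OF l, of "c \<circ> inv_into UNIV \<sigma>"]
      annihilator_vector[OF annihilator_letter_act[OF l \<sigma>], of c]
      linear_functional_zero[OF annihilator_linear[OF l]]
      linear_functional_zero[OF annihilator_linear[OF annihilator_letter_act[OF l \<sigma>]]]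
    by simp
qed

lemma exchange_letter_act:
  assumes l: "annihilator l" and \<sigma>: "\<sigma> permutes A"
  shows "l (letter_act \<sigma> (exchange_vector c)) = of_int (sign \<sigma>) * recolor A 1 0 (noncomb_value l) (c \<circ> inv_into UNIV \<sigma>)"
proof -
  have "l (letter_act \<sigma> (exchange_vector c)) = recolor A 1 0 (noncomb_value (\<lambda>p. l (letter_act \<sigma> p))) c"
    by (rule annihilator_exchange[OF annihilator_letter_act[OF l \<sigma>]])
  also have "noncomb_value (\<lambda>p. l (letter_act \<sigma> p)) = (\<lambda>c. of_int (sign \<sigma>) * noncomb_value l (c \<circ> inv_into UNIV \<sigma>))"
    by (simp add: noncomb_value_letter_act[OF l \<sigma>] fun_eq_iff)
  also have "recolor A 1 0 \<dots> c = of_int (sign \<sigma>) * recolor A 1 0 (noncomb_value l) (c \<circ> inv_into UNIV \<sigma>)"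
    unfolding recolor_mult recolor_comp_permutes[OF permutes_inv[OF \<sigma>]] ..
  finally show ?thesis .
qed

end

context noncombs
begin

definition "N = {w \<in> bracketed_perms n A. noncomb w}"

lemma noncomb_vector_span: "noncomb_vector c \<in> pm.span (basis_vec ` N)"
proof (cases "of_weight A n n (n - 2) c")
  case True
  let ?w = "noncomb_word (class_list A c 0) (class_list A c 1) (class_list A c 2)"
  note cl = class_lists_coloured[OF finite_A True]
  have "?w \<in> N"
    using noncomb_word_noncomb[OF n cl(2-4), of A] cl(1) by (simp add: N_def coloured_lists_def)
  moreover have "noncomb_vector c = scale (letter_sign (class_list A c 0 @ class_list A c 1 @ class_list A c 2)) (basis_vec ?w)"
    using True by (simp add: noncomb_vector_def Let_def)
  ultimately show ?thesis by (simp only:) (intro pm.span_scale pm.span_base imageI)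
qed (simp add: noncomb_vector_def pm.span_zero)

lemma exchange_vector_span: "exchange_vector c \<in> pm.span (basis_vec ` N)"
  unfolding exchange_vector_def by (intro pm.span_sum noncomb_vector_span)

lemma recolour_in_W:
  assumes "of_weight A n n (n - 2) c" "\<And>x. x \<notin> A \<Longrightarrow> c x = 0" "x \<in> A" "c x = 1"
  shows "c(x := 0) \<in> W"
proof -
  have "of_weight A (n + 1) (n - 1) (n - 2) (c(x := 0))"
  proof (rule of_weight_upd[OF finite_A assms(3), where i = 1])
    show "of_weight A n n (n - 2) ((c(x := 0))(x := 1))" using assms(1,4) by (simp add: fun_upd_idem)
  qed (use n in \<open>auto simp: three_colours_def\<close>)
  then show ?thesis using assms(2) by (simp add: W_def colourings_def)
qed

text \<open>\<open>v_quadratic\<close> as a congruence: modulo the ideal, twice a signed non-comb is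
  the sum of the exchange vectors obtained by moving one letter from the second class into the
  first. Antisymmetry puts the entries of the outer bracket into standard order.\<close>

lemma noncomb_word_reduction:
  assumes w: "w \<in> N"
  shows "\<exists>z \<in> pm.span (exchange_vector ` W). basis_vec w - z \<in> J"
proof -
  obtain ws U V W' where ws: "w = Bracket ws"
    and ms: "mset ws = mset (Bracket (map Letter U) # Bracket (map Letter V) # map Letter W')"
    and len: "length U = n" "length V = n" "length W' = n - 2"
    and d: "distinct (U @ V @ W')" "set (U @ V @ W') = A"
    using noncomb_shape[OF n _ _ card_A] w unfolding N_def by blast
  let ?us = "Bracket (map Letter U) # Bracket (map Letter V) # map Letter W'"
  have "mset ?us = mset ws" by (simp only: ms)
  then obtain \<sigma> where \<sigma>: "\<sigma> permutes {..<length ws}" "permute_list \<sigma> ws = ?us"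
    by (rule mset_eq_permutation)
  have "length ws = n" "set ws \<subseteq> bwords n A"
    using w unfolding N_def ws by (auto simp: bracketed_perms_def bwords_def)
  then have red: "basis_vec w - scale (of_int (sign \<sigma>)) (basis_vec (noncomb_word U V W')) \<in> J"
    using basis_antisymmetry[of ws \<sigma>] \<sigma> unfolding ws noncomb_word_def by simp
  define c where "c x = (if x \<in> set V then 1 else if x \<in> set W' then 2 else 0 :: nat)" for x
  have c: "coloured_lists A c U V W'" using d by (auto simp: coloured_lists_def c_def)
  have weight: "of_weight A n n (n - 2) c" using coloured_lists_weight[OF c] len by simp
  have outside: "c x = 0" if "x \<notin> A" for x using that d(2) by (auto simp: c_def)
  let ?s = "letter_sign (U @ V @ W')"
  \<comment> \<open>The factor 1/2 inverts the eigenvalue in \<open>v_quadratic\<close>,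
    \<open>?s\<close> removes the letter sign and the sign of \<open>\<sigma>\<close> undoes the
    reordering of the entries.\<close>
  define z where "z = scale (of_int (sign \<sigma>) * ?s / 2) (\<Sum>x\<in>{x\<in>A. c x = 1}. exchange_vector (c(x := 0)))"
  have "z \<in> pm.span (exchange_vector ` W)"
    unfolding z_def using recolour_in_W[OF weight outside]
    by (intro pm.span_scale pm.span_sum pm.span_base) auto
  moreover have "basis_vec w - z \<in> J"
    unfolding ideal_iff
  proof (intro allI impI)
    fix l assume l: "annihilator l"
    note lin = annihilator_linear[OF l]
    have "l (\<Sum>x\<in>{x\<in>A. c x = 1}. exchange_vector (c(x := 0))) = 2 * noncomb_value l c"
      unfolding noncomb_value_quadratic[OF l, symmetric]
      by (simp only: linear_functional_sum[OF lin] annihilator_exchange[OF l] recolor_def[of A 0 1])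
    then have "l z = of_int (sign \<sigma>) * (?s * ?s) * l (basis_vec (noncomb_word U V W'))"
      unfolding z_def annihilator_scale[OF l] noncomb_value_eq[OF l c len] by simp
    also have "?s * ?s = 1" using d(1) by (rule letter_sign_square)
    finally have "l z = of_int (sign \<sigma>) * l (basis_vec (noncomb_word U V W'))" by simp
    moreover have "l (basis_vec w - scale (of_int (sign \<sigma>)) (basis_vec (noncomb_word U V W'))) = 0"
      using red l by (simp only: annihilator_def)
    ultimately show "l (basis_vec w - z) = 0"
      by (simp only: linear_functional_diff[OF lin] annihilator_scale[OF l])
  qed
  ultimately show ?thesis by blast
qed

text \<open>One inclusion holds before passing to cosets, since exchange vectors are combinations of
  non-combs; the other is \<open>noncomb_word_reduction\<close>, extended to the span.\<close>

lemma coset_spans: "(\<lambda>x. coset x) ` pm.span (basis_vec ` N) = range (\<lambda>x. coset (combination W exchange_vector x))"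
proof -
  let ?E = "pm.span (exchange_vector ` W)"
  have "pm.subspace {y. \<exists>z\<in>?E. y - z \<in> J}"
    unfolding pm.subspace_def
  proof (intro conjI ballI allI)
    show "0 \<in> {y. \<exists>z\<in>?E. y - z \<in> J}"
      using pm.span_zero pm.subspace_0[OF ideal_subspace] by force
    fix y y' assume "y \<in> {y. \<exists>z\<in>?E. y - z \<in> J}" "y' \<in> {y. \<exists>z\<in>?E. y - z \<in> J}"
    then obtain z z' where z: "z \<in> ?E" "y - z \<in> J" "z' \<in> ?E" "y' - z' \<in> J" by blast
    have "(y + y') - (z + z') = (y - z) + (y' - z')" by simp
    then have "(y + y') - (z + z') \<in> J" using z pm.subspace_add[OF ideal_subspace] by metis
    then show "y + y' \<in> {y. \<exists>z\<in>?E. y - z \<in> J}" using z pm.span_add by blast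
  next
    fix a y assume "y \<in> {y. \<exists>z\<in>?E. y - z \<in> J}"
    then obtain z where z: "z \<in> ?E" "y - z \<in> J" by blast
    have "scale a y - scale a z = scale a (y - z)" by (rule pm.scale_right_diff_distrib[symmetric])
    then have "scale a y - scale a z \<in> J" using z pm.subspace_scale[OF ideal_subspace] by metis
    then show "scale a y \<in> {y. \<exists>z\<in>?E. y - z \<in> J}" using z pm.span_scale by blast
  qed
  then have "pm.span (basis_vec ` N) \<subseteq> {y. \<exists>z\<in>?E. y - z \<in> J}"
    using noncomb_word_reduction by (intro pm.span_minimal) auto
  then have "\<exists>z\<in>?E. coset y = coset z" if "y \<in> pm.span (basis_vec ` N)" for y
    using that coset_eq_iff by blast
  then have 1: "(\<lambda>x. coset x) ` pm.span (basis_vec ` N) \<subseteq> (\<lambda>x. coset x) ` ?E" by blast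
  have "?E \<subseteq> pm.span (basis_vec ` N)"
    using exchange_vector_span by (intro pm.span_minimal) auto
  with 1 have "(\<lambda>x. coset x) ` pm.span (basis_vec ` N) = (\<lambda>x. coset x) ` ?E" by blast
  then show ?thesis unfolding range_combination[OF finite_W, symmetric] by (simp add: image_image)
qed

text \<open>A coordinate of the evaluation in the cross product algebra is nonzero at one non-comb;
  by \<open>v_quadratic\<close> the associated highest weight function cannot vanish either.\<close>

lemma noncomb_value_nonzero: "\<exists>l c. annihilator l \<and> c \<in> W \<and> recolor A 1 0 (noncomb_value l) c \<noteq> 0"
proof -
  define f where "f = (\<lambda>x. if x \<le> n then x - 1 else if x < 2 * n then x - n - 1 else if x = 2 * n then n else x - 2 * n - 1)"
  define l where "l = (\<lambda>p. evaluation n f p (n - 2))"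
  have l: "annihilator l"
    unfolding annihilator_def l_def using linear_evaluation evaluation_ideal n by auto
  let ?U = "[1..<n + 1]" and ?V = "[n + 1..<2 * n + 1]" and ?W = "[2 * n + 1..<3 * n - 1]"
  define c where "c x = (if x \<in> set ?V then 1 else if x \<in> set ?W then 2 else 0 :: nat)" for x
  have c: "coloured_lists A c ?U ?V ?W"
    using n by (auto simp: coloured_lists_def c_def A_def simp del: upt.simps)
  have len: "length ?U = n" "length ?V = n" "length ?W = n - 2" using n by (simp_all del: upt.simps)
  have weight: "of_weight A n n (n - 2) c" using coloured_lists_weight[OF c] len by (simp del: upt.simps)
  have outside: "c x = 0" if "x \<notin> A" for x using that n by (auto simp: c_def A_def simp del: upt.simps)
  have "letter_sign (?U @ ?V @ ?W) \<noteq> 0"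
    using letter_sign_square[of "?U @ ?V @ ?W"] c unfolding coloured_lists_def by fastforce
  moreover have "l (basis_vec (noncomb_word ?U ?V ?W)) \<noteq> 0"
    using noncomb_evaluation_nonzero[OF n] by (simp add: l_def f_def evaluation_def del: upt.simps)
  ultimately have "noncomb_value l c \<noteq> 0" unfolding noncomb_value_eq[OF l c len] by simp
  then have "recolor A 0 1 (recolor A 1 0 (noncomb_value l)) c \<noteq> 0"
    unfolding noncomb_value_quadratic[OF l] by simp
  then obtain x where "x \<in> A" "c x = 1" "recolor A 1 0 (noncomb_value l) (c(x := 0)) \<noteq> 0"
    by (rule recolor_nonzero)
  then show ?thesis using recolour_in_W[OF weight outside] l by blast
qed

text \<open>On one side \<open>x\<close> is orthogonal to all coefficient functions of signed
  polytabloids, on the other to the highest weight functions of all annihilating functionals.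
  \<open>orthogonal_highest\<close> gives one direction. For the other, the annihilating functionals
  are stable under permutations, so orthogonality to one nonzero function extends to its translates
  and \<open>orthogonal_translates\<close> applies.\<close>

lemma kernels_agree:
  "combination W (signed_polytabloid (target_shape n)) x = 0 \<longleftrightarrow> combination W exchange_vector x \<in> J"
proof
  let ?sp = "signed_polytabloid (target_shape n)"
  interpret K: invariant_kernel A "n + 1" "n - 1" "n - 2" "\<lambda>c. Poly_Mapping.lookup (?sp c)" "tabloids (target_shape n)"
    unfolding A_def by (rule specht_kernel[OF n])
  have lookup: "Poly_Mapping.lookup (combination W ?sp x) T = (\<Sum>c\<in>W. x c * Poly_Mapping.lookup (?sp c) T)" for T
    by (simp add: combination_def lookup_sum lookup_scale)
  {
    assume zero: "combination W ?sp x = 0"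
    show "combination W exchange_vector x \<in> J"
      unfolding ideal_iff
    proof (intro allI impI)
      fix l assume l: "annihilator l"
      have "(\<Sum>c\<in>W. x c * recolor A 1 0 (noncomb_value l) c) = 0"
        unfolding W_def
      proof (rule K.orthogonal_highest[where x = x and g = "recolor A 1 0 (noncomb_value l)"])
        show "(\<Sum>c\<in>colourings A (n + 1) (n - 1) (n - 2). x c * Poly_Mapping.lookup (?sp c) t) = 0" for t
          unfolding W_def[symmetric] lookup[symmetric] zero by simp
      qed (rule highest_noncomb_value[OF l])
      then show "l (combination W exchange_vector x) = 0"
        by (simp add: linear_combination[OF annihilator_linear[OF l]] annihilator_exchange[OF l])
    qed
  }
  {
    assume ideal: "combination W exchange_vector x \<in> J"
    obtain l c1 where l: "annihilator l" and c1: "c1 \<in> W" "recolor A 1 0 (noncomb_value l) c1 \<noteq> 0"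
      using noncomb_value_nonzero by blast
    let ?g = "recolor A 1 0 (noncomb_value l)"
    have translates: "(\<Sum>c\<in>W. x c * ?g (c \<circ> \<sigma>)) = 0" if \<sigma>: "\<sigma> permutes A" for \<sigma>
    proof -
      let ?s = "inv_into UNIV \<sigma>"
      have s: "?s permutes A" using \<sigma> by (rule permutes_inv)
      note l' = annihilator_letter_act[OF l s]
      have "0 = l (letter_act ?s (combination W exchange_vector x))" using ideal l' by (simp add: annihilator_def)
      also have "\<dots> = (\<Sum>c\<in>W. x c * l (letter_act ?s (exchange_vector c)))"
        by (rule linear_combination[OF annihilator_linear[OF l']])
      also have "\<dots> = of_int (sign ?s) * (\<Sum>c\<in>W. x c * ?g (c \<circ> \<sigma>))"
        unfolding exchange_letter_act[OF l s] permutes_inv_inv[OF \<sigma>] by (simp add: sum_distrib_left mult_ac)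
      finally show ?thesis by (simp add: sign_def split: if_splits)
    qed
    have "Poly_Mapping.lookup (combination W ?sp x) T = 0" for T
    proof (cases "T \<in> tabloids (target_shape n)")
      case True
      show ?thesis
        unfolding lookup unfolding W_def
        by (rule K.orthogonal_translates[where x = x and g = ?g and ?c1.0 = c1,
              OF highest_noncomb_value[OF l] c1[unfolded W_def] translates[unfolded W_def] True])
    next
      case False
      then have "Poly_Mapping.lookup (?sp c) T = 0" for c
        unfolding lookup_signed_polytabloid by (intro sum.neutral) (auto simp: tabloids_def)
      then show ?thesis unfolding lookup by simp
    qed
    then show "combination W ?sp x = 0" by (intro poly_mapping_eqI) simp
  }
qed

lemma rho_tilde_image:
  "linear_image (rho_tilde n 3) (\<lambda>x. coset x) (pm.span (basis_vec ` N))"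
  "act (rho_tilde n 3) = act (free_filippov n A)"
proof -
  have A: "{1..3 * (n - 1) + 1} = A" unfolding A_def using n by (intro arg_cong[where f = "\<lambda>m. {1..m}"]) simp
  have word: "filippov_word n A ` S = (\<lambda>x. coset x) ` (basis_vec ` S)" for S
    by (simp add: filippov_word_def image_image)
  have rho: "rho n 3 = spanned_rep complex_ring (free_filippov n A) ((\<lambda>x. coset x) ` (basis_vec ` bracketed_perms n A))"
    unfolding rho_def A Let_def word ..
  have tilde: "rho_tilde n 3 = spanned_rep complex_ring (rho n 3) ((\<lambda>x. coset x) ` (basis_vec ` N))"
    unfolding rho_tilde_def A Let_def word N_def ..
  have "basis_vec ` bracketed_perms n A \<subseteq> C"
    by (auto simp: bracketed_perms_def basis_in_C)
  from linear_image_spanned_rep[OF linear_image_free_filippov this]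
  have "linear_image (rho n 3) (\<lambda>x. coset x) (pm.span (basis_vec ` bracketed_perms n A))" unfolding rho .
  then show "linear_image (rho_tilde n 3) (\<lambda>x. coset x) (pm.span (basis_vec ` N))"
    unfolding tilde by (rule linear_image_spanned_rep) (auto simp: N_def intro: pm.span_base)
  show "act (rho_tilde n 3) = act (free_filippov n A)" by (simp add: tilde rho)
qed

end

theorem theorem4p1:
  fixes n :: nat
  assumes "n \<ge> 2"
  shows "rep_isomorphic (sym_group (3 * n - 2)) complex_ring
           (rho_tilde n 3) (specht (replicate (n - 2) 3 @ [2, 1, 1]))"
proof -
  interpret noncombs n by (rule noncombs.intro) (rule assms)
  let ?sp = "signed_polytabloid (target_shape n)"
  let ?S = "\<lambda>x. coset (combination W exchange_vector x)" and ?T = "combination W ?sp"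
  \<comment> \<open>The sign-twisted action on coefficients: up to sign, \<open>\<sigma>\<close>
    sends the generator at \<open>c\<close> to the one at
    \<open>c \<circ> inv_into UNIV \<sigma>\<close>, and reindexing the sum moves
    \<open>\<sigma>\<close> into the argument of \<open>x\<close>.\<close>
  let ?h = "\<lambda>\<sigma> x c. of_int (sign \<sigma>) * x (c \<circ> \<sigma>)"
  let ?C = "pm.span (basis_vec ` N)"
  have in_span: "combination W exchange_vector x \<in> ?C" for x
    unfolding combination_def using exchange_vector_span by (intro pm.span_sum pm.span_scale)
  note V = rho_tilde_image(1)[unfolded linear_image_def]
  have specht: "linear_image (specht (target_shape n)) id (range ?T)" "act (specht (target_shape n)) = relabel_tabloids"
    unfolding W_def A_def by (rule specht_carrier[OF assms])+
  have T: "carrier (specht (target_shape n)) = range ?T"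
    "\<And>p q. p \<in> range ?T \<Longrightarrow> q \<in> range ?T \<Longrightarrow> add (specht (target_shape n)) p q = p + q"
    "\<And>a p. p \<in> range ?T \<Longrightarrow> module.smult (specht (target_shape n)) a p = scale a p"
    using specht(1) unfolding linear_image_def id_apply image_id by blast+
  have perm: "\<sigma> permutes A" if "\<sigma> \<in> carrier (sym_group (3 * n - 2))" for \<sigma>
    using that by (simp add: sym_group_carrier A_def)
  show ?thesis
  proof (rule rep_isomorphicI[where S = ?S and T = ?T and h = ?h])
    show "carrier (rho_tilde n 3) = range ?S" using V coset_spans by simp
    show "add (rho_tilde n 3) (?S x) (?S y) = ?S (\<lambda>i. x i + y i)" for x y
      using V in_span by (simp add: combination_add)
    show "module.smult (rho_tilde n 3) a (?S x) = ?S (\<lambda>i. a * x i)" for a x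
      using V in_span by (simp add: combination_scale)
    show "act (rho_tilde n 3) \<sigma> (?S x) = ?S (?h \<sigma> x)" if "\<sigma> \<in> carrier (sym_group (3 * n - 2))" for \<sigma> x
    proof -
      note \<sigma> = perm[OF that]
      have "letter_act \<sigma> (combination W exchange_vector x) - combination W exchange_vector (?h \<sigma> x) \<in> J"
        unfolding ideal_iff
      proof (intro allI impI)
        fix l assume l: "annihilator l"
        let ?g = "recolor A 1 0 (noncomb_value l)"
        have "l (letter_act \<sigma> (combination W exchange_vector x))
            = (\<Sum>c\<in>W. x c * (of_int (sign \<sigma>) * ?g (c \<circ> inv_into UNIV \<sigma>)))"
          unfolding linear_combination[OF annihilator_linear[OF annihilator_letter_act[OF l \<sigma>]]]
            exchange_letter_act[OF l \<sigma>] ..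
        also have "\<dots> = (\<Sum>c\<in>W. x (c \<circ> \<sigma>) * (of_int (sign \<sigma>) * ?g (c \<circ> \<sigma> \<circ> inv_into UNIV \<sigma>)))"
          unfolding W_def by (rule sum_colourings_comp[OF \<sigma>, symmetric])
        also have "\<dots> = (\<Sum>c\<in>W. ?h \<sigma> x c * ?g c)"
          by (simp add: comp_assoc permutes_inv_o[OF \<sigma>] mult_ac)
        also have "\<dots> = l (combination W exchange_vector (?h \<sigma> x))"
          by (simp add: linear_combination[OF annihilator_linear[OF l]] annihilator_exchange[OF l])
        finally show "l (letter_act \<sigma> (combination W exchange_vector x) - combination W exchange_vector (?h \<sigma> x)) = 0"
          by (simp add: linear_functional_diff[OF annihilator_linear[OF l]])
      qed
      then show ?thesis
        unfolding rho_tilde_image(2) act_free_filippov[OF \<sigma>] coset_eq_iff .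
    qed
    show "carrier (specht (replicate (n - 2) 3 @ [2, 1, 1])) = range ?T" by (rule T(1))
    show "add (specht (replicate (n - 2) 3 @ [2, 1, 1])) (?T x) (?T y) = ?T (\<lambda>i. x i + y i)" for x y
      by (simp only: T(2) rangeI combination_add)
    show "module.smult (specht (replicate (n - 2) 3 @ [2, 1, 1])) a (?T x) = ?T (\<lambda>i. a * x i)" for a x
      by (simp only: T(3) rangeI combination_scale)
    show "act (specht (replicate (n - 2) 3 @ [2, 1, 1])) \<sigma> (?T x) = ?T (?h \<sigma> x)"
      if "\<sigma> \<in> carrier (sym_group (3 * n - 2))" for \<sigma> x
    proof -
      note \<sigma> = perm[OF that]
      have \<sigma>': "\<sigma> permutes {1..sum_list (target_shape n)}" using \<sigma> by (simp only: sum_shape[OF assms] A_def)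
      have "relabel_tabloids \<sigma> (?T x) = (\<Sum>c\<in>W. scale (x c) (scale (of_int (sign \<sigma>)) (?sp (c \<circ> inv_into UNIV \<sigma>))))"
        unfolding relabel_tabloids_combination unfolding combination_def
          relabel_tabloids_signed_polytabloid[OF \<sigma>'] ..
      also have "\<dots> = (\<Sum>c\<in>W. scale (x (c \<circ> \<sigma>)) (scale (of_int (sign \<sigma>)) (?sp (c \<circ> \<sigma> \<circ> inv_into UNIV \<sigma>))))"
        unfolding W_def by (rule sum_colourings_comp[OF \<sigma>, symmetric])
      also have "\<dots> = ?T (?h \<sigma> x)"
        unfolding combination_def pm.scale_scale comp_assoc permutes_inv_o[OF \<sigma>] comp_id
        by (simp only: mult.commute)
      finally show ?thesis unfolding specht(2) .
    qed
    show "?S x = ?S y \<longleftrightarrow> ?T x = ?T y" for x y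
      unfolding coset_eq_iff combination_diff kernels_agree[symmetric]
      unfolding combination_diff[symmetric] by simp
  qed
qed

end
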